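(* Let $T$ be a homogeneous Poisson point process on $\mathbb{R}$ with rate $\gamma>0$, and let $G$ be a non-degenerate probability distribution on $[0,1]$. Then $\Psi_G(T)\stackrel{D}{=}T$ if and only if $G=\mathrm{B}(r,1-r)$ for some $0<r<1$.
   Context: $\stackrel{D}{=}$ denotes equality in distribution of point processes. A distribution is non-degenerate if it is not concentrated at a single point. $\mathrm{B}(\alpha,\beta)$ is the Beta distribution with density $\frac{\Gamma(\alpha+\beta)}{\Gamma(\alpha)\Gamma(\beta)}x^{\alpha-1}(1-x)^{\beta-1}$, $x\in(0,1)$. Neighbour-dependent shift operator with division distribution $G$: for a countable subset $T$ of $\mathbb{R}$ without accumulation points (unbounded in both directions), let $\mathcal{I}(T)$ be the set of open intervals between consecutive points of $T$. Set $\Psi_GT=\bigcup_{I\in\mathcal{I}(T)}\{c(I)\}$, where $c(I)=x+b_I(y-x)$ for $I=(x,y)$ and the $b_I$ are i.i.d. with distribution $G$, independent of $T$. *)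

theory Defs
  imports "HOL-Probability.Probability"
begin

definition configs :: "real set set" where
  "configs = {T. countable T \<and> (\<forall>x. \<not> x islimpt T) \<and> \<not> bdd_above T \<and> \<not> bdd_below T}"

text \<open>The sigma-algebra generated by the counting variables \<open>T \<mapsto> #(T \<inter> B)\<close> for bounded Borel
  sets \<open>B\<close>. A point process is a random element of this space, and two point processes are equal in
  distribution iff their push-forwards to it agree. On \<open>configs\<close> the sets \<open>T \<inter> B\<close> are finite,
  so \<open>card\<close> is the true number of points.\<close>

definition config_space :: "real set measure" where
  "config_space = sigma configs
     {{T \<in> configs. card (T \<inter> B) = k} | B k. B \<in> sets borel \<and> bounded B}"

text \<open>The first clause makes \<open>T\<close> take values in \<open>configs\<close> everywhere on \<open>M\<close> (not just almost surely).
  The count law is written out because \<open>poisson_pmf\<close> is unspecified at rate 0, which occurs here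
  for Lebesgue-null \<open>B\<close>.\<close>

definition homogeneous_poisson_process :: "'w measure \<Rightarrow> real \<Rightarrow> ('w \<Rightarrow> real set) \<Rightarrow> bool" where
  "homogeneous_poisson_process M \<gamma> T \<longleftrightarrow>
     T \<in> M \<rightarrow>\<^sub>M config_space \<and>
     (\<forall>B k. B \<in> sets borel \<and> bounded B \<longrightarrow>
        measure M {\<omega> \<in> space M. card (T \<omega> \<inter> B) = k} =
          (\<gamma> * measure lborel B) ^ k / fact k * exp (- (\<gamma> * measure lborel B))) \<and>
     (\<forall>(B :: nat \<Rightarrow> real set) n.
        (\<forall>i<n. B i \<in> sets borel \<and> bounded (B i)) \<and> disjoint_family_on B {..<n} \<longrightarrow>
        prob_space.indep_vars M (\<lambda>_. count_space UNIV) (\<lambda>i \<omega>. card (T \<omega> \<inter> B i)) {..<n})"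

text \<open>Pairs \<open>(x, y)\<close> stand for the open intervals between consecutive points.\<close>

definition gaps :: "real set \<Rightarrow> (real \<times> real) set" where
  "gaps T = {(x, y). x \<in> T \<and> y \<in> T \<and> x < y \<and> T \<inter> {x<..<y} = {}}"

text \<open>The order isomorphism from a configuration to the integers under which the largest
  nonpositive point gets index 0. The gaps are labelled by the index of their left endpoint, so
  that the division variables attached to them can be a family indexed by the integers.\<close>

definition point_index :: "real set \<Rightarrow> real \<Rightarrow> int" where
  "point_index T x =
     (if 0 < x then int (card (T \<inter> {0<..x})) else - int (card (T \<inter> {x<..0})))"

definition neighbour_shift :: "(int \<Rightarrow> real) \<Rightarrow> real set \<Rightarrow> real set" where
  "neighbour_shift b T = (\<lambda>(x, y). x + b (point_index T x) * (y - x)) ` gaps T"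

definition division_distribution :: "real measure \<Rightarrow> bool" where
  "division_distribution G \<longleftrightarrow>
     prob_space G \<and> sets G = sets (restrict_space borel {0..1})"

definition nondegenerate :: "real measure \<Rightarrow> bool" where
  "nondegenerate G \<longleftrightarrow> \<not> (\<exists>x \<in> space G. measure G {x} = 1)"

definition beta_distribution :: "real \<Rightarrow> real \<Rightarrow> real measure" where
  "beta_distribution \<alpha> \<beta> = density (restrict_space lborel {0..1})
     (\<lambda>x. ennreal (Gamma (\<alpha> + \<beta>) / (Gamma \<alpha> * Gamma \<beta>) *
        x powr (\<alpha> - 1) * (1 - x) powr (\<beta> - 1) * indicator {0<..<1} x))"

end

theory Submission
  imports Defs
begin

text \<open>Let \<open>x\<^sub>j\<close> be the points of \<open>T\<close> in increasing order and \<open>c\<^sub>j = x\<^sub>j + b\<^sub>j (x\<^sub>j\<^sub>+\<^sub>1 - x\<^sub>j)\<close> the points of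
  the divided process. Both directions rest on one family of statistics, the expectations of
  \<open>\<Sum>j. f\<^sub>0(c\<^sub>j) f\<^sub>1(c\<^sub>j\<^sub>+\<^sub>1) \<dots> f\<^sub>k(c\<^sub>j\<^sub>+\<^sub>k)\<close>, and the same with \<open>x\<close> in place of \<open>c\<close>. The Mecke formula (theorem
  \<open>mecke\<close>), applied one point at a time from left to right, turns them into iterated integrals in
  which the successive gaps of \<open>T\<close> are independent exponentials (\<open>shifted_sum_along_expectation\<close> and
  \<open>points_sum_along_expectation\<close>). Working with these sums over all \<open>j\<close> avoids any special
  treatment of the size-biased gap that covers the origin.

  Suppose first that \<open>G\<close> is the beta distribution with parameters \<open>r\<close> and \<open>1 - r\<close>. The density of \<open>c\<close> in a gap
  \<open>(x, y)\<close>, times the exponential weight of the gap, splits as \<open>p(c - x) q(y - c)\<close> with gamma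
  kernels of shapes \<open>r\<close> and \<open>1 - r\<close>. Integrating out the points of \<open>T\<close> thus leaves between two consecutive
  \<open>c\<close> the kernel \<open>q * p = p * q\<close>, which is again the exponential one, and the two end factors cancel
  (\<open>chain_mean_beta\<close>). Hence \<open>c\<close> and \<open>x\<close> have the same statistics. The event that no point lies in
  a bounded set is a sum of such products, taken over the number of points in a window
  (\<open>void_indicator_eq_sum\<close>), and the probabilities of these void events determine the law of a point
  process (\<open>measure_eq_by_voids\<close>).

  Conversely, suppose the law is invariant. Comparing mean numbers of points shows that almost surely
  no two \<open>c\<^sub>j\<close> coincide (\<open>AE_inj_shifted\<close>), so that the statistics of \<open>c\<close> are functionals of the point
  set and equal those of \<open>x\<close>. Three consecutive points with exponential weights yield
  \<open>\<phi>(1, a) \<phi>(a, c) \<phi>(c, 1) = 1 / (a c)\<close> for \<open>\<phi>(a, c) = E (1 / (a b + c (1 - b)))\<close>, where \<open>b\<close>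
  has law \<open>G\<close>; this says that the two parts of a divided exponential gap are independent. As \<open>\<phi>\<close> is homogeneous of degree \<open>-1\<close>,
  \<open>a \<mapsto> \<phi>(a, 1)\<close> is multiplicative, hence equal to \<open>a\<^sup>-\<^sup>r\<close> with \<open>r\<close> the mean of \<open>G\<close>. Its power series at
  \<open>a = 1\<close> gives the moments of \<open>G\<close>, and these are the beta moments (\<open>beta_characterization\<close>).\<close>

section \<open>Configurations and their sigma-algebra\<close>

lemma finite_configs_Int:
  assumes T: "T \<in> configs" and B: "bounded B"
  shows "finite (T \<inter> B)"
proof -
  have "finite (closure B \<inter> T)"
    using T B by (intro finite_not_islimpt_in_compact) (auto simp: configs_def compact_closure)
  moreover have "T \<inter> B \<subseteq> closure B \<inter> T" using closure_subset[of B] by auto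
  ultimately show ?thesis by (rule rev_finite_subset)
qed

lemma configs_iff:
  "T \<in> configs \<longleftrightarrow> (\<forall>a b. finite (T \<inter> {a..b})) \<and> (\<forall>a. \<exists>x\<in>T. a < x) \<and> (\<forall>a. \<exists>x\<in>T. x < a)"
proof (intro iffI conjI allI)
  fix a b assume "T \<in> configs"
  then show "finite (T \<inter> {a..b})" by (rule finite_configs_Int) auto
next
  fix a assume "T \<in> configs"
  then have "\<not> (\<forall>x\<in>T. x \<le> a)" "\<not> (\<forall>x\<in>T. a \<le> x)"
    by (auto simp: configs_def bdd_above_def bdd_below_def)
  then show "\<exists>x\<in>T. a < x" "\<exists>x\<in>T. x < a" by (auto simp: not_le)
next
  assume *: "(\<forall>a b. finite (T \<inter> {a..b})) \<and> (\<forall>a. \<exists>x\<in>T. a < x) \<and> (\<forall>a. \<exists>x\<in>T. x < a)"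
  have "T = (\<Union>n::nat. T \<inter> {- real n..real n})"
  proof (intro equalityI subsetI)
    fix x assume "x \<in> T"
    moreover obtain n :: nat where "\<bar>x\<bar> \<le> real n" using real_arch_simple by blast
    ultimately show "x \<in> (\<Union>n::nat. T \<inter> {- real n..real n})"
      by (intro UN_I[of n]) auto
  qed auto
  moreover have "countable (\<Union>n::nat. T \<inter> {- real n..real n})"
    using * by (intro countable_UN) (auto intro: countable_finite)
  ultimately have "countable T" by simp
  moreover have "\<not> x islimpt T" for x
  proof
    assume "x islimpt T"
    moreover have "eventually (\<lambda>y. y \<in> ball x 1) (at x)" by (rule eventually_at_in_open') auto
    ultimately have "x islimpt (T \<inter> ball x 1)" by (rule islimpt_Int_eventually)
    moreover have "finite (T \<inter> ball x 1)"
      using * by (intro finite_subset[of "T \<inter> ball x 1" "T \<inter> {x-1..x+1}"]) (auto simp: dist_real_def)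
    ultimately show False by (simp add: islimpt_finite)
  qed
  moreover have "\<not> bdd_above T" "\<not> bdd_below T"
    using * by (auto simp: bdd_above_def bdd_below_def not_le)
  ultimately show "T \<in> configs" by (auto simp: configs_def)
qed

lemma insert_configs: "T \<in> configs \<Longrightarrow> insert x T \<in> configs"
  unfolding configs_iff by (auto simp: Int_insert_left)

lemma Diff_bounded_configs: "T \<in> configs \<Longrightarrow> bounded B \<Longrightarrow> T - B \<in> configs"
proof -
  assume T: "T \<in> configs" and "bounded B"
  then obtain K where "\<forall>x\<in>B. norm x \<le> K" unfolding bounded_iff by blast
  then have K: "\<And>x. x \<in> B \<Longrightarrow> \<bar>x\<bar> \<le> K" by simp
  show ?thesis
    unfolding configs_iff
  proof (intro conjI allI)
    fix a b
    show "finite ((T - B) \<inter> {a..b})"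
      by (rule finite_subset[of _ "T \<inter> {a..b}"]) (use finite_configs_Int[OF T, of "{a..b}"] in auto)
  next
    fix a
    obtain x where "x \<in> T" "max a K < x" using T unfolding configs_iff by blast
    then show "\<exists>x\<in>T - B. a < x" using K[of x] by (intro bexI[of _ x]) auto
    obtain x where "x \<in> T" "x < min a (-K)" using T unfolding configs_iff by blast
    then show "\<exists>x\<in>T - B. x < a" using K[of x] by (intro bexI[of _ x]) auto
  qed
qed

lemma space_config_space [simp]: "space config_space = configs"
  unfolding config_space_def by (rule space_measure_of) auto

definition voids :: "real set set set" where
  "voids = {{T \<in> configs. T \<inter> B = {}} | B. B \<in> sets borel \<and> bounded B}"

lemma Int_stable_voids: "Int_stable voids"
proof (rule Int_stableI)
  fix U V assume "U \<in> voids" "V \<in> voids"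
  then obtain B C where "B \<in> sets borel" "bounded B" "U = {T \<in> configs. T \<inter> B = {}}"
    "C \<in> sets borel" "bounded C" "V = {T \<in> configs. T \<inter> C = {}}"
    by (auto simp: voids_def)
  then show "U \<inter> V \<in> voids"
    unfolding voids_def by (intro CollectI exI[of _ "B \<union> C"]) auto
qed

lemma voids_Pow: "voids \<subseteq> Pow configs"
  by (auto simp: voids_def)

text \<open>A rational number below the largest element and above all others splits off that element. Rational
  cuts keep the union countable, which lets counting events be built from void events by induction.\<close>

lemma card_ge_Suc_iff_split:
  fixes S :: "real set"
  assumes "finite S"
  shows "Suc k \<le> card S \<longleftrightarrow> (\<exists>q\<in>\<rat>. k \<le> card (S \<inter> {..q}) \<and> S \<inter> {q<..} \<noteq> {})"
proof
  assume k: "Suc k \<le> card S"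
  then have "S \<noteq> {}" by auto
  define y where "y = Max S"
  have y: "y \<in> S" "\<And>x. x \<in> S \<Longrightarrow> x \<le> y" using assms \<open>S \<noteq> {}\<close> by (auto simp: y_def)
  define z where "z = Max (insert (y - 1) (S - {y}))"
  have "z \<in> insert (y - 1) (S - {y})" using assms unfolding z_def by (intro Max_in) auto
  then have z: "z < y" using y by (auto simp: less_le)
  have z': "\<And>x. x \<in> S - {y} \<Longrightarrow> x \<le> z"
    using assms by (auto simp: z_def)
  obtain q where q: "q \<in> \<rat>" "z < q" "q < y" using Rats_dense_in_real[OF z] by auto
  have "S \<inter> {..q} = S - {y}" using z z' q y by force
  then have "k \<le> card (S \<inter> {..q})" using k y assms by simp
  moreover have "S \<inter> {q<..} \<noteq> {}" using y q by auto
  ultimately show "\<exists>q\<in>\<rat>. k \<le> card (S \<inter> {..q}) \<and> S \<inter> {q<..} \<noteq> {}" using q by blast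
next
  assume "\<exists>q\<in>\<rat>. k \<le> card (S \<inter> {..q}) \<and> S \<inter> {q<..} \<noteq> {}"
  then obtain q where q: "k \<le> card (S \<inter> {..q})" "S \<inter> {q<..} \<noteq> {}" by blast
  have "card S = card (S \<inter> {..q}) + card (S \<inter> {q<..})"
    using assms by (subst card_Un_disjoint[symmetric]) (auto intro!: arg_cong[where f=card])
  moreover have "card (S \<inter> {q<..}) > 0" using q assms by (simp add: card_gt_0_iff)
  ultimately show "Suc k \<le> card S" using q(1) by linarith
qed

lemma card_ge_in_sigma_voids:
  assumes "B \<in> sets borel" "bounded B"
  shows "{T \<in> configs. k \<le> card (T \<inter> B)} \<in> sigma_sets configs voids"
  using assms
proof (induction k arbitrary: B)
  case 0
  then show ?case by (simp add: sigma_sets_top)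
next
  case (Suc k)
  interpret sigma_algebra configs "sigma_sets configs voids"
    by (rule sigma_algebra_sigma_sets[OF voids_Pow])
  \<comment> \<open>A cut at \<open>q\<close> that leaves \<open>k\<close> points of \<open>B\<close> on the left and at least one on the right.\<close>
  have eq: "{T \<in> configs. Suc k \<le> card (T \<inter> B)} =
      (\<Union>q\<in>\<rat>. {T \<in> configs. k \<le> card (T \<inter> (B \<inter> {..q}))} \<inter> (configs - {T \<in> configs. T \<inter> (B \<inter> {q<..}) = {}}))"
    using Suc.prems card_ge_Suc_iff_split[OF finite_configs_Int, of _ B k] by (auto simp: Int_assoc)
  have "{T \<in> configs. k \<le> card (T \<inter> (B \<inter> {..q}))} \<in> sigma_sets configs voids" for q
    using Suc.prems by (intro Suc.IH) (auto intro: bounded_subset)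
  moreover have "{T \<in> configs. T \<inter> (B \<inter> {q<..}) = {}} \<in> sigma_sets configs voids" for q
    using Suc.prems unfolding voids_def by (intro sigma_sets.Basic CollectI exI[of _ "B \<inter> {q<..}"]) (auto intro: bounded_subset)
  ultimately show ?case
    unfolding eq by (intro countable_UN'' Int compl_sets) (auto intro: countable_rat)
qed

text \<open>Void events alone generate the sigma-algebra. Unlike the counting events they are stable under
  intersection, so laws of point processes may be compared on them.\<close>

lemma sets_config_space: "sets config_space = sigma_sets configs voids"
proof -
  let ?C = "{{T \<in> configs. card (T \<inter> B) = k} | B k. B \<in> sets borel \<and> bounded B} :: real set set set"
  interpret sigma_algebra configs "sigma_sets configs voids"
    by (rule sigma_algebra_sigma_sets[OF voids_Pow])
  have "sets config_space = sigma_sets configs ?C"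
    unfolding config_space_def by (rule sets_measure_of) auto
  also have "\<dots> = sigma_sets configs voids"
  proof (rule sigma_sets_eqI)
    fix U assume "U \<in> ?C"
    then obtain B k where B: "B \<in> sets borel" "bounded B" "U = {T \<in> configs. card (T \<inter> B) = k}" by auto
    then have "U = {T \<in> configs. k \<le> card (T \<inter> B)} - {T \<in> configs. Suc k \<le> card (T \<inter> B)}" by auto
    then show "U \<in> sigma_sets configs voids"
      using B by (auto intro!: Diff card_ge_in_sigma_voids)
  next
    fix U assume "U \<in> voids"
    then obtain B where B: "B \<in> sets borel" "bounded B" "U = {T \<in> configs. T \<inter> B = {}}"
      by (auto simp: voids_def)
    then have "U = {T \<in> configs. card (T \<inter> B) = 0}"
      using finite_configs_Int by auto
    then show "U \<in> sigma_sets configs ?C"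
      using B by (intro sigma_sets.Basic) auto
  qed
  finally show ?thesis .
qed

lemma void_sets [measurable]:
  "B \<in> sets borel \<Longrightarrow> bounded B \<Longrightarrow> {T \<in> configs. T \<inter> B = {}} \<in> sets config_space"
  unfolding sets_config_space voids_def by (intro sigma_sets.Basic) auto

lemma measurable_card [measurable]:
  assumes "B \<in> sets borel" "bounded B"
  shows "(\<lambda>T. card (T \<inter> B)) \<in> config_space \<rightarrow>\<^sub>M count_space UNIV"
proof (rule measurable_count_space_eq2_countable[THEN iffD2], auto)
  fix k
  have "(\<lambda>T. card (T \<inter> B)) -` {k} \<inter> configs = {T \<in> configs. k \<le> card (T \<inter> B)} - {T \<in> configs. Suc k \<le> card (T \<inter> B)}"
    by auto
  also have "\<dots> \<in> sets config_space"
    using assms by (auto simp: sets_config_space[symmetric] intro!: sets.Diff card_ge_in_sigma_voids[folded sets_config_space])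
  finally show "(\<lambda>T. card (T \<inter> B)) -` {k} \<inter> configs \<in> sets config_space" .
qed

lemma measurable_config_spaceI:
  assumes "\<And>x. x \<in> space M \<Longrightarrow> f x \<in> configs"
    and "\<And>B. B \<in> sets borel \<Longrightarrow> bounded B \<Longrightarrow> {x \<in> space M. f x \<inter> B = {}} \<in> sets M"
  shows "f \<in> M \<rightarrow>\<^sub>M config_space"
proof (rule measurable_sigma_sets[OF sets_config_space voids_Pow])
  show "f \<in> space M \<rightarrow> configs" using assms(1) by auto
  fix U assume "U \<in> voids"
  then obtain B where B: "B \<in> sets borel" "bounded B" "U = {T \<in> configs. T \<inter> B = {}}"
    by (auto simp: voids_def)
  then have "f -` U \<inter> space M = {x \<in> space M. f x \<inter> B = {}}" using assms(1) by auto
  then show "f -` U \<inter> space M \<in> sets M" using assms(2) B by simp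
qed

text \<open>Renyi's theorem for these configurations: void probabilities determine the law.\<close>

lemma measure_eq_by_voids:
  assumes M: "sets M = sets config_space" and N: "sets N = sets config_space"
    and fin: "emeasure M configs \<noteq> \<infinity>"
    and eq: "\<And>B. B \<in> sets borel \<Longrightarrow> bounded B \<Longrightarrow>
      emeasure M {T \<in> configs. T \<inter> B = {}} = emeasure N {T \<in> configs. T \<inter> B = {}}"
  shows "M = N"
proof (rule measure_eqI_generator_eq[OF Int_stable_voids voids_Pow])
  have "configs \<in> voids" unfolding voids_def by (intro CollectI exI[of _ "{}"]) auto
  then show "range (\<lambda>_::nat. configs) \<subseteq> voids" by auto
  fix U assume "U \<in> voids"
  then show "emeasure M U = emeasure N U" using eq by (auto simp: voids_def)
qed (use M N fin in \<open>simp_all add: sets_config_space\<close>)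

section \<open>Enumeration of the points\<close>

text \<open>The index jumps by one at each point and is constant elsewhere; the three sign cases come from the
  convention at the origin.\<close>

lemma point_index_add:
  assumes T: "T \<in> configs" and "x \<le> y"
  shows "point_index T y = point_index T x + int (card (T \<inter> {x<..y}))"
proof -
  have un: "card (T \<inter> {a<..c}) = card (T \<inter> {a<..b}) + card (T \<inter> {b<..c})" if "a \<le> b" "b \<le> c" for a b c
    using that finite_configs_Int[OF T, of "{_<.._}"]
    by (subst card_Un_disjoint[symmetric]) (auto intro!: arg_cong[where f=card])
  consider (pos) "0 < x" | (mixed) "x \<le> 0" "0 < y" | (nonpos) "y \<le> 0" by linarith
  then show ?thesis
  proof cases
    case pos
    then show ?thesis using un[of 0 x y] \<open>x \<le> y\<close> by (simp add: point_index_def)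
  next
    case mixed
    then show ?thesis using un[of x 0 y] by (simp add: point_index_def)
  next
    case nonpos
    then show ?thesis using un[of x y 0] \<open>x \<le> y\<close> by (simp add: point_index_def)
  qed
qed

lemma point_index_mono: "T \<in> configs \<Longrightarrow> x \<le> y \<Longrightarrow> point_index T x \<le> point_index T y"
  by (simp add: point_index_add[of T x y])

lemma point_index_strict_mono:
  assumes "T \<in> configs" "x < y" "y \<in> T"
  shows "point_index T x < point_index T y"
proof -
  have "finite (T \<inter> {x<..y})" using assms by (intro finite_configs_Int) auto
  then have "0 < card (T \<inter> {x<..y})" using assms by (auto simp: card_gt_0_iff)
  then show ?thesis using assms by (simp add: point_index_add[of T x y])
qed

lemma inj_on_point_index: "T \<in> configs \<Longrightarrow> inj_on (point_index T) T"
  by (rule linorder_inj_onI) (auto dest: point_index_strict_mono)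

lemma next_point_exists:
  assumes T: "T \<in> configs"
  obtains y where "y \<in> T" "x < y" "T \<inter> {x<..<y} = {}"
proof -
  obtain z where z: "z \<in> T" "x < z" using T unfolding configs_iff by blast
  have fin: "finite (T \<inter> {x<..z})" using T by (intro finite_configs_Int) auto
  have ne: "T \<inter> {x<..z} \<noteq> {}" using z by auto
  define y where "y = Min (T \<inter> {x<..z})"
  have "y \<in> T \<inter> {x<..z}" unfolding y_def by (rule Min_in[OF fin ne])
  moreover have "y \<le> w" if "w \<in> T \<inter> {x<..z}" for w using that fin by (auto simp: y_def)
  ultimately have "T \<inter> {x<..<y} = {}" by force
  then show ?thesis using \<open>y \<in> T \<inter> {x<..z}\<close> that by auto
qed

lemma point_index_next:
  assumes T: "T \<in> configs" and "y \<in> T" "x < y" "T \<inter> {x<..<y} = {}"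
  shows "point_index T y = point_index T x + 1"
proof -
  have "T \<inter> {x<..y} = {y}" using assms by force
  then show ?thesis using assms by (simp add: point_index_add[of T x y])
qed

lemma previous_point_exists:
  assumes T: "T \<in> configs"
  obtains x where "x \<in> T" "x < y" "T \<inter> {x<..<y} = {}"
proof -
  obtain z where z: "z \<in> T" "z < y" using T unfolding configs_iff by blast
  have fin: "finite (T \<inter> {z..<y})" using T by (intro finite_configs_Int) auto
  have ne: "T \<inter> {z..<y} \<noteq> {}" using z by auto
  define x where "x = Max (T \<inter> {z..<y})"
  have "x \<in> T \<inter> {z..<y}" unfolding x_def by (rule Max_in[OF fin ne])
  moreover have "w \<le> x" if "w \<in> T \<inter> {z..<y}" for w using that fin by (auto simp: x_def)
  ultimately have "T \<inter> {x<..<y} = {}" by force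
  then show ?thesis using \<open>x \<in> T \<inter> {z..<y}\<close> that by auto
qed

text \<open>The set of indices taken on \<open>T\<close> is closed under successor and predecessor because
  every point has a next and a previous one, so it is all of the integers.\<close>

lemma bij_betw_point_index:
  assumes T: "T \<in> configs"
  shows "bij_betw (point_index T) T UNIV"
proof -
  have "j \<in> point_index T ` T" for j
  proof -
    obtain x0 where x0: "x0 \<in> T" using T unfolding configs_iff by blast
    show ?thesis
    proof (induction j rule: int_induct[of _ "point_index T x0"])
      case base then show ?case using x0 by auto
    next
      case (step1 i)
      then obtain x where x: "x \<in> T" "i = point_index T x" by auto
      obtain y where "y \<in> T" "x < y" "T \<inter> {x<..<y} = {}" using next_point_exists[OF T] .
      then show ?case using point_index_next[OF T, of y x] x by (intro image_eqI[of _ _ y]) auto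
    next
      case (step2 i)
      then obtain y where y: "y \<in> T" "i = point_index T y" by auto
      obtain x where "x \<in> T" "x < y" "T \<inter> {x<..<y} = {}" using previous_point_exists[OF T] .
      then show ?case using point_index_next[OF T, of y x] y by (intro image_eqI[of _ _ x]) auto
    qed
  qed
  then show ?thesis using inj_on_point_index[OF T] by (auto simp: bij_betw_def)
qed

definition pt :: "real set \<Rightarrow> int \<Rightarrow> real" where
  "pt T = the_inv_into T (point_index T)"

lemma bij_betw_pt: "T \<in> configs \<Longrightarrow> bij_betw (pt T) UNIV T"
  unfolding pt_def by (rule bij_betw_the_inv_into[OF bij_betw_point_index])

lemma pt_in: "T \<in> configs \<Longrightarrow> pt T j \<in> T"
  using bij_betw_pt[of T] by (auto simp: bij_betw_def)

lemma range_pt: "T \<in> configs \<Longrightarrow> range (pt T) = T"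
  using bij_betw_pt[of T] by (auto simp: bij_betw_def)

lemma point_index_pt [simp]: "T \<in> configs \<Longrightarrow> point_index T (pt T j) = j"
  unfolding pt_def using bij_betw_point_index[of T]
  by (intro f_the_inv_into_f) (auto simp: bij_betw_def)

lemma pt_point_index: "T \<in> configs \<Longrightarrow> x \<in> T \<Longrightarrow> pt T (point_index T x) = x"
  unfolding pt_def by (rule the_inv_into_f_f[OF inj_on_point_index])

text \<open>This Galois connection is what makes the enumerated points measurable: \<open>point_index\<close>
  is a count of points in a bounded set.\<close>

lemma pt_le_iff: "T \<in> configs \<Longrightarrow> pt T j \<le> a \<longleftrightarrow> j \<le> point_index T a"
  using point_index_mono[of T "pt T j" a] point_index_strict_mono[of T a "pt T j"] pt_in[of T j]
  by (auto simp: not_le[symmetric])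

lemma pt_less_iff: "T \<in> configs \<Longrightarrow> pt T i < pt T j \<longleftrightarrow> i < j"
  using pt_le_iff[of T j "pt T i"] by (auto simp: not_le[symmetric])

lemma pt_mono: "T \<in> configs \<Longrightarrow> i \<le> j \<Longrightarrow> pt T i \<le> pt T j"
  by (simp add: pt_le_iff)

lemma pt_gap: "T \<in> configs \<Longrightarrow> T \<inter> {pt T j<..<pt T (j + 1)} = {}"
proof (rule ccontr)
  assume T: "T \<in> configs" "T \<inter> {pt T j<..<pt T (j + 1)} \<noteq> {}"
  then obtain x where x: "x \<in> T" "pt T j < x" "x < pt T (j + 1)" by auto
  then obtain i where i: "x = pt T i" using range_pt[OF T(1)] by auto
  then show False using x T by (simp add: pt_less_iff)
qed

lemma gaps_eq: assumes T: "T \<in> configs" shows "gaps T = range (\<lambda>j. (pt T j, pt T (j + 1)))"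
proof (intro equalityI subsetI)
  fix g assume "g \<in> gaps T"
  then obtain x y where g: "g = (x, y)" "x \<in> T" "y \<in> T" "x < y" "T \<inter> {x<..<y} = {}"
    by (auto simp: gaps_def)
  have "point_index T y = point_index T x + 1" using g T by (intro point_index_next) auto
  then have "g = (pt T (point_index T x), pt T (point_index T x + 1))"
    using g T pt_point_index[OF T, of x] pt_point_index[OF T, of y] by simp
  then show "g \<in> range (\<lambda>j. (pt T j, pt T (j + 1)))" by blast
next
  fix g assume "g \<in> range (\<lambda>j. (pt T j, pt T (j + 1)))"
  then show "g \<in> gaps T" using T pt_gap[OF T] by (auto simp: gaps_def pt_in pt_less_iff)
qed

lemma measurable_point_index [measurable]: "(\<lambda>T. point_index T a) \<in> config_space \<rightarrow>\<^sub>M count_space UNIV"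
  unfolding point_index_def by measurable auto

lemma measurable_pt [measurable]: "(\<lambda>T. pt T j) \<in> borel_measurable config_space"
proof (rule borel_measurableI_le)
  fix a
  have "{T \<in> space config_space. pt T j \<le> a} = {T \<in> space config_space. j \<le> point_index T a}"
    by (auto simp: pt_le_iff)
  also have "\<dots> \<in> sets config_space" by measurable
  finally show "{T \<in> space config_space. pt T j \<le> a} \<in> sets config_space" .
qed

text \<open>Following next points describes a stretch of consecutive points without reference to their
  indices, so it is insensitive to where the origin lies.\<close>

definition next_point :: "real set \<Rightarrow> real \<Rightarrow> real" where
  "next_point T x = Inf (T \<inter> {x<..})"

lemma next_point_eqI: "y \<in> T \<Longrightarrow> x < y \<Longrightarrow> T \<inter> {x<..<y} = {} \<Longrightarrow> next_point T x = y"
  unfolding next_point_def by (rule cInf_eq_minimum) (auto simp: not_less[symmetric])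

lemma next_point_props:
  assumes "T \<in> configs"
  shows "next_point T x \<in> T" "x < next_point T x" "T \<inter> {x<..<next_point T x} = {}"
  using next_point_exists[OF assms, of x] next_point_eqI by metis+

lemma next_point_pt: "T \<in> configs \<Longrightarrow> next_point T (pt T j) = pt T (j + 1)"
  by (rule next_point_eqI) (auto simp: pt_in pt_less_iff pt_gap)

lemma next_point_le_iff: "T \<in> configs \<Longrightarrow> next_point T x \<le> a \<longleftrightarrow> T \<inter> {x<..a} \<noteq> {}"
  using next_point_props[of T x] by (force simp: not_less[symmetric])

lemma measurable_next_point:
  "(\<lambda>(T, x). next_point T x) \<in> borel_measurable (config_space \<Otimes>\<^sub>M borel)"
proof (rule borel_measurableI_le)
  fix a
  have "{w \<in> space (config_space \<Otimes>\<^sub>M borel). (\<lambda>(T, x). next_point T x) w \<le> a} =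
    (\<Union>q\<in>\<rat>. (configs - {T \<in> configs. T \<inter> {q<..a} = {}}) \<times> {..q})"
  proof (intro equalityI subsetI)
    fix w assume "w \<in> {w \<in> space (config_space \<Otimes>\<^sub>M borel). (\<lambda>(T, x). next_point T x) w \<le> a}"
    then obtain T x where w: "w = (T, x)" "T \<in> configs" "next_point T x \<le> a" by (auto simp: space_pair_measure)
    obtain q where "q \<in> \<rat>" "x < q" "q < next_point T x" using Rats_dense_in_real next_point_props(2)[OF w(2)] by metis
    moreover have "next_point T x \<in> T \<inter> {q<..a}"
      using w next_point_props(1)[OF w(2)] \<open>q < next_point T x\<close> by auto
    ultimately show "w \<in> (\<Union>q\<in>\<rat>. (configs - {T \<in> configs. T \<inter> {q<..a} = {}}) \<times> {..q})"
      using w by (intro UN_I[of q]) auto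
  next
    fix w assume "w \<in> (\<Union>q\<in>\<rat>. (configs - {T \<in> configs. T \<inter> {q<..a} = {}}) \<times> {..q})"
    then obtain q T x where w: "w = (T, x)" "T \<in> configs" "T \<inter> {q<..a} \<noteq> {}" "x \<le> q" by auto
    then have "T \<inter> {x<..a} \<noteq> {}" by fastforce
    then show "w \<in> {w \<in> space (config_space \<Otimes>\<^sub>M borel). (\<lambda>(T, x). next_point T x) w \<le> a}"
      using w by (simp add: space_pair_measure next_point_le_iff)
  qed
  also have "\<dots> \<in> sets (config_space \<Otimes>\<^sub>M borel)"
    by (intro sets.countable_UN'' countable_rat pair_measureI sets.Diff void_sets)
       (auto simp: space_config_space[symmetric] simp del: space_config_space)
  finally show "{w \<in> space (config_space \<Otimes>\<^sub>M borel). (\<lambda>(T, x). next_point T x) w \<le> a} \<in> sets (config_space \<Otimes>\<^sub>M borel)" .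
qed

lemma measurable_next_point' [measurable (raw)]:
  assumes "f \<in> M \<rightarrow>\<^sub>M config_space" "g \<in> borel_measurable M"
  shows "(\<lambda>w. next_point (f w) (g w)) \<in> borel_measurable M"
  using measurable_compose[OF measurable_Pair[OF assms] measurable_next_point] by simp


section \<open>The Mecke formula\<close>

lemma sum_points_indicator:
  assumes T: "T \<in> configs" and A: "bounded A"
  shows "(\<integral>\<^sup>+j. indicator A (pt T j) \<partial>count_space UNIV) = of_nat (card (T \<inter> A))"
proof -
  have "(\<integral>\<^sup>+j. indicator A (pt T j) \<partial>count_space UNIV) = (\<integral>\<^sup>+x. indicator A x \<partial>count_space T)"
    by (rule nn_integral_bij_count_space[OF bij_betw_pt[OF T]])
  also have "\<dots> = (\<Sum>x\<in>T \<inter> A. indicator A x)"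
    by (rule nn_integral_count_space') (use finite_configs_Int[OF T A] in auto)
  also have "\<dots> = of_nat (card (T \<inter> A))" by simp
  finally show ?thesis .
qed

lemma sigma_sets_bounded_borel:
  "sets borel = sigma_sets UNIV {A :: real set. A \<in> sets borel \<and> bounded A}"
proof (intro equalityI)
  have "sets borel = sigma_sets UNIV (range (\<lambda>(a, b). box a b :: real set))"
    unfolding borel_eq_box by (rule sets_measure_of) auto
  also have "\<dots> \<subseteq> sigma_sets UNIV {A. A \<in> sets borel \<and> bounded A}"
    by (rule sigma_sets_mono') (auto simp del: box_real)
  finally show "sets borel \<subseteq> sigma_sets UNIV {A :: real set. A \<in> sets borel \<and> bounded A}" .
  show "sigma_sets UNIV {A :: real set. A \<in> sets borel \<and> bounded A} \<subseteq> sets borel"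
    using sets.sigma_sets_subset[of "{A :: real set. A \<in> sets borel \<and> bounded A}" borel] by auto
qed

text \<open>Bounded Borel sets times void events form an intersection-stable generator, and only on bounded
  sets are the measures of interest finite.\<close>

lemma marked_measure_eqI:
  fixes M N :: "(real \<times> real set) measure"
  assumes sets: "sets M = sets (borel \<Otimes>\<^sub>M config_space)" "sets N = sets (borel \<Otimes>\<^sub>M config_space)"
    and eq: "\<And>A B. A \<in> sets borel \<Longrightarrow> bounded A \<Longrightarrow> B \<in> sets borel \<Longrightarrow> bounded B \<Longrightarrow>
      emeasure M (A \<times> {T \<in> configs. T \<inter> B = {}}) = emeasure N (A \<times> {T \<in> configs. T \<inter> B = {}})"
    and fin: "\<And>A. A \<in> sets borel \<Longrightarrow> bounded A \<Longrightarrow> emeasure M (A \<times> configs) \<noteq> \<infinity>"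
  shows "M = N"
proof (rule measure_eqI_generator_eq[where E = "{A \<times> V | A V. A \<in> {A :: real set. A \<in> sets borel \<and> bounded A} \<and> V \<in> voids}"
      and \<Omega> = "UNIV \<times> configs" and A = "\<lambda>n. {- real n..real n} \<times> configs"])
  let ?Ea = "{A :: real set. A \<in> sets borel \<and> bounded A}"
  let ?E = "{A \<times> V | A V. A \<in> ?Ea \<and> V \<in> voids}"
  have configs: "configs \<in> voids" unfolding voids_def by (intro CollectI exI[of _ "{}"]) auto
  show "Int_stable ?E"
  proof (rule Int_stableI)
    fix U W assume "U \<in> ?E" "W \<in> ?E"
    then obtain A V A' V' where "A \<in> ?Ea" "V \<in> voids" "U = A \<times> V" "A' \<in> ?Ea" "V' \<in> voids" "W = A' \<times> V'"
      by blast
    moreover have "V \<inter> V' \<in> voids" using calculation Int_stable_voids by (auto simp: Int_stable_def)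
    ultimately show "U \<inter> W \<in> ?E"
      by (intro CollectI exI[of _ "A \<inter> A'"] exI[of _ "V \<inter> V'"]) (auto intro: bounded_subset)
  qed
  show "?E \<subseteq> Pow (UNIV \<times> configs)" using voids_Pow by auto
  fix X assume "X \<in> ?E"
  then show "emeasure M X = emeasure N X" using eq by (auto simp: voids_def)
next
  let ?Ea = "{A :: real set. A \<in> sets borel \<and> bounded A}"
  let ?E = "{A \<times> V | A V. A \<in> ?Ea \<and> V \<in> voids}"
  have configs: "configs \<in> voids" unfolding voids_def by (intro CollectI exI[of _ "{}"]) auto
  have cover: "(\<Union>n::nat. {- real n..real n}) = UNIV"
  proof -
    have "\<exists>n::nat. - real n \<le> x \<and> x \<le> real n" for x :: real
    proof -
      obtain n :: nat where "\<bar>x\<bar> \<le> real n" using real_arch_simple by blast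
      then show ?thesis by (intro exI[of _ n]) auto
    qed
    then show ?thesis by auto
  qed
  have "sets (borel \<Otimes>\<^sub>M config_space) =
    sets (sigma (space borel \<times> space config_space) ?E)"
  proof (rule sets_pair_eq)
    show "countable (range (\<lambda>n::nat. {- real n..real n}))" by auto
    show "range (\<lambda>n::nat. {- real n..real n}) \<subseteq> ?Ea" by auto
    show "\<Union>(range (\<lambda>n::nat. {- real n..real n})) = space borel" using cover by simp
    show "countable {configs}" "{configs} \<subseteq> voids" "\<Union>{configs} = space config_space"
      using configs by auto
  qed (use voids_Pow in \<open>auto simp: sigma_sets_bounded_borel[symmetric] sets_config_space\<close>)
  also have "\<dots> = sigma_sets (UNIV \<times> configs) ?E"
    using voids_Pow by (subst sets_measure_of) auto
  finally have *: "sets (borel \<Otimes>\<^sub>M config_space) = sigma_sets (UNIV \<times> configs) ?E" .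
  show "sets M = sigma_sets (UNIV \<times> configs) ?E" "sets N = sigma_sets (UNIV \<times> configs) ?E"
    using sets * by auto
  show "range (\<lambda>n::nat. {- real n..real n} \<times> configs) \<subseteq> ?E"
  proof (rule image_subsetI)
    fix n :: nat
    show "{- real n..real n} \<times> configs \<in> ?E"
      using configs by (intro CollectI exI[of _ "{- real n..real n}"] exI[of _ configs]) auto
  qed
  show "(\<Union>n::nat. {- real n..real n} \<times> configs) = UNIV \<times> configs" using cover by auto
  show "emeasure M ({- real n..real n} \<times> configs) \<noteq> \<infinity>" for n :: nat by (rule fin) auto
qed

lemma measurable_pt_pair [measurable]:
  "(\<lambda>(j, T). pt T j) \<in> borel_measurable (count_space UNIV \<Otimes>\<^sub>M config_space)"
  by (rule measurable_pair_measure_countable1) auto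

lemma measurable_insert_point:
  "(\<lambda>(x, T). insert x T) \<in> borel \<Otimes>\<^sub>M config_space \<rightarrow>\<^sub>M config_space"
proof (rule measurable_config_spaceI)
  fix B :: "real set" assume B: "B \<in> sets borel" "bounded B"
  have "{w \<in> space (borel \<Otimes>\<^sub>M config_space). (\<lambda>(x, T). insert x T) w \<inter> B = {}} =
      (- B) \<times> {T \<in> configs. T \<inter> B = {}}"
    by (auto simp: space_pair_measure)
  also have "\<dots> \<in> sets (borel \<Otimes>\<^sub>M config_space)"
    using B by (intro pair_measureI void_sets) auto
  finally show "{w \<in> space (borel \<Otimes>\<^sub>M config_space). (\<lambda>(x, T). insert x T) w \<inter> B = {}} \<in> sets (borel \<Otimes>\<^sub>M config_space)" .
qed (auto simp: space_pair_measure insert_configs)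

lemma measurable_insert_point' [measurable (raw)]:
  assumes "f \<in> borel_measurable M" "g \<in> M \<rightarrow>\<^sub>M config_space"
  shows "(\<lambda>w. insert (f w) (g w)) \<in> M \<rightarrow>\<^sub>M config_space"
  using measurable_compose[OF measurable_Pair[OF assms] measurable_insert_point] by simp

lemma measurable_Diff_config:
  assumes "C \<in> sets borel" "bounded C"
  shows "(\<lambda>T. T - C) \<in> config_space \<rightarrow>\<^sub>M config_space"
proof (rule measurable_config_spaceI)
  fix B :: "real set" assume B: "B \<in> sets borel" "bounded B"
  have "{T \<in> space config_space. (T - C) \<inter> B = {}} = {T \<in> configs. T \<inter> (B - C) = {}}" by auto
  then show "{T \<in> space config_space. (T - C) \<inter> B = {}} \<in> sets config_space"
    using assms B by (auto intro!: void_sets intro: bounded_subset)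
qed (auto simp: Diff_bounded_configs assms)

lemma measure_Un_Diff_bounded:
  fixes B C :: "real set"
  assumes "B \<in> sets borel" "bounded B" "C \<in> sets borel" "bounded C"
  shows "measure lborel (C \<union> B) = measure lborel C + measure lborel (B - C)"
proof -
  have "measure lborel (C \<union> (B - C)) = measure lborel C + measure lborel (B - C)"
    using assms emeasure_bounded_finite[of C] emeasure_bounded_finite[OF bounded_subset[OF assms(2) Diff_subset[of B C]]]
    by (intro measure_Union) (auto simp: less_top)
  then show ?thesis by simp
qed

text \<open>The two properties of a Poisson law used below: its void probabilities, and the mean number of
  points in a set on the event that a disjoint set is void.\<close>

locale poisson_law =
  fixes P :: "real set measure" and \<gamma> :: real
  assumes rate_pos: "0 < \<gamma>"
    and sets_P: "sets P = sets config_space"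
    and void_prob: "\<And>B. B \<in> sets borel \<Longrightarrow> bounded B \<Longrightarrow>
      emeasure P {T \<in> configs. T \<inter> B = {}} = ennreal (exp (- (\<gamma> * measure lborel B)))"
    and mean_count: "\<And>A B. A \<in> sets borel \<Longrightarrow> bounded A \<Longrightarrow> B \<in> sets borel \<Longrightarrow> bounded B \<Longrightarrow> A \<inter> B = {} \<Longrightarrow>
      (\<integral>\<^sup>+T. of_nat (card (T \<inter> A)) * indicator {T \<in> configs. T \<inter> B = {}} T \<partial>P) =
        ennreal (\<gamma> * measure lborel A * exp (- (\<gamma> * measure lborel B)))"
begin

lemma space_P [simp]: "space P = configs"
  using sets_eq_imp_space_eq[OF sets_P] by simp

lemma measurable_P [simp]: "measurable P N = measurable config_space N"
  by (rule measurable_cong_sets[OF sets_P refl])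

sublocale prob_space P
  by (rule prob_spaceI) (use void_prob[of "{}"] in simp)

text \<open>Both sides are integrals of \<open>f\<close> against measures on marked configurations, so it
  suffices to compare them on a bounded set \<open>A\<close> times a void event for \<open>B\<close>. There
  the left side counts the points in \<open>A - B\<close> while \<open>B\<close> is void, and on the right the
  inserted point must avoid \<open>B\<close>.\<close>

theorem mecke:
  assumes [measurable]: "f \<in> borel_measurable (borel \<Otimes>\<^sub>M config_space)"
  shows "(\<integral>\<^sup>+T. \<integral>\<^sup>+j. f (pt T j, T) \<partial>count_space UNIV \<partial>P) =
    ennreal \<gamma> * (\<integral>\<^sup>+x. \<integral>\<^sup>+T. f (x, insert x T) \<partial>P \<partial>lborel)"
proof -
  let ?R = "borel \<Otimes>\<^sub>M config_space"
  define M1 where "M1 = distr (count_space UNIV \<Otimes>\<^sub>M P) ?R (\<lambda>(j, T). (pt T j, T))"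
  define M2 where "M2 = distr (density lborel (\<lambda>_. ennreal \<gamma>) \<Otimes>\<^sub>M P) ?R (\<lambda>(x, T). (x, insert x T))"
  have [measurable_cong]: "sets P = sets config_space" by (rule sets_P)
  have M1: "(\<integral>\<^sup>+w. g w \<partial>M1) = (\<integral>\<^sup>+T. \<integral>\<^sup>+j. g (pt T j, T) \<partial>count_space UNIV \<partial>P)"
    if [measurable]: "g \<in> borel_measurable ?R" for g
  proof -
    have "(\<integral>\<^sup>+w. g w \<partial>M1) = (\<integral>\<^sup>+w. g ((\<lambda>(j, T). (pt T j, T)) w) \<partial>(count_space UNIV \<Otimes>\<^sub>M P))"
      unfolding M1_def by (rule nn_integral_distr) measurable
    also have "\<dots> = (\<integral>\<^sup>+j. \<integral>\<^sup>+T. g (pt T j, T) \<partial>P \<partial>count_space UNIV)"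
      by (subst nn_integral_fst[symmetric]) (auto simp: case_prod_beta)
    also have "\<dots> = (\<integral>\<^sup>+T. \<integral>\<^sup>+j. g (pt T j, T) \<partial>count_space UNIV \<partial>P)"
      by (rule nn_integral_count_space_nn_integral[symmetric]) auto
    finally show ?thesis .
  qed
  have M2: "(\<integral>\<^sup>+w. g w \<partial>M2) = ennreal \<gamma> * (\<integral>\<^sup>+x. \<integral>\<^sup>+T. g (x, insert x T) \<partial>P \<partial>lborel)"
    if [measurable]: "g \<in> borel_measurable ?R" for g
  proof -
    have "(\<integral>\<^sup>+w. g w \<partial>M2) = (\<integral>\<^sup>+w. g ((\<lambda>(x, T). (x, insert x T)) w) \<partial>(density lborel (\<lambda>_. ennreal \<gamma>) \<Otimes>\<^sub>M P))"
      unfolding M2_def by (rule nn_integral_distr) measurable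
    also have "\<dots> = (\<integral>\<^sup>+x. \<integral>\<^sup>+T. g (x, insert x T) \<partial>P \<partial>density lborel (\<lambda>_. ennreal \<gamma>))"
      by (subst nn_integral_fst[symmetric]) (auto simp: case_prod_beta)
    also have "\<dots> = ennreal \<gamma> * (\<integral>\<^sup>+x. \<integral>\<^sup>+T. g (x, insert x T) \<partial>P \<partial>lborel)"
      by (subst nn_integral_density) (auto simp: nn_integral_cmult)
    finally show ?thesis .
  qed
  have rect1: "emeasure M1 (A \<times> {T \<in> configs. T \<inter> B = {}}) =
      ennreal (\<gamma> * measure lborel (A - B) * exp (- (\<gamma> * measure lborel B)))"
    if AB [measurable]: "A \<in> sets borel" "bounded A" "B \<in> sets borel" "bounded B" for A B
  proof -
    have [measurable]: "A \<times> {T \<in> configs. T \<inter> B = {}} \<in> sets ?R" by (intro pair_measureI void_sets AB)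
    have [measurable_cong]: "sets M1 = sets ?R" by (simp add: M1_def)
    have "emeasure M1 (A \<times> {T \<in> configs. T \<inter> B = {}}) = (\<integral>\<^sup>+w. indicator (A \<times> {T \<in> configs. T \<inter> B = {}}) w \<partial>M1)"
      by (rule nn_integral_indicator[symmetric]) measurable
    also have "\<dots> = (\<integral>\<^sup>+T. \<integral>\<^sup>+j. indicator A (pt T j) * indicator {T \<in> configs. T \<inter> B = {}} T \<partial>count_space UNIV \<partial>P)"
      by (subst M1) (auto simp: indicator_times)
    also have "\<dots> = (\<integral>\<^sup>+T. of_nat (card (T \<inter> A)) * indicator {T \<in> configs. T \<inter> B = {}} T \<partial>P)"
      by (intro nn_integral_cong) (simp add: nn_integral_multc sum_points_indicator AB)
    also have "\<dots> = (\<integral>\<^sup>+T. of_nat (card (T \<inter> (A - B))) * indicator {T \<in> configs. T \<inter> B = {}} T \<partial>P)"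
      by (intro nn_integral_cong) (auto split: split_indicator intro!: arg_cong[where f=card])
    also have "\<dots> = ennreal (\<gamma> * measure lborel (A - B) * exp (- (\<gamma> * measure lborel B)))"
      using AB by (intro mean_count) (auto intro: bounded_subset)
    finally show ?thesis .
  qed
  have rect2: "emeasure M2 (A \<times> {T \<in> configs. T \<inter> B = {}}) =
      ennreal (\<gamma> * measure lborel (A - B) * exp (- (\<gamma> * measure lborel B)))"
    if AB [measurable]: "A \<in> sets borel" "bounded A" "B \<in> sets borel" "bounded B" for A B
  proof -
    have V: "{T \<in> configs. T \<inter> B = {}} \<in> sets P" using void_sets[OF AB(3,4)] by (simp add: sets_P)
    have [measurable]: "A \<times> {T \<in> configs. T \<inter> B = {}} \<in> sets ?R" by (intro pair_measureI void_sets AB)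
    have [measurable_cong]: "sets M2 = sets ?R" by (simp add: M2_def)
    have bdd: "bounded (A - B)" using AB by (auto intro: bounded_subset)
    have "emeasure M2 (A \<times> {T \<in> configs. T \<inter> B = {}}) = (\<integral>\<^sup>+w. indicator (A \<times> {T \<in> configs. T \<inter> B = {}}) w \<partial>M2)"
      by (rule nn_integral_indicator[symmetric]) measurable
    also have "\<dots> = ennreal \<gamma> * (\<integral>\<^sup>+x. \<integral>\<^sup>+T. indicator (A - B) x * indicator {T \<in> configs. T \<inter> B = {}} T \<partial>P \<partial>lborel)"
      by (subst M2) (auto simp: indicator_def insert_configs intro!: nn_integral_cong arg_cong2[where f="(*)"])
    also have "\<dots> = ennreal \<gamma> * (\<integral>\<^sup>+x. indicator (A - B) x * ennreal (exp (- (\<gamma> * measure lborel B))) \<partial>lborel)"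
      using V by (simp add: nn_integral_cmult void_prob AB)
    also have "\<dots> = ennreal \<gamma> * (emeasure lborel (A - B) * ennreal (exp (- (\<gamma> * measure lborel B))))"
      by (simp add: nn_integral_multc)
    also have "emeasure lborel (A - B) = ennreal (measure lborel (A - B))"
      using emeasure_bounded_finite[OF bdd] by (intro emeasure_eq_ennreal_measure) auto
    finally show ?thesis using rate_pos by (simp add: ennreal_mult mult_ac)
  qed
  have "M1 = M2"
  proof (rule marked_measure_eqI)
    fix A :: "real set" assume A: "A \<in> sets borel" "bounded A"
    show "emeasure M1 (A \<times> configs) \<noteq> \<infinity>"
      using rect1[of A "{}"] A by simp
  qed (auto simp: M1_def M2_def rect1[unfolded M1_def] rect2[unfolded M2_def])
  then show ?thesis using M1[of f] M2[of f] by simp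
qed

text \<open>Independence of disjoint regions: deleting the points in \<open>C\<close> changes nothing for
  \<open>g\<close>, and conditioning on \<open>C\<close> being void does not change the law of what remains
  outside \<open>C\<close>, as one sees on void events.\<close>

lemma independent_of_void:
  assumes C: "C \<in> sets borel" "bounded C"
    and g [measurable]: "g \<in> borel_measurable config_space"
    and local: "\<And>T. T \<in> configs \<Longrightarrow> g (T - C) = g T"
  shows "(\<integral>\<^sup>+T. indicator {T \<in> configs. T \<inter> C = {}} T * g T \<partial>P) =
    ennreal (exp (- (\<gamma> * measure lborel C))) * (\<integral>\<^sup>+T. g T \<partial>P)"
proof -
  let ?c = "ennreal (exp (- (\<gamma> * measure lborel C)))"
  let ?V = "{T \<in> configs. T \<inter> C = {}}"
  have [measurable_cong]: "sets P = sets config_space" by (rule sets_P)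
  have [measurable]: "?V \<in> sets config_space" by (rule void_sets[OF C])
  have [measurable]: "(\<lambda>T. T - C) \<in> config_space \<rightarrow>\<^sub>M config_space" by (rule measurable_Diff_config[OF C])
  define Q1 where "Q1 = distr (density P (indicator ?V)) config_space (\<lambda>T. T - C)"
  define Q2 where "Q2 = distr (density P (\<lambda>_. ?c)) config_space (\<lambda>T. T - C)"
  have int1: "(\<integral>\<^sup>+T. h T \<partial>Q1) = (\<integral>\<^sup>+T. indicator ?V T * h (T - C) \<partial>P)"
    if [measurable]: "h \<in> borel_measurable config_space" for h
    unfolding Q1_def by (subst nn_integral_distr, measurable, subst nn_integral_density) auto
  have int2: "(\<integral>\<^sup>+T. h T \<partial>Q2) = ?c * (\<integral>\<^sup>+T. h (T - C) \<partial>P)"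
    if [measurable]: "h \<in> borel_measurable config_space" for h
    unfolding Q2_def by (subst nn_integral_distr, measurable, subst nn_integral_density) (auto simp: nn_integral_cmult)
  have void1: "emeasure Q1 {T \<in> configs. T \<inter> B = {}} = ennreal (exp (- (\<gamma> * measure lborel (C \<union> B))))"
    if B: "B \<in> sets borel" "bounded B" for B
  proof -
    have [measurable]: "{T \<in> configs. T \<inter> B = {}} \<in> sets config_space" by (rule void_sets[OF B])
    have sets: "{T \<in> configs. T \<inter> (C \<union> B) = {}} \<in> sets P" unfolding sets_P using B C by (intro void_sets) auto
    have "emeasure Q1 {T \<in> configs. T \<inter> B = {}} = (\<integral>\<^sup>+T. indicator {T \<in> configs. T \<inter> B = {}} T \<partial>Q1)"
      by (rule nn_integral_indicator[symmetric]) (simp add: Q1_def)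
    also have "\<dots> = (\<integral>\<^sup>+T. indicator {T \<in> configs. T \<inter> (C \<union> B) = {}} T \<partial>P)"
      by (subst int1, measurable, intro nn_integral_cong)
         (auto split: split_indicator simp: Diff_bounded_configs C disjoint_iff)
    also have "\<dots> = ennreal (exp (- (\<gamma> * measure lborel (C \<union> B))))"
      using sets B C by (simp add: void_prob)
    finally show ?thesis .
  qed
  have void2: "emeasure Q2 {T \<in> configs. T \<inter> B = {}} = ?c * ennreal (exp (- (\<gamma> * measure lborel (B - C))))"
    if B: "B \<in> sets borel" "bounded B" for B
  proof -
    have [measurable]: "{T \<in> configs. T \<inter> B = {}} \<in> sets config_space" by (rule void_sets[OF B])
    have sets: "{T \<in> configs. T \<inter> (B - C) = {}} \<in> sets P" unfolding sets_P using B C by (intro void_sets) (auto intro: bounded_subset)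
    have "emeasure Q2 {T \<in> configs. T \<inter> B = {}} = (\<integral>\<^sup>+T. indicator {T \<in> configs. T \<inter> B = {}} T \<partial>Q2)"
      by (rule nn_integral_indicator[symmetric]) (simp add: Q2_def)
    also have "\<dots> = ?c * (\<integral>\<^sup>+T. indicator {T \<in> configs. T \<inter> (B - C) = {}} T \<partial>P)"
      by (subst int2, measurable, intro arg_cong2[where f="(*)"] refl nn_integral_cong)
         (auto split: split_indicator simp: Diff_bounded_configs C disjoint_iff)
    also have "\<dots> = ?c * ennreal (exp (- (\<gamma> * measure lborel (B - C))))"
      using sets B C by (simp add: void_prob bounded_subset[OF _ Diff_subset])
    finally show ?thesis .
  qed
  have "Q1 = Q2"
  proof (rule measure_eq_by_voids)
    show "emeasure Q1 configs \<noteq> \<infinity>" using void1[of "{}"] by simp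
    fix B :: "real set" assume B: "B \<in> sets borel" "bounded B"
    show "emeasure Q1 {T \<in> configs. T \<inter> B = {}} = emeasure Q2 {T \<in> configs. T \<inter> B = {}}"
      unfolding void1[OF B] void2[OF B] measure_Un_Diff_bounded[OF B C]
      by (simp add: exp_add[symmetric] ennreal_mult[symmetric] distrib_left)
  qed (auto simp: Q1_def Q2_def)
  then have "(\<integral>\<^sup>+T. indicator ?V T * g (T - C) \<partial>P) = ?c * (\<integral>\<^sup>+T. g (T - C) \<partial>P)"
    using int1[OF g] int2[OF g] by simp
  moreover have "(\<integral>\<^sup>+T. indicator ?V T * g (T - C) \<partial>P) = (\<integral>\<^sup>+T. indicator ?V T * g T \<partial>P)"
    by (intro nn_integral_cong) (simp add: local)
  moreover have "(\<integral>\<^sup>+T. g (T - C) \<partial>P) = (\<integral>\<^sup>+T. g T \<partial>P)"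
    by (intro nn_integral_cong) (simp add: local)
  ultimately show ?thesis by simp
qed

end


section \<open>The law of a homogeneous Poisson process\<close>

lemma nn_integral_eq_sum_levels:
  fixes N :: "'a \<Rightarrow> nat"
  assumes [measurable]: "N \<in> M \<rightarrow>\<^sub>M count_space UNIV" "E \<in> sets M"
  shows "(\<integral>\<^sup>+w. of_nat (N w) * indicator E w \<partial>M) = (\<Sum>k. of_nat k * emeasure M ({w \<in> space M. N w = k} \<inter> E))"
proof -
  have "(\<integral>\<^sup>+w. of_nat (N w) * indicator E w \<partial>M) =
      (\<integral>\<^sup>+w. (\<Sum>k. of_nat k * indicator ({w \<in> space M. N w = k} \<inter> E) w) \<partial>M)"
  proof (rule nn_integral_cong)
    fix w assume "w \<in> space M"
    have "(\<Sum>k. of_nat k * indicator ({w \<in> space M. N w = k} \<inter> E) w :: ennreal) =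
        (\<Sum>k\<in>{N w}. of_nat k * indicator ({w \<in> space M. N w = k} \<inter> E) w)"
      by (rule suminf_finite) (auto simp: indicator_def)
    then show "of_nat (N w) * indicator E w = (\<Sum>k. of_nat k * indicator ({w \<in> space M. N w = k} \<inter> E) w :: ennreal)"
      using \<open>w \<in> space M\<close> by (simp add: indicator_def)
  qed
  also have "\<dots> = (\<Sum>k. \<integral>\<^sup>+w. of_nat k * indicator ({w \<in> space M. N w = k} \<inter> E) w \<partial>M)"
    by (rule nn_integral_suminf) measurable
  also have "\<dots> = (\<Sum>k. of_nat k * emeasure M ({w \<in> space M. N w = k} \<inter> E))"
    by (intro suminf_cong nn_integral_cmult_indicator) measurable
  finally show ?thesis .
qed

lemma poisson_mean_sums:
  fixes l :: real
  shows "(\<lambda>k. real k * (l ^ k / fact k * exp (- l))) sums l"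
proof -
  have "(\<lambda>k. l ^ k / fact k) sums exp l"
    using exp_converges[of l] by (simp add: divide_inverse_commute scaleR_conv_of_real)
  then have "(\<lambda>k. l * exp (- l) * (l ^ k / fact k)) sums (l * exp (- l) * exp l)"
    by (rule sums_mult)
  then have "(\<lambda>k. real (Suc k) * (l ^ Suc k / fact (Suc k) * exp (- l))) sums l"
    by (simp add: exp_minus field_simps del: of_nat_Suc)
  then show ?thesis by (subst (asm) sums_Suc_iff) simp
qed

text \<open>The process is entered through its counts only: independence of the counts of two disjoint sets
  together with the mean of the Poisson distribution.\<close>

lemma poisson_law_distr:
  assumes "prob_space M" "0 < \<gamma>" "homogeneous_poisson_process M \<gamma> T"
  shows "poisson_law (distr M config_space T) \<gamma>"
proof -
  interpret prob_space M by fact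
  have T [measurable]: "T \<in> M \<rightarrow>\<^sub>M config_space"
    and counts: "\<And>B k. B \<in> sets borel \<Longrightarrow> bounded B \<Longrightarrow>
        prob {\<omega> \<in> space M. card (T \<omega> \<inter> B) = k} =
          (\<gamma> * measure lborel B) ^ k / fact k * exp (- (\<gamma> * measure lborel B))"
    and indep: "\<And>(B :: nat \<Rightarrow> real set) n. (\<And>i. i < n \<Longrightarrow> B i \<in> sets borel \<and> bounded (B i)) \<Longrightarrow> disjoint_family_on B {..<n} \<Longrightarrow>
        indep_vars (\<lambda>_. count_space UNIV) (\<lambda>i \<omega>. card (T \<omega> \<inter> B i)) {..<n}"
    using assms(3) by (auto simp: homogeneous_poisson_process_def)
  have T_configs: "T \<omega> \<in> configs" if "\<omega> \<in> space M" for \<omega>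
    using measurable_space[OF T that] by simp
  have void_eq: "{\<omega> \<in> space M. T \<omega> \<inter> B = {}} = {\<omega> \<in> space M. card (T \<omega> \<inter> B) = 0}" if "bounded B" for B
    using T_configs finite_configs_Int[OF _ that] by auto
  have joint: "prob ({\<omega> \<in> space M. card (T \<omega> \<inter> A) = k} \<inter> {\<omega> \<in> space M. card (T \<omega> \<inter> B) = 0}) =
      prob {\<omega> \<in> space M. card (T \<omega> \<inter> A) = k} * prob {\<omega> \<in> space M. card (T \<omega> \<inter> B) = 0}"
    if "A \<in> sets borel" "bounded A" "B \<in> sets borel" "bounded B" "A \<inter> B = {}" for A B k
  proof -
    define C where "C i = (if i = (0::nat) then A else B)" for i
    have "indep_vars (\<lambda>_. count_space UNIV) (\<lambda>i \<omega>. card (T \<omega> \<inter> C i)) {..<2}"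
      using that by (intro indep) (auto simp: C_def disjoint_family_on_def)
    from indep_varsD[OF this, of "{..<2}" "\<lambda>i. if i = 0 then {k} else {0}"]
    have "prob (\<Inter>i\<in>{0, Suc 0}. (\<lambda>\<omega>. card (T \<omega> \<inter> C i)) -` (if i = 0 then {k} else {0}) \<inter> space M) =
      (\<Prod>i\<in>{0, Suc 0}. prob ((\<lambda>\<omega>. card (T \<omega> \<inter> C i)) -` (if i = 0 then {k} else {0}) \<inter> space M))"
      by (simp add: lessThan_nat_numeral lessThan_Suc insert_commute numeral_2_eq_2)
    then have "prob ((\<lambda>\<omega>. card (T \<omega> \<inter> A)) -` {k} \<inter> space M \<inter> ((\<lambda>\<omega>. card (T \<omega> \<inter> B)) -` {0} \<inter> space M)) =
      prob ((\<lambda>\<omega>. card (T \<omega> \<inter> A)) -` {k} \<inter> space M) * prob ((\<lambda>\<omega>. card (T \<omega> \<inter> B)) -` {0} \<inter> space M)"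
      by (simp add: C_def)
    moreover have "(\<lambda>\<omega>. card (T \<omega> \<inter> S)) -` {n} \<inter> space M = {\<omega> \<in> space M. card (T \<omega> \<inter> S) = n}" for S n
      by auto
    ultimately show ?thesis by simp
  qed
  show ?thesis
  proof
    show "0 < \<gamma>" by fact
    show "sets (distr M config_space T) = sets config_space" by simp
  next
    fix B :: "real set" assume B: "B \<in> sets borel" "bounded B"
    have "T -` {S \<in> configs. S \<inter> B = {}} \<inter> space M = {\<omega> \<in> space M. T \<omega> \<inter> B = {}}"
      using T_configs by auto
    then show "emeasure (distr M config_space T) {S \<in> configs. S \<inter> B = {}} = ennreal (exp (- (\<gamma> * measure lborel B)))"
      using counts[OF B, of 0] void_eq[OF B(2)] void_sets[OF B] by (simp add: emeasure_distr emeasure_eq_measure)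
  next
    fix A B :: "real set"
    assume AB [measurable]: "A \<in> sets borel" "bounded A" "B \<in> sets borel" "bounded B" and "A \<inter> B = {}"
    let ?l = "\<gamma> * measure lborel A" and ?v = "exp (- (\<gamma> * measure lborel B))"
    let ?E = "{\<omega> \<in> space M. card (T \<omega> \<inter> B) = 0}"
    have [measurable]: "{S \<in> configs. S \<inter> B = {}} \<in> sets config_space" by (rule void_sets[OF AB(3,4)])
    have E: "?E \<in> sets M" by measurable
    have "(\<integral>\<^sup>+S. of_nat (card (S \<inter> A)) * indicator {S \<in> configs. S \<inter> B = {}} S \<partial>distr M config_space T) =
        (\<integral>\<^sup>+\<omega>. of_nat (card (T \<omega> \<inter> A)) * indicator ?E \<omega> \<partial>M)"
      by (subst nn_integral_distr, measurable, intro nn_integral_cong)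
         (use T_configs finite_configs_Int[OF _ AB(4)] in \<open>auto simp: indicator_def\<close>)
    also have "\<dots> = (\<Sum>k. of_nat k * emeasure M ({\<omega> \<in> space M. card (T \<omega> \<inter> A) = k} \<inter> ?E))"
      by (rule nn_integral_eq_sum_levels[OF _ E]) measurable
    also have "\<dots> = (\<Sum>k. ennreal (real k * (?l ^ k / fact k * exp (- ?l)) * ?v))"
      using joint[OF AB \<open>A \<inter> B = {}\<close>] counts[OF AB(1,2)] counts[OF AB(3,4), of 0]
      by (simp add: emeasure_eq_measure ennreal_mult'[symmetric] ennreal_of_nat_eq_real_of_nat mult_ac)
    also have "\<dots> = ennreal (?l * ?v)"
      using \<open>0 < \<gamma>\<close> sums_mult2[OF poisson_mean_sums[of ?l], of ?v]
      by (intro suminf_ennreal_eq) auto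
    finally show "(\<integral>\<^sup>+S. of_nat (card (S \<inter> A)) * indicator {S \<in> configs. S \<inter> B = {}} S \<partial>distr M config_space T) =
        ennreal (?l * ?v)" .
  qed
qed

section \<open>Chains of consecutive points\<close>

text \<open>A product over the successive pairs of neighbouring points that start from an arbitrary real
  \<open>x\<close>, which need not be a point of \<open>T\<close>.\<close>

primrec chain :: "(real \<Rightarrow> real \<Rightarrow> ennreal) list \<Rightarrow> real set \<Rightarrow> real \<Rightarrow> ennreal" where
  "chain [] T x = 1"
| "chain (F # Fs) T x = F x (next_point T x) * chain Fs T (next_point T x)"

text \<open>One transition of the Markov chain of points: the next point is at an exponential
  distance.\<close>

definition exp_step :: "real \<Rightarrow> (real \<Rightarrow> real \<Rightarrow> ennreal) \<Rightarrow> (real \<Rightarrow> ennreal) \<Rightarrow> real \<Rightarrow> ennreal" where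
  "exp_step \<gamma> F u x = (\<integral>\<^sup>+y. ennreal (\<gamma> * exp (- (\<gamma> * (y - x)))) * indicator {x<..} y * (F x y * u y) \<partial>lborel)"

primrec chain_mean :: "real \<Rightarrow> (real \<Rightarrow> real \<Rightarrow> ennreal) list \<Rightarrow> real \<Rightarrow> ennreal" where
  "chain_mean \<gamma> [] x = 1"
| "chain_mean \<gamma> (F # Fs) x = exp_step \<gamma> F (chain_mean \<gamma> Fs) x"

definition borel_kernel :: "(real \<Rightarrow> real \<Rightarrow> ennreal) \<Rightarrow> bool" where
  "borel_kernel F \<longleftrightarrow> (\<lambda>(x, y). F x y) \<in> borel_measurable (borel \<Otimes>\<^sub>M borel)"

lemma borel_kernelD:
  assumes "borel_kernel F" "f \<in> borel_measurable M" "g \<in> borel_measurable M"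
  shows "(\<lambda>w. F (f w) (g w)) \<in> borel_measurable M"
  using measurable_compose[OF measurable_Pair[OF assms(2,3)] assms(1)[unfolded borel_kernel_def]] by simp

lemma measurable_exp_step:
  assumes F: "borel_kernel F" and [measurable]: "u \<in> borel_measurable borel"
  shows "exp_step \<gamma> F u \<in> borel_measurable borel"
proof -
  have [measurable]: "(\<lambda>(x, y). F x y) \<in> borel_measurable (borel \<Otimes>\<^sub>M borel)"
    using F by (simp add: borel_kernel_def)
  have [measurable]: "Measurable.pred (borel \<Otimes>\<^sub>M borel) (\<lambda>(x, y). y \<in> {x::real<..})"
    by (simp add: greaterThan_def)
  show ?thesis unfolding exp_step_def by measurable
qed

lemma measurable_chain_mean: "\<forall>F\<in>set Fs. borel_kernel F \<Longrightarrow> chain_mean \<gamma> Fs \<in> borel_measurable borel"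
proof (induction Fs)
  case Nil
  have "chain_mean \<gamma> [] = (\<lambda>_. 1)" by auto
  then show ?case by simp
next
  case (Cons F Fs)
  have "chain_mean \<gamma> (F # Fs) = exp_step \<gamma> F (chain_mean \<gamma> Fs)" by auto
  then show ?case using Cons measurable_exp_step by simp
qed

lemma measurable_chain:
  assumes "\<forall>F\<in>set Fs. borel_kernel F" "f \<in> M \<rightarrow>\<^sub>M config_space" "g \<in> borel_measurable M"
  shows "(\<lambda>w. chain Fs (f w) (g w)) \<in> borel_measurable M"
  using assms
proof (induction Fs arbitrary: g)
  case (Cons F Fs)
  have [measurable]: "(\<lambda>w. next_point (f w) (g w)) \<in> borel_measurable M"
    using Cons.prems by (intro measurable_next_point') auto
  then have "(\<lambda>w. F (g w) (next_point (f w) (g w))) \<in> borel_measurable M"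
    "(\<lambda>w. chain Fs (f w) (next_point (f w) (g w))) \<in> borel_measurable M"
    using Cons by (auto intro: borel_kernelD)
  then show ?case by simp
qed simp

lemma chain_cong_future:
  assumes "T \<in> configs" "T' \<in> configs" "T \<inter> {x<..} = T' \<inter> {x<..}"
  shows "chain Fs T x = chain Fs T' x"
  using assms(3)
proof (induction Fs arbitrary: x)
  case (Cons F Fs)
  have eq: "next_point T x = next_point T' x" by (simp add: next_point_def Cons.prems)
  have "T \<inter> {next_point T x<..} = (T \<inter> {x<..}) \<inter> {next_point T x<..}"
    using next_point_props(2)[OF assms(1), of x] by auto
  also have "\<dots> = T' \<inter> {next_point T x<..}"
    unfolding Cons.prems using next_point_props(2)[OF assms(1), of x] by auto
  finally show ?case using Cons.IH eq by simp
qed simp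

lemma chain_Cons_eq_sum:
  assumes T: "T \<in> configs"
  shows "chain (F # Fs) T x =
    (\<integral>\<^sup>+j. indicator {w. next_point T x = w} (pt T j) * (F x (pt T j) * chain Fs T (pt T j)) \<partial>count_space UNIV)"
proof -
  let ?y = "next_point T x"
  have "(\<integral>\<^sup>+j. indicator {w. ?y = w} (pt T j) * (F x (pt T j) * chain Fs T (pt T j)) \<partial>count_space UNIV) =
      (\<integral>\<^sup>+w. indicator {w. ?y = w} w * (F x w * chain Fs T w) \<partial>count_space T)"
    by (rule nn_integral_bij_count_space[OF bij_betw_pt[OF T], of "\<lambda>w. indicator {w. ?y = w} w * (F x w * chain Fs T w)"])
  also have "\<dots> = (\<Sum>w\<in>{?y}. indicator {w. ?y = w} w * (F x w * chain Fs T w))"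
    by (rule nn_integral_count_space') (use next_point_props(1)[OF T, of x] in auto)
  finally show ?thesis by simp
qed

text \<open>Whether an inserted point becomes the next one is a void event for the original configuration;
  this is how the exponential gap enters.\<close>

lemma next_point_insert_eq_iff:
  assumes T: "T \<in> configs"
  shows "next_point (insert y T) x = y \<longleftrightarrow> x < y \<and> T \<inter> {x<..<y} = {}"
  using next_point_props[OF insert_configs[OF T, of y], of x] next_point_eqI[of y "insert y T" x]
  by auto

context poisson_law
begin

text \<open>The next point after \<open>x\<close> is summed over with the Mecke formula: inserting it at
  \<open>y\<close> requires the interval between to be void, of probability \<open>exp (- (\<gamma> * (y -
  x)))\<close>, and the rest of the chain depends only on points beyond \<open>y\<close>.\<close>

lemma chain_expectation:
  assumes "\<forall>F\<in>set Fs. borel_kernel F"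
  shows "(\<integral>\<^sup>+T. chain Fs T x \<partial>P) = chain_mean \<gamma> Fs x"
  using assms
proof (induction Fs arbitrary: x)
  case Nil
  show ?case using emeasure_space_1 by simp
next
  case (Cons F Fs)
  have F: "borel_kernel F" and Fs: "\<forall>F\<in>set Fs. borel_kernel F" using Cons.prems by auto
  let ?f = "\<lambda>(y, T). indicator {w. next_point T x = w} y * (F x y * chain Fs T y) :: ennreal"
  have [measurable]: "(\<lambda>w. F x (fst w)) \<in> borel_measurable (borel \<Otimes>\<^sub>M config_space)"
    by (rule borel_kernelD[OF F]) auto
  have [measurable]: "(\<lambda>w. chain Fs (snd w) (fst w)) \<in> borel_measurable (borel \<Otimes>\<^sub>M config_space)"
    by (rule measurable_chain[OF Fs]) auto
  have f: "?f \<in> borel_measurable (borel \<Otimes>\<^sub>M config_space)"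
    unfolding case_prod_beta by measurable
  have "(\<integral>\<^sup>+T. chain (F # Fs) T x \<partial>P) = (\<integral>\<^sup>+T. \<integral>\<^sup>+j. ?f (pt T j, T) \<partial>count_space UNIV \<partial>P)"
    by (intro nn_integral_cong) (simp only: chain_Cons_eq_sum space_P prod.case)
  also have "\<dots> = ennreal \<gamma> * (\<integral>\<^sup>+y. \<integral>\<^sup>+T. ?f (y, insert y T) \<partial>P \<partial>lborel)"
    by (rule mecke[OF f])
  also have "(\<integral>\<^sup>+y. \<integral>\<^sup>+T. ?f (y, insert y T) \<partial>P \<partial>lborel) =
      (\<integral>\<^sup>+y. indicator {x<..} y * (ennreal (exp (- (\<gamma> * (y - x)))) * (F x y * chain_mean \<gamma> Fs y)) \<partial>lborel)"
  proof (rule nn_integral_cong)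
    fix y
    have m [measurable]: "(\<lambda>T. chain Fs T y) \<in> borel_measurable config_space"
      by (rule measurable_chain[OF Fs]) auto
    have "(\<integral>\<^sup>+T. ?f (y, insert y T) \<partial>P) =
        (\<integral>\<^sup>+T. indicator {x<..} y * (F x y * (indicator {T \<in> configs. T \<inter> {x<..<y} = {}} T * chain Fs T y)) \<partial>P)"
    proof (rule nn_integral_cong)
      fix T assume "T \<in> space P"
      then have T: "T \<in> configs" by simp
      have "chain Fs (insert y T) y = chain Fs T y"
        using T by (intro chain_cong_future insert_configs) auto
      then show "?f (y, insert y T) = indicator {x<..} y * (F x y * (indicator {T \<in> configs. T \<inter> {x<..<y} = {}} T * chain Fs T y))"
        using next_point_insert_eq_iff[OF T, of y x] T
        by (cases "next_point (insert y T) x = y") (auto simp: indicator_def)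
    qed
    also have "\<dots> = indicator {x<..} y * (F x y * (\<integral>\<^sup>+T. indicator {T \<in> configs. T \<inter> {x<..<y} = {}} T * chain Fs T y \<partial>P))"
    proof -
      have "{T \<in> configs. T \<inter> {x<..<y} = {}} \<in> sets config_space" by (rule void_sets) auto
      then have "(\<lambda>T. indicator {T \<in> configs. T \<inter> {x<..<y} = {}} T * chain Fs T y) \<in> borel_measurable P"
        unfolding measurable_P by measurable
      then show ?thesis by (simp add: nn_integral_cmult del: measurable_P)
    qed
    also have "\<dots> = indicator {x<..} y * (ennreal (exp (- (\<gamma> * (y - x)))) * (F x y * chain_mean \<gamma> Fs y))"
    proof (cases "x < y")
      case True
      have "(\<integral>\<^sup>+T. indicator {T \<in> configs. T \<inter> {x<..<y} = {}} T * chain Fs T y \<partial>P) =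
          ennreal (exp (- (\<gamma> * measure lborel {x<..<y}))) * (\<integral>\<^sup>+T. chain Fs T y \<partial>P)"
        by (rule independent_of_void[OF _ _ m])
           (auto intro!: chain_cong_future simp: Diff_bounded_configs)
      then show ?thesis using True Cons.IH[OF Fs, of y] by (simp add: mult_ac)
    qed simp
    finally show "(\<integral>\<^sup>+T. ?f (y, insert y T) \<partial>P) =
      indicator {x<..} y * (ennreal (exp (- (\<gamma> * (y - x)))) * (F x y * chain_mean \<gamma> Fs y))" .
  qed
  also have "ennreal \<gamma> * \<dots> = exp_step \<gamma> F (chain_mean \<gamma> Fs) x"
  proof -
    have [measurable]: "chain_mean \<gamma> Fs \<in> borel_measurable borel" by (rule measurable_chain_mean[OF Fs])
    have [measurable]: "F x \<in> borel_measurable borel" by (rule borel_kernelD[OF F]) auto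
    show ?thesis
      unfolding exp_step_def using rate_pos
      by (subst nn_integral_cmult[symmetric], measurable) (auto intro!: nn_integral_cong simp: ennreal_mult mult_ac)
  qed
  finally show ?case by simp
qed

text \<open>A chain sees only points to the right of its start, so inserting the start itself is
  harmless.\<close>

lemma sum_chain_expectation:
  assumes Fs: "\<forall>F\<in>set Fs. borel_kernel F"
  shows "(\<integral>\<^sup>+T. \<integral>\<^sup>+j. chain Fs T (pt T j) \<partial>count_space UNIV \<partial>P) = ennreal \<gamma> * (\<integral>\<^sup>+x. chain_mean \<gamma> Fs x \<partial>lborel)"
proof -
  have m: "(\<lambda>(x, T). chain Fs T x) \<in> borel_measurable (borel \<Otimes>\<^sub>M config_space)"
    unfolding case_prod_beta by (rule measurable_chain[OF Fs]) auto
  have "(\<integral>\<^sup>+T. chain Fs (insert x T) x \<partial>P) = chain_mean \<gamma> Fs x" for x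
    unfolding chain_expectation[OF Fs, symmetric]
    by (intro nn_integral_cong chain_cong_future) (auto simp: insert_configs)
  then show ?thesis using mecke[OF m] by simp
qed

end


section \<open>The divided process\<close>

definition shifted :: "real set \<Rightarrow> (int \<Rightarrow> real) \<Rightarrow> int \<Rightarrow> real" where
  "shifted T \<beta> j = pt T j + \<beta> j * (pt T (j + 1) - pt T j)"

lemma neighbour_shift_eq_range:
  assumes T: "T \<in> configs"
  shows "neighbour_shift \<beta> T = range (shifted T \<beta>)"
  unfolding neighbour_shift_def gaps_eq[OF T] image_image shifted_def using T by simp

lemma shifted_bounds:
  assumes "T \<in> configs" "\<beta> j \<in> {0..1}"
  shows "pt T j \<le> shifted T \<beta> j" "shifted T \<beta> j \<le> pt T (j + 1)"
proof -
  have *: "pt T j \<le> pt T (j + 1)" using assms by (simp add: pt_mono)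
  then show "pt T j \<le> shifted T \<beta> j" using assms by (simp add: shifted_def)
  have "\<beta> j * (pt T (j + 1) - pt T j) \<le> 1 * (pt T (j + 1) - pt T j)"
    using * assms by (intro mult_right_mono) auto
  then show "shifted T \<beta> j \<le> pt T (j + 1)" by (simp add: shifted_def)
qed

text \<open>Only weak monotonicity holds in general: a mark 1 followed by a mark 0 makes two neighbouring
  points coincide.\<close>

lemma mono_shifted:
  assumes "T \<in> configs" "\<And>j. \<beta> j \<in> {0..1}"
  shows "mono (shifted T \<beta>)"
proof (rule monoI)
  fix i j :: int assume "i \<le> j"
  show "shifted T \<beta> i \<le> shifted T \<beta> j"
  proof (cases "i = j")
    case False
    then have "pt T (i + 1) \<le> pt T j" using \<open>i \<le> j\<close> assms by (intro pt_mono) auto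
    then show ?thesis using shifted_bounds[where \<beta> = \<beta>, OF assms(1,2), of i] shifted_bounds[where \<beta> = \<beta>, OF assms(1,2), of j] by linarith
  qed simp
qed

lemma pt_unbounded:
  assumes "T \<in> configs"
  shows "\<exists>j. a < pt T j" "\<exists>j. pt T j < a"
proof -
  obtain x where "x \<in> T" "a < x" using assms unfolding configs_iff by blast
  then show "\<exists>j. a < pt T j" using pt_point_index[OF assms] by metis
  obtain x where "x \<in> T" "x < a" using assms unfolding configs_iff by blast
  then show "\<exists>j. pt T j < a" using pt_point_index[OF assms] by metis
qed

lemma shifted_unbounded:
  assumes "T \<in> configs" "\<And>j. \<beta> j \<in> {0..1}"
  shows "\<exists>j. a < shifted T \<beta> j" "\<exists>j. shifted T \<beta> j < a"
proof -
  obtain j where "a < pt T j" using pt_unbounded[OF assms(1)] by blast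
  then have "a < shifted T \<beta> j" using shifted_bounds(1)[where \<beta> = \<beta>, OF assms(1,2), of j] by linarith
  then show "\<exists>j. a < shifted T \<beta> j" by blast
  obtain j where "pt T j < a" using pt_unbounded[OF assms(1)] by blast
  then have "shifted T \<beta> (j - 1) < a" using shifted_bounds(2)[where \<beta> = \<beta>, OF assms(1,2), of "j - 1"] by simp
  then show "\<exists>j. shifted T \<beta> j < a" by blast
qed

lemma finite_shifted_index:
  assumes T: "T \<in> configs" and \<beta>: "\<And>j. \<beta> j \<in> {0..1}"
  shows "finite {j. shifted T \<beta> j \<in> {a..b}}"
proof (rule finite_subset)
  show "{j. shifted T \<beta> j \<in> {a..b}} \<subseteq> {point_index T a - 1..point_index T b}"
  proof
    fix j assume j: "j \<in> {j. shifted T \<beta> j \<in> {a..b}}"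
    then have "pt T j \<le> b" using shifted_bounds(1)[where \<beta> = \<beta>, OF T \<beta>, of j] by simp
    moreover have "a \<le> pt T (j + 1)" using j shifted_bounds(2)[where \<beta> = \<beta>, OF T \<beta>, of j] by simp
    then have "point_index T a \<le> j + 1" using point_index_mono[OF T, of a "pt T (j + 1)"] T by simp
    ultimately show "j \<in> {point_index T a - 1..point_index T b}" using pt_le_iff[OF T] by simp
  qed
qed simp

lemma range_shifted_configs:
  assumes T: "T \<in> configs" and \<beta>: "\<And>j. \<beta> j \<in> {0..1}"
  shows "range (shifted T \<beta>) \<in> configs"
  unfolding configs_iff
proof (intro conjI allI)
  fix a b
  have "range (shifted T \<beta>) \<inter> {a..b} = shifted T \<beta> ` {j. shifted T \<beta> j \<in> {a..b}}" by auto
  then show "finite (range (shifted T \<beta>) \<inter> {a..b})" using finite_shifted_index[where \<beta> = \<beta>, OF T \<beta>] by simp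
qed (use shifted_unbounded[where \<beta> = \<beta>, OF T \<beta>] in blast)+

section \<open>Expectations of consecutive products\<close>

primrec along :: "('a \<Rightarrow> int \<Rightarrow> ennreal) \<Rightarrow> 'a list \<Rightarrow> int \<Rightarrow> ennreal" where
  "along h [] j = 1"
| "along h (f # fs) j = h f j * along h fs (j + 1)"

lemma along_eq_prod:
  "along h fs j = (\<Prod>i\<in>{j..<j + int (length fs)}. h (fs ! nat (i - j)) i)"
proof (induction fs arbitrary: j)
  case (Cons f fs)
  have "{j..<j + int (length (f # fs))} = insert j {j + 1..<j + 1 + int (length fs)}" by auto
  moreover have "(\<Prod>i\<in>{j + 1..<j + 1 + int (length fs)}. h ((f # fs) ! nat (i - j)) i) =
      (\<Prod>i\<in>{j + 1..<j + 1 + int (length fs)}. h (fs ! nat (i - (j + 1))) i)"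
  proof (rule prod.cong[OF refl])
    fix i assume "i \<in> {j + 1..<j + 1 + int (length fs)}"
    then have "nat (i - j) = Suc (nat (i - (j + 1)))" by auto
    then show "h ((f # fs) ! nat (i - j)) i = h (fs ! nat (i - (j + 1))) i" by simp
  qed
  ultimately show ?case using Cons.IH[of "j + 1"] by simp
qed simp

lemma chain_map_eq_along:
  assumes "T \<in> configs"
  shows "chain (map K fs) T (pt T j) = along (\<lambda>f i. K f (pt T i) (pt T (i + 1))) fs j"
  using assms by (induction fs arbitrary: j) (auto simp: next_point_pt)

lemma measurable_along:
  assumes "\<And>f i. f \<in> set fs \<Longrightarrow> (\<lambda>w. h w f i) \<in> borel_measurable M"
  shows "(\<lambda>w. along (h w) fs j) \<in> borel_measurable M"
  using assms by (induction fs arbitrary: j) auto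

definition division_kernel :: "real measure \<Rightarrow> (real \<Rightarrow> ennreal) \<Rightarrow> real \<Rightarrow> real \<Rightarrow> ennreal" where
  "division_kernel G f x y = (\<integral>\<^sup>+\<beta>. f (x + \<beta> * (y - x)) \<partial>G)"

locale poisson_division = poisson_law +
  fixes G :: "real measure"
  assumes division: "division_distribution G"
begin

sublocale G: prob_space G
  using division by (simp add: division_distribution_def)

lemma sets_G: "sets G = sets (restrict_space borel {0..1})"
  using division by (simp add: division_distribution_def)

lemma space_G: "space G = {0..1}"
  using sets_eq_imp_space_eq[OF sets_G] by (simp add: space_restrict_space)

lemma measurable_from_G: "f \<in> borel_measurable borel \<Longrightarrow> f \<in> measurable G borel"
  unfolding measurable_cong_sets[OF sets_G refl] by (rule measurable_restrict_space1)

lemma id_measurable_G: "(\<lambda>\<beta>. \<beta>) \<in> measurable G borel"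
  by (rule measurable_from_G) auto

sublocale marks: product_prob_space "\<lambda>_. G" UNIV
  by unfold_locales

abbreviation marks :: "(int \<Rightarrow> real) measure" where
  "marks \<equiv> \<Pi>\<^sub>M n\<in>UNIV. G"

lemma space_marks: "space marks = {\<beta>. \<forall>j. \<beta> j \<in> {0..1}}"
  by (auto simp: space_PiM space_G)

lemma mark_measurable: "(\<lambda>\<beta>. \<beta> j) \<in> borel_measurable marks"
  using measurable_compose[OF measurable_component_singleton[of j UNIV "\<lambda>_. G"] id_measurable_G] by simp

lemma measurable_shifted:
  "(\<lambda>w. shifted (fst w) (snd w) j) \<in> borel_measurable (config_space \<Otimes>\<^sub>M marks)"
proof -
  note [measurable] = mark_measurable
  show ?thesis unfolding shifted_def by measurable
qed

lemma measurable_neighbour_shift: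
  "(\<lambda>(T, \<beta>). neighbour_shift \<beta> T) \<in> config_space \<Otimes>\<^sub>M marks \<rightarrow>\<^sub>M config_space"
proof (rule measurable_config_spaceI)
  fix w assume "w \<in> space (config_space \<Otimes>\<^sub>M marks)"
  then show "(\<lambda>(T, \<beta>). neighbour_shift \<beta> T) w \<in> configs"
    by (auto simp: space_pair_measure space_marks neighbour_shift_eq_range range_shifted_configs)
next
  fix B :: "real set" assume [measurable]: "B \<in> sets borel" and "bounded B"
  note [measurable] = measurable_shifted
  have "{w \<in> space (config_space \<Otimes>\<^sub>M marks). (\<lambda>(T, \<beta>). neighbour_shift \<beta> T) w \<inter> B = {}} =
      {w \<in> space (config_space \<Otimes>\<^sub>M marks). \<forall>j. shifted (fst w) (snd w) j \<notin> B}"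
    by (auto simp: space_pair_measure neighbour_shift_eq_range disjoint_iff)
  also have "\<dots> \<in> sets (config_space \<Otimes>\<^sub>M marks)" by measurable
  finally show "{w \<in> space (config_space \<Otimes>\<^sub>M marks). (\<lambda>(T, \<beta>). neighbour_shift \<beta> T) w \<inter> B = {}} \<in> sets (config_space \<Otimes>\<^sub>M marks)" .
qed

lemma borel_kernel_division_kernel:
  assumes [measurable]: "f \<in> borel_measurable borel"
  shows "borel_kernel (division_kernel G f)"
proof -
  note [measurable] = id_measurable_G
  have "(\<lambda>w. \<integral>\<^sup>+\<beta>. f (fst w + \<beta> * (snd w - fst w)) \<partial>G) \<in> borel_measurable (borel \<Otimes>\<^sub>M borel)"
    by (intro G.borel_measurable_nn_integral) measurable
  then show ?thesis by (simp add: borel_kernel_def division_kernel_def case_prod_beta)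
qed

text \<open>For a fixed configuration the divided points depend on distinct marks, so the expectation
  factorises over the gaps.\<close>

lemma marks_expectation_along:
  assumes T: "T \<in> configs" and fs: "\<forall>f\<in>set fs. f \<in> borel_measurable borel"
  shows "(\<integral>\<^sup>+\<beta>. along (\<lambda>f i. f (shifted T \<beta> i)) fs j \<partial>marks) = chain (map (division_kernel G) fs) T (pt T j)"
proof -
  let ?J = "{j..<j + int (length fs)}"
  define h where "h i b = (fs ! nat (i - j)) (pt T i + b * (pt T (i + 1) - pt T i))" for i b
  have [measurable]: "fs ! nat (i - j) \<in> borel_measurable borel" if "i \<in> ?J" for i
    using fs that by auto
  note [measurable] = id_measurable_G
  have h [measurable]: "h i \<in> borel_measurable G" if "i \<in> ?J" for i
    using that unfolding h_def by measurable
  have "(\<integral>\<^sup>+\<beta>. along (\<lambda>f i. f (shifted T \<beta> i)) fs j \<partial>marks) = (\<integral>\<^sup>+\<beta>. (\<Prod>i\<in>?J. h i (restrict \<beta> ?J i)) \<partial>marks)"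
    by (simp add: along_eq_prod shifted_def h_def)
  also have "\<dots> = (\<integral>\<^sup>+\<beta>. (\<Prod>i\<in>?J. h i (\<beta> i)) \<partial>distr marks (\<Pi>\<^sub>M i\<in>?J. G) (\<lambda>\<beta>. restrict \<beta> ?J))"
    by (rule nn_integral_distr[symmetric])
       (auto intro!: measurable_restrict_subset simp del: restrict_apply)
  also have "distr marks (\<Pi>\<^sub>M i\<in>?J. G) (\<lambda>\<beta>. restrict \<beta> ?J) = (\<Pi>\<^sub>M i\<in>?J. G)"
    by (rule marks.distr_PiM_restrict_finite) auto
  also have "(\<integral>\<^sup>+\<beta>. (\<Prod>i\<in>?J. h i (\<beta> i)) \<partial>(\<Pi>\<^sub>M i\<in>?J. G)) = (\<Prod>i\<in>?J. \<integral>\<^sup>+b. h i b \<partial>G)"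
    by (rule marks.product_nn_integral_prod) auto
  also have "\<dots> = chain (map (division_kernel G) fs) T (pt T j)"
    by (simp add: chain_map_eq_along[OF T] along_eq_prod h_def division_kernel_def)
  finally show ?thesis .
qed

text \<open>Averaging over the marks replaces each \<open>f\<close> by a function of the gap, which leaves a
  chain along the points of \<open>T\<close>.\<close>

theorem shifted_sum_along_expectation:
  assumes fs: "\<forall>f\<in>set fs. f \<in> borel_measurable borel"
  shows "(\<integral>\<^sup>+w. \<integral>\<^sup>+j. along (\<lambda>f i. f (shifted (fst w) (snd w) i)) fs j \<partial>count_space UNIV \<partial>(P \<Otimes>\<^sub>M marks)) =
    ennreal \<gamma> * (\<integral>\<^sup>+x. chain_mean \<gamma> (map (division_kernel G) fs) x \<partial>lborel)"
proof -
  note [measurable_cong] = sets_P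
  have m [measurable]: "(\<lambda>w. along (\<lambda>f i. f (shifted (fst w) (snd w) i)) fs j) \<in> borel_measurable (config_space \<Otimes>\<^sub>M marks)" for j
    by (intro measurable_along measurable_compose[OF measurable_shifted]) (use fs in auto)
  have "(\<integral>\<^sup>+w. \<integral>\<^sup>+j. along (\<lambda>f i. f (shifted (fst w) (snd w) i)) fs j \<partial>count_space UNIV \<partial>(P \<Otimes>\<^sub>M marks)) =
      (\<integral>\<^sup>+j. \<integral>\<^sup>+w. along (\<lambda>f i. f (shifted (fst w) (snd w) i)) fs j \<partial>(P \<Otimes>\<^sub>M marks) \<partial>count_space UNIV)"
    by (rule nn_integral_count_space_nn_integral) auto
  also have "\<dots> = (\<integral>\<^sup>+j. \<integral>\<^sup>+T. chain (map (division_kernel G) fs) T (pt T j) \<partial>P \<partial>count_space UNIV)"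
  proof (rule nn_integral_cong)
    fix j :: int
    have "(\<integral>\<^sup>+w. along (\<lambda>f i. f (shifted (fst w) (snd w) i)) fs j \<partial>(P \<Otimes>\<^sub>M marks)) =
        (\<integral>\<^sup>+T. \<integral>\<^sup>+\<beta>. along (\<lambda>f i. f (shifted T \<beta> i)) fs j \<partial>marks \<partial>P)"
      by (subst marks.nn_integral_fst[symmetric]) auto
    also have "\<dots> = (\<integral>\<^sup>+T. chain (map (division_kernel G) fs) T (pt T j) \<partial>P)"
      by (intro nn_integral_cong marks_expectation_along fs) simp
    finally show "(\<integral>\<^sup>+w. along (\<lambda>f i. f (shifted (fst w) (snd w) i)) fs j \<partial>(P \<Otimes>\<^sub>M marks)) = \<dots>" .
  qed
  also have "\<dots> = (\<integral>\<^sup>+T. \<integral>\<^sup>+j. chain (map (division_kernel G) fs) T (pt T j) \<partial>count_space UNIV \<partial>P)"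
    by (rule nn_integral_count_space_nn_integral[symmetric])
       (use fs borel_kernel_division_kernel in \<open>auto intro!: measurable_chain\<close>)
  also have "\<dots> = ennreal \<gamma> * (\<integral>\<^sup>+x. chain_mean \<gamma> (map (division_kernel G) fs) x \<partial>lborel)"
    by (rule sum_chain_expectation) (use fs borel_kernel_division_kernel in auto)
  finally show ?thesis .
qed

end

theorem (in poisson_law) points_sum_along_expectation:
  assumes fs: "\<forall>f\<in>set fs. f \<in> borel_measurable borel"
  shows "(\<integral>\<^sup>+T. \<integral>\<^sup>+j. along (\<lambda>f i. f (pt T i)) fs j \<partial>count_space UNIV \<partial>P) =
    ennreal \<gamma> * (\<integral>\<^sup>+x. chain_mean \<gamma> (map (\<lambda>f x y. f x) fs) x \<partial>lborel)"
proof -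
  have "(\<integral>\<^sup>+T. \<integral>\<^sup>+j. along (\<lambda>f i. f (pt T i)) fs j \<partial>count_space UNIV \<partial>P) =
      (\<integral>\<^sup>+T. \<integral>\<^sup>+j. chain (map (\<lambda>f x y. f x) fs) T (pt T j) \<partial>count_space UNIV \<partial>P)"
    by (intro nn_integral_cong) (simp add: chain_map_eq_along)
  also have "\<dots> = ennreal \<gamma> * (\<integral>\<^sup>+x. chain_mean \<gamma> (map (\<lambda>f x y. f x) fs) x \<partial>lborel)"
    by (rule sum_chain_expectation) (use fs in \<open>auto simp: borel_kernel_def\<close>)
  finally show ?thesis .
qed


section \<open>Beta division as a pair of commuting convolutions\<close>

text \<open>Convolution with a kernel in the difference \<open>y - x\<close>, where \<open>x\<close> is the
  argument of the result. Thus \<open>u\<close> is averaged over what lies to the right of \<open>x\<close>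
  when the kernel vanishes on negative numbers.\<close>

definition right_conv :: "(real \<Rightarrow> ennreal) \<Rightarrow> (real \<Rightarrow> ennreal) \<Rightarrow> real \<Rightarrow> ennreal" where
  "right_conv k u x = (\<integral>\<^sup>+y. k (y - x) * u y \<partial>lborel)"

lemma measurable_right_conv [measurable]:
  assumes [measurable]: "k \<in> borel_measurable borel" "u \<in> borel_measurable borel"
  shows "right_conv k u \<in> borel_measurable borel"
  unfolding right_conv_def by measurable

lemma nn_integral_shift:
  fixes k :: "real \<Rightarrow> ennreal"
  assumes [measurable]: "k \<in> borel_measurable borel"
  shows "(\<integral>\<^sup>+y. k (y - x) \<partial>lborel) = (\<integral>\<^sup>+y. k y \<partial>lborel)"
  by (subst (2) nn_integral_real_affine[where c = 1 and t = "- x"]) auto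

lemma nn_integral_reflect:
  fixes k :: "real \<Rightarrow> ennreal"
  assumes [measurable]: "k \<in> borel_measurable borel"
  shows "(\<integral>\<^sup>+y. k (x - y) \<partial>lborel) = (\<integral>\<^sup>+y. k y \<partial>lborel)"
  by (subst (2) nn_integral_real_affine[where c = "-1" and t = x]) auto

lemma right_conv_const:
  assumes [measurable]: "k \<in> borel_measurable borel"
  shows "right_conv k (\<lambda>_. c) x = integral\<^sup>N lborel k * c"
  unfolding right_conv_def by (simp add: nn_integral_multc nn_integral_shift)

lemma right_conv_cmult:
  assumes [measurable]: "k \<in> borel_measurable borel" "u \<in> borel_measurable borel"
  shows "right_conv k (\<lambda>y. c * u y) x = c * right_conv k u x"
  unfolding right_conv_def by (simp add: nn_integral_cmult[symmetric] mult.left_commute)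

lemma nn_integral_right_conv:
  assumes [measurable]: "k \<in> borel_measurable borel" "u \<in> borel_measurable borel"
  shows "(\<integral>\<^sup>+x. right_conv k u x \<partial>lborel) = integral\<^sup>N lborel k * integral\<^sup>N lborel u"
proof -
  have "(\<integral>\<^sup>+x. right_conv k u x \<partial>lborel) = (\<integral>\<^sup>+y. \<integral>\<^sup>+x. k (y - x) * u y \<partial>lborel \<partial>lborel)"
    unfolding right_conv_def by (rule lborel_pair.Fubini') measurable
  then show ?thesis by (simp add: nn_integral_multc nn_integral_reflect nn_integral_cmult)
qed

lemma right_conv_twice:
  assumes [measurable]: "k \<in> borel_measurable borel" "l \<in> borel_measurable borel" "u \<in> borel_measurable borel"
  shows "right_conv k (right_conv l u) x = (\<integral>\<^sup>+y. (\<integral>\<^sup>+z. k (z - x) * l (y - z) \<partial>lborel) * u y \<partial>lborel)"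
proof -
  have "right_conv k (right_conv l u) x = (\<integral>\<^sup>+z. \<integral>\<^sup>+y. k (z - x) * (l (y - z) * u y) \<partial>lborel \<partial>lborel)"
    unfolding right_conv_def by (simp add: nn_integral_cmult)
  also have "\<dots> = (\<integral>\<^sup>+y. \<integral>\<^sup>+z. k (z - x) * (l (y - z) * u y) \<partial>lborel \<partial>lborel)"
    by (rule lborel_pair.Fubini') measurable
  also have "\<dots> = (\<integral>\<^sup>+y. (\<integral>\<^sup>+z. k (z - x) * l (y - z) \<partial>lborel) * u y \<partial>lborel)"
    by (simp add: nn_integral_multc[symmetric] mult.assoc)
  finally show ?thesis .
qed

lemma right_conv_commute:
  assumes [measurable]: "k \<in> borel_measurable borel" "l \<in> borel_measurable borel" "u \<in> borel_measurable borel"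
  shows "right_conv k (right_conv l u) x = right_conv l (right_conv k u) x"
proof -
  have "(\<integral>\<^sup>+z. k (z - x) * l (y - z) \<partial>lborel) = (\<integral>\<^sup>+z. l (z - x) * k (y - z) \<partial>lborel)" for y
    using nn_integral_reflect[of "\<lambda>z. k (z - x) * l (y - z)" "x + y"] by (simp add: mult.commute)
  then show ?thesis by (simp add: right_conv_twice)
qed

text \<open>The exponential density has total mass one because the next point exists.\<close>

lemma (in poisson_law) exp_step_one: "exp_step \<gamma> (\<lambda>_ _. 1) (\<lambda>_. 1) x = 1"
proof -
  have "(\<integral>\<^sup>+T. chain [\<lambda>_ _. 1] T x \<partial>P) = chain_mean \<gamma> [\<lambda>_ _. 1] x"
    by (rule chain_expectation) (simp add: borel_kernel_def)
  moreover have "chain_mean \<gamma> [] = (\<lambda>_. 1)" by auto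
  ultimately show ?thesis using emeasure_space_1 by simp
qed

definition gamma_kernel :: "real \<Rightarrow> real \<Rightarrow> real \<Rightarrow> ennreal" where
  "gamma_kernel \<gamma> s t = ennreal (indicator {0<..} t * (t powr (s - 1) * exp (- (\<gamma> * t))))"

lemma measurable_gamma_kernel [measurable]: "gamma_kernel \<gamma> s \<in> borel_measurable borel"
  unfolding gamma_kernel_def by measurable

lemma measurable_exp_step_weight:
  "(\<lambda>y. ennreal (\<gamma> * exp (- (\<gamma> * (y - x)))) * indicator {x<..} y) \<in> borel_measurable borel"
  by measurable

locale poisson_beta_division = poisson_division +
  fixes r :: real
  assumes r: "0 < r" "r < 1" and beta: "G = beta_distribution r (1 - r)"
begin

definition beta_norm :: real where "beta_norm = Gamma 1 / (Gamma r * Gamma (1 - r))"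

lemma beta_norm_pos: "0 < beta_norm"
  unfolding beta_norm_def using r by (intro divide_pos_pos mult_pos_pos Gamma_real_pos) auto

text \<open>Under the substitution \<open>c = x + b (y - x)\<close> the Jacobian and the two density factors
  contribute \<open>y - x\<close> to the powers \<open>1\<close>, \<open>r - 1\<close> and \<open>- r\<close>.
  The gap length cancels because the two beta parameters sum to one.\<close>

lemma division_kernel_beta:
  assumes [measurable]: "f \<in> borel_measurable borel" and "x < y"
  shows "division_kernel G f x y =
    (\<integral>\<^sup>+c. ennreal (beta_norm * indicator {x<..<y} c * ((c - x) powr (r - 1) * (y - c) powr (- r))) * f c \<partial>lborel)"
proof -
  let ?d = "\<lambda>b::real. ennreal (beta_norm * b powr (r - 1) * (1 - b) powr (- r) * indicator {0<..<1} b)"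
  have "division_kernel G f x y = (\<integral>\<^sup>+b. f (x + b * (y - x)) \<partial>density (restrict_space lborel {0..1}) ?d)"
    by (simp add: division_kernel_def beta beta_distribution_def beta_norm_def)
  also have "\<dots> = (\<integral>\<^sup>+b. ?d b * f (x + b * (y - x)) \<partial>restrict_space lborel {0..1})"
    by (rule nn_integral_density) (auto intro!: measurable_restrict_space1)
  also have "\<dots> = (\<integral>\<^sup>+b. ?d b * f (x + b * (y - x)) * indicator {0..1} b \<partial>lborel)"
    by (rule nn_integral_restrict_space) auto
  also have "\<dots> = (\<integral>\<^sup>+b. ennreal (y - x) * (ennreal (beta_norm * indicator {x<..<y} (x + (y - x) * b) *
      ((x + (y - x) * b - x) powr (r - 1) * (y - (x + (y - x) * b)) powr (- r))) * f (x + (y - x) * b)) \<partial>lborel)"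
  proof (rule nn_integral_cong)
    fix b :: real
    show "?d b * f (x + b * (y - x)) * indicator {0..1} b =
      ennreal (y - x) * (ennreal (beta_norm * indicator {x<..<y} (x + (y - x) * b) *
      ((x + (y - x) * b - x) powr (r - 1) * (y - (x + (y - x) * b)) powr (- r))) * f (x + (y - x) * b))"
    proof (cases "0 < b \<and> b < 1")
      case True
      have 1: "y - (x + (y - x) * b) = (y - x) * (1 - b)" by (simp add: algebra_simps)
      have in_gap: "x + (y - x) * b \<in> {x<..<y}"
      proof -
        have "0 < (y - x) * b" "0 < (y - x) * (1 - b)" using True \<open>x < y\<close> by auto
        then show ?thesis by (simp add: algebra_simps)
      qed
      have "(y - x) * ((x + (y - x) * b - x) powr (r - 1) * (y - (x + (y - x) * b)) powr (- r)) =
          ((y - x) powr 1 * (y - x) powr (r - 1) * (y - x) powr (- r)) * (b powr (r - 1) * (1 - b) powr (- r))"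
        using True \<open>x < y\<close> unfolding 1 by (simp add: powr_mult)
      also have "(y - x) powr 1 * (y - x) powr (r - 1) * (y - x) powr (- r) = 1"
        using \<open>x < y\<close> by (simp only: powr_add[symmetric]) simp
      finally have "ennreal (y - x) * ennreal (beta_norm * ((x + (y - x) * b - x) powr (r - 1) * (y - (x + (y - x) * b)) powr (- r))) =
          ennreal (beta_norm * (b powr (r - 1) * (1 - b) powr (- r)))"
        using \<open>x < y\<close> by (subst ennreal_mult'[symmetric]) (auto simp: mult.left_commute)
      then show ?thesis using True in_gap by (simp add: mult.assoc[symmetric] mult.commute[of b])
    next
      case False
      have "x + (y - x) * b \<notin> {x<..<y}"
      proof
        assume "x + (y - x) * b \<in> {x<..<y}"
        then have "0 < (y - x) * b" "0 < (y - x) * (1 - b)" by (auto simp: algebra_simps)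
        then show False using False \<open>x < y\<close> by (simp add: zero_less_mult_iff)
      qed
      then show ?thesis using False by auto
    qed
  qed
  also have "\<dots> = (\<integral>\<^sup>+c. ennreal (beta_norm * indicator {x<..<y} c * ((c - x) powr (r - 1) * (y - c) powr (- r))) * f c \<partial>lborel)"
    using \<open>x < y\<close> by (subst (2) nn_integral_real_affine[where c = "y - x" and t = x]) (auto simp: nn_integral_cmult)
  finally show ?thesis .
qed

text \<open>The exponential weight of a gap splits at the dividing point, so dividing a gap is a convolution
  up to \<open>c\<close> followed by a convolution from \<open>c\<close> to the next point.\<close>

lemma exp_step_beta:
  assumes [measurable]: "f \<in> borel_measurable borel" "u \<in> borel_measurable borel"
  shows "exp_step \<gamma> (division_kernel G f) u x =
    right_conv (gamma_kernel \<gamma> r) (\<lambda>c. f c * (ennreal (\<gamma> * beta_norm) * right_conv (gamma_kernel \<gamma> (1 - r)) u c)) x"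
proof -
  let ?p = "gamma_kernel \<gamma> r" and ?q = "gamma_kernel \<gamma> (1 - r)"
  have "exp_step \<gamma> (division_kernel G f) u x = (\<integral>\<^sup>+y. \<integral>\<^sup>+c. ?p (c - x) * (f c * (ennreal (\<gamma> * beta_norm) * (?q (y - c) * u y))) \<partial>lborel \<partial>lborel)"
    unfolding exp_step_def
  proof (rule nn_integral_cong)
    fix y
    show "ennreal (\<gamma> * exp (- (\<gamma> * (y - x)))) * indicator {x<..} y * (division_kernel G f x y * u y) =
        (\<integral>\<^sup>+c. ?p (c - x) * (f c * (ennreal (\<gamma> * beta_norm) * (?q (y - c) * u y))) \<partial>lborel)"
    proof (cases "x < y")
      case True
      have "ennreal (\<gamma> * exp (- (\<gamma> * (y - x)))) * indicator {x<..} y * (division_kernel G f x y * u y) =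
          (\<integral>\<^sup>+c. ennreal (\<gamma> * exp (- (\<gamma> * (y - x)))) * (ennreal (beta_norm * indicator {x<..<y} c * ((c - x) powr (r - 1) * (y - c) powr (- r))) * f c * u y) \<partial>lborel)"
        using True by (simp add: division_kernel_beta nn_integral_cmult nn_integral_multc)
      also have "\<dots> = (\<integral>\<^sup>+c. ?p (c - x) * (f c * (ennreal (\<gamma> * beta_norm) * (?q (y - c) * u y))) \<partial>lborel)"
      proof (rule nn_integral_cong)
        fix c
        have "exp (- (\<gamma> * (y - x))) = exp (- (\<gamma> * (c - x))) * exp (- (\<gamma> * (y - c)))"
          by (simp add: exp_add[symmetric] algebra_simps)
        then have weights: "ennreal (\<gamma> * exp (- (\<gamma> * (y - x)))) * ennreal (beta_norm * indicator {x<..<y} c * ((c - x) powr (r - 1) * (y - c) powr (- r))) =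
            ?p (c - x) * (ennreal (\<gamma> * beta_norm) * ?q (y - c))"
          using rate_pos beta_norm_pos
          by (auto simp: gamma_kernel_def ennreal_mult'[symmetric] indicator_def mult_ac)
        have "ennreal (\<gamma> * exp (- (\<gamma> * (y - x)))) * (ennreal (beta_norm * indicator {x<..<y} c * ((c - x) powr (r - 1) * (y - c) powr (- r))) * f c * u y) =
            (?p (c - x) * (ennreal (\<gamma> * beta_norm) * ?q (y - c))) * (f c * u y)"
          unfolding weights[symmetric] by (simp only: mult.assoc)
        also have "\<dots> = ?p (c - x) * (f c * (ennreal (\<gamma> * beta_norm) * (?q (y - c) * u y)))"
          by (simp only: mult_ac)
        finally show "ennreal (\<gamma> * exp (- (\<gamma> * (y - x)))) * (ennreal (beta_norm * indicator {x<..<y} c * ((c - x) powr (r - 1) * (y - c) powr (- r))) * f c * u y) =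
            ?p (c - x) * (f c * (ennreal (\<gamma> * beta_norm) * (?q (y - c) * u y)))" .
      qed
      finally show ?thesis .
    next
      case False
      have "(\<integral>\<^sup>+c. ?p (c - x) * (f c * (ennreal (\<gamma> * beta_norm) * (?q (y - c) * u y))) \<partial>lborel) = (\<integral>\<^sup>+(c::real). 0 \<partial>lborel)"
        using False by (intro nn_integral_cong) (auto simp: gamma_kernel_def indicator_def)
      then show ?thesis using False by simp
    qed
  qed
  also have "\<dots> = (\<integral>\<^sup>+c. \<integral>\<^sup>+y. ?p (c - x) * (f c * (ennreal (\<gamma> * beta_norm) * (?q (y - c) * u y))) \<partial>lborel \<partial>lborel)"
    by (rule lborel_pair.Fubini') measurable
  also have "\<dots> = right_conv ?p (\<lambda>c. f c * (ennreal (\<gamma> * beta_norm) * right_conv ?q u c)) x"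
    unfolding right_conv_def by (simp add: nn_integral_cmult)
  finally show ?thesis .
qed

lemma exp_step_factor:
  assumes [measurable]: "u \<in> borel_measurable borel"
  shows "exp_step \<gamma> (\<lambda>_ _. 1) u x =
    right_conv (gamma_kernel \<gamma> r) (\<lambda>c. ennreal (\<gamma> * beta_norm) * right_conv (gamma_kernel \<gamma> (1 - r)) u c) x"
proof -
  have "division_kernel G (\<lambda>_. 1) = (\<lambda>_ _. 1)"
    by (simp add: division_kernel_def fun_eq_iff G.emeasure_space_1)
  then show ?thesis using exp_step_beta[of "\<lambda>_. 1" u x] by simp
qed

text \<open>What remains of the last gap, from the last divided point to its right end.\<close>

definition end_weight :: ennreal where
  "end_weight = ennreal (\<gamma> * beta_norm) * integral\<^sup>N lborel (gamma_kernel \<gamma> (1 - r))"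

text \<open>The left and the right part of a gap together make up one exponential gap of mass one.\<close>

lemma end_weight_inverse: "integral\<^sup>N lborel (gamma_kernel \<gamma> r) * end_weight = 1"
  using exp_step_one[of 0] exp_step_factor[of "\<lambda>_. 1" 0]
  by (simp add: right_conv_const end_weight_def)

text \<open>Read along the divided points, the right part of one gap is followed by the left part of the next.
  Commuting the two convolutions turns this pair into a full exponential gap.\<close>

lemma chain_mean_beta:
  assumes "\<forall>f\<in>set fs. f \<in> borel_measurable borel"
  shows "chain_mean \<gamma> (map (division_kernel G) fs) x =
    right_conv (gamma_kernel \<gamma> r) (\<lambda>c. end_weight * chain_mean \<gamma> (map (\<lambda>f x y. f x) fs) c) x"
  using assms
proof (induction fs arbitrary: x)
  case Nil
  show ?case using end_weight_inverse by (simp add: right_conv_const)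
next
  case (Cons f fs)
  let ?p = "gamma_kernel \<gamma> r" and ?q = "gamma_kernel \<gamma> (1 - r)"
  let ?u = "chain_mean \<gamma> (map (\<lambda>f x y. f x) fs)"
  have f [measurable]: "f \<in> borel_measurable borel" using Cons.prems by auto
  have u [measurable]: "?u \<in> borel_measurable borel"
    using Cons.prems by (intro measurable_chain_mean) (auto simp: borel_kernel_def)
  have IH: "chain_mean \<gamma> (map (division_kernel G) fs) = right_conv ?p (\<lambda>c. end_weight * ?u c)"
    using Cons by auto
  \<comment> \<open>Right part of a gap followed by the left part of the next one, in exchanged order.\<close>
  have commute: "ennreal (\<gamma> * beta_norm) * right_conv ?q (right_conv ?p (\<lambda>c. end_weight * ?u c)) c =
      end_weight * exp_step \<gamma> (\<lambda>_ _. 1) ?u c" for c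
  proof -
    have "right_conv ?q (right_conv ?p (\<lambda>c. end_weight * ?u c)) c = right_conv ?p (right_conv ?q (\<lambda>c. end_weight * ?u c)) c"
      by (rule right_conv_commute) measurable
    also have "right_conv ?q (\<lambda>c. end_weight * ?u c) = (\<lambda>c. end_weight * right_conv ?q ?u c)"
      by (rule ext, rule right_conv_cmult) measurable
    also have "right_conv ?p \<dots> c = end_weight * right_conv ?p (right_conv ?q ?u) c"
      by (rule right_conv_cmult) measurable
    finally have "ennreal (\<gamma> * beta_norm) * right_conv ?q (right_conv ?p (\<lambda>c. end_weight * ?u c)) c =
        end_weight * (ennreal (\<gamma> * beta_norm) * right_conv ?p (right_conv ?q ?u) c)"
      by (simp only: mult.left_commute)
    also have "ennreal (\<gamma> * beta_norm) * right_conv ?p (right_conv ?q ?u) c = exp_step \<gamma> (\<lambda>_ _. 1) ?u c"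
      unfolding exp_step_factor[OF u] by (rule right_conv_cmult[symmetric]) measurable
    finally show ?thesis .
  qed
  have point: "chain_mean \<gamma> (map (\<lambda>f x y. f x) (f # fs)) c = f c * exp_step \<gamma> (\<lambda>_ _. 1) ?u c" for c
  proof -
    have "chain_mean \<gamma> (map (\<lambda>f x y. f x) (f # fs)) c =
      (\<integral>\<^sup>+y. f c * (ennreal (\<gamma> * exp (- (\<gamma> * (y - c)))) * indicator {c<..} y * (1 * ?u y)) \<partial>lborel)"
      by (simp add: exp_step_def mult_ac)
    also have "\<dots> = f c * exp_step \<gamma> (\<lambda>_ _. 1) ?u c"
      unfolding exp_step_def by (rule nn_integral_cmult) measurable
    finally show ?thesis .
  qed
  have "chain_mean \<gamma> (map (division_kernel G) (f # fs)) x =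
      right_conv ?p (\<lambda>c. f c * (ennreal (\<gamma> * beta_norm) * right_conv ?q (right_conv ?p (\<lambda>c. end_weight * ?u c)) c)) x"
    by (simp add: IH exp_step_beta)
  also have "\<dots> = right_conv ?p (\<lambda>c. end_weight * chain_mean \<gamma> (map (\<lambda>f x y. f x) (f # fs)) c) x"
    unfolding commute point by (simp only: mult.left_commute)
  finally show ?case .
qed

lemma sum_along_expectation_eq:
  assumes fs: "\<forall>f\<in>set fs. f \<in> borel_measurable borel"
  shows "(\<integral>\<^sup>+w. \<integral>\<^sup>+j. along (\<lambda>f i. f (shifted (fst w) (snd w) i)) fs j \<partial>count_space UNIV \<partial>(P \<Otimes>\<^sub>M marks)) =
    (\<integral>\<^sup>+T. \<integral>\<^sup>+j. along (\<lambda>f i. f (pt T i)) fs j \<partial>count_space UNIV \<partial>P)"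
proof -
  let ?u = "chain_mean \<gamma> (map (\<lambda>f x y. f x) fs)"
  have [measurable]: "?u \<in> borel_measurable borel"
    using fs by (intro measurable_chain_mean) (auto simp: borel_kernel_def)
  have "(\<integral>\<^sup>+x. chain_mean \<gamma> (map (division_kernel G) fs) x \<partial>lborel) =
      (integral\<^sup>N lborel (gamma_kernel \<gamma> r) * end_weight) * (\<integral>\<^sup>+x. ?u x \<partial>lborel)"
    by (simp add: chain_mean_beta[OF fs] nn_integral_right_conv nn_integral_cmult mult.assoc)
  then have "(\<integral>\<^sup>+x. chain_mean \<gamma> (map (division_kernel G) fs) x \<partial>lborel) = (\<integral>\<^sup>+x. ?u x \<partial>lborel)"
    by (simp only: end_weight_inverse mult_1_left)
  then show ?thesis
    by (simp add: shifted_sum_along_expectation[OF fs] points_sum_along_expectation[OF fs])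
qed

end


section \<open>Void events read off from consecutive points\<close>

lemma borel_measurable_nn_integral_countable:
  fixes g :: "'i :: countable \<Rightarrow> 'a \<Rightarrow> ennreal"
  assumes [measurable]: "\<And>j. g j \<in> borel_measurable M"
  shows "(\<lambda>w. \<integral>\<^sup>+j. g j w \<partial>count_space UNIV) \<in> borel_measurable M"
proof -
  interpret sigma_finite_measure "count_space (UNIV :: 'i set)"
    by (rule sigma_finite_measure_count_space_countable) auto
  have "(\<lambda>w. g (snd w) (fst w)) \<in> borel_measurable (M \<Otimes>\<^sub>M count_space UNIV)"
    by (rule measurable_compose_countable'[where I = UNIV]) auto
  then have "(\<lambda>(w, j). g j w) \<in> borel_measurable (M \<Otimes>\<^sub>M count_space UNIV)"
    by (simp add: case_prod_beta)
  then show ?thesis by (rule borel_measurable_nn_integral)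
qed

text \<open>Test functions for the event that exactly \<open>k\<close> points lie in \<open>[-m, m]\<close>
  and none of them in \<open>B\<close>; summing over \<open>k\<close> detects that \<open>B\<close> is
  void.\<close>

definition window :: "real \<Rightarrow> real set \<Rightarrow> nat \<Rightarrow> (real \<Rightarrow> ennreal) list" where
  "window m B k = indicator {..<- m} # replicate k (indicator ({- m..m} - B)) @ [indicator {m<..}]"

lemma window_measurable: "B \<in> sets borel \<Longrightarrow> \<forall>f\<in>set (window m B k). f \<in> borel_measurable borel"
  by (auto simp: window_def)

lemma along_replicate_snoc:
  "along (\<lambda>f i. f (a i)) (replicate k (indicator K) @ [indicator R]) j =
    (if (\<forall>i\<in>{j..<j + int k}. a i \<in> K) \<and> a (j + int k) \<in> R then 1 else 0)"
proof (induction k arbitrary: j)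
  case (Suc k)
  have "{j..<j + int (Suc k)} = insert j {j + 1..<j + 1 + int k}" by auto
  then have all: "(\<forall>i\<in>{j..<j + int (Suc k)}. a i \<in> K) \<longleftrightarrow> a j \<in> K \<and> (\<forall>i\<in>{j + 1..<j + 1 + int k}. a i \<in> K)" by auto
  have last: "j + int (Suc k) = j + 1 + int k" by simp
  show ?case unfolding all unfolding last using Suc.IH[of "j + 1"] by (simp split: split_indicator)
qed (auto simp: indicator_def)

lemma along_window:
  "along (\<lambda>f i. f (a i)) (window m B k) j =
    (if a j < - m \<and> (\<forall>i\<in>{j + 1..<j + 1 + int k}. a i \<in> {- m..m} - B) \<and> m < a (j + 1 + int k) then 1 else 0)"
  unfolding window_def by (simp add: along_replicate_snoc indicator_def)

text \<open>A monotone sequence that is unbounded in both directions has exactly one last index left of the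
  window and one first index right of it, so precisely one choice of start and number of inner points can
  contribute. Monotonicity is enough for this, so the divided points may coincide.\<close>

lemma void_indicator_eq_sum:
  fixes a :: "int \<Rightarrow> real"
  assumes "mono a" and unbounded: "\<And>x. \<exists>j. x < a j" "\<And>x. \<exists>j. a j < x"
    and B: "B \<subseteq> {- m..m}" "0 \<le> m"
  shows "(\<integral>\<^sup>+k. \<integral>\<^sup>+j. along (\<lambda>f i. f (a i)) (window m B k) j \<partial>count_space UNIV \<partial>count_space UNIV) =
    (if range a \<inter> B = {} then 1 else 0)"
proof -
  have ex: "\<exists>l. \<forall>i. a i < x \<longleftrightarrow> i < l" for x
  proof -
    obtain u where u: "x < a u" using unbounded by blast
    obtain v where v: "a v < x" using unbounded by blast
    have bound: "i \<le> u" if "a i < x" for i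
    proof (rule ccontr)
      assume "\<not> i \<le> u"
      then have "a u \<le> a i" by (intro monoD[OF \<open>mono a\<close>]) simp
      then show False using u that by simp
    qed
    have fin: "finite {i. v \<le> i \<and> a i < x}" by (rule finite_subset[of _ "{v..u}"]) (auto dest: bound)
    define p where "p = Max {i. v \<le> i \<and> a i < x}"
    have p: "v \<le> p" "a p < x" using Max_in[OF fin] v by (auto simp: p_def)
    have "i \<le> p" if "a i < x" for i
    proof (cases "v \<le> i")
      case True
      then show ?thesis using Max_ge[OF fin, of i] that by (simp add: p_def)
    qed (use p in simp)
    moreover have "a i < x" if "i \<le> p" for i using monoD[OF \<open>mono a\<close> that] p by linarith
    ultimately show ?thesis by (intro exI[of _ "p + 1"]) (auto simp: zless_add1_eq order_le_less)
  qed
  \<comment> \<open>\<open>s\<close> is the first index not left of the window, \<open>t\<close> the first index right of it.\<close>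
  obtain s where s: "\<And>i. a i < - m \<longleftrightarrow> i < s" using ex by blast
  have "\<exists>t. \<forall>i. m < a i \<longleftrightarrow> t \<le> i"
  proof -
    obtain u where u: "m < a u" using unbounded by blast
    obtain v where v: "a v < m" using unbounded by blast
    have bound: "v \<le> i" if "m < a i" for i
    proof (rule ccontr)
      assume "\<not> v \<le> i"
      then have "a i \<le> a v" by (intro monoD[OF \<open>mono a\<close>]) simp
      then show False using v that by simp
    qed
    have fin: "finite {i. i \<le> u \<and> m < a i}" by (rule finite_subset[of _ "{v..u}"]) (auto dest: bound)
    define p where "p = Min {i. i \<le> u \<and> m < a i}"
    have p: "p \<le> u" "m < a p" using Min_in[OF fin] u by (auto simp: p_def)
    have "p \<le> i" if "m < a i" for i
    proof (cases "i \<le> u")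
      case True
      then show ?thesis using Min_le[OF fin, of i] that by (simp add: p_def)
    qed (use p in simp)
    moreover have "m < a i" if "p \<le> i" for i using monoD[OF \<open>mono a\<close> that] p by linarith
    ultimately show ?thesis by (intro exI[of _ p]) auto
  qed
  then obtain t where t: "\<And>i. m < a i \<longleftrightarrow> t \<le> i" by blast
  have "s \<le> t"
  proof (rule ccontr)
    assume "\<not> s \<le> t"
    then have "a t < - m" "m < a t" using s t by auto
    then show False using \<open>0 \<le> m\<close> by linarith
  qed
  have mid: "a i \<in> {- m..m} \<longleftrightarrow> s \<le> i \<and> i < t" for i
    using s[of i] t[of i] by (auto simp: not_less not_le)
  have void: "range a \<inter> B = {} \<longleftrightarrow> (\<forall>i\<in>{s..<t}. a i \<notin> B)"
  proof -
    have inside: "i \<in> {s..<t}" if "a i \<in> B" for i using B mid[of i] that by auto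
    have "range a \<inter> B = {} \<longleftrightarrow> (\<forall>i. a i \<notin> B)" by auto
    then show ?thesis using inside by blast
  qed
  have val: "along (\<lambda>f i. f (a i)) (window m B k) j =
      (if j = s - 1 \<and> k = nat (t - s) \<and> range a \<inter> B = {} then 1 else 0)" for j k
  proof -
    have "(a j < - m \<and> (\<forall>i\<in>{j + 1..<j + 1 + int k}. a i \<in> {- m..m} - B) \<and> m < a (j + 1 + int k)) \<longleftrightarrow>
      (j = s - 1 \<and> k = nat (t - s) \<and> range a \<inter> B = {})" (is "?L \<longleftrightarrow> ?R")
    proof
      assume L: ?L
      then have j: "j < s" "t \<le> j + 1 + int k" using s t by auto
      have "j = s - 1"
      proof (rule ccontr)
        assume "j \<noteq> s - 1"
        then have "j + 1 < s" using j by simp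
        moreover have "s \<le> j + 1 + int k" using j \<open>s \<le> t\<close> by simp
        ultimately have "j + 1 \<in> {j + 1..<j + 1 + int k}" by simp
        then have "a (j + 1) \<in> {- m..m}" using L by blast
        then show False using mid \<open>j + 1 < s\<close> by simp
      qed
      moreover have "j + 1 + int k \<le> t"
      proof (rule ccontr)
        assume "\<not> j + 1 + int k \<le> t"
        then have "t \<in> {j + 1..<j + 1 + int k}" using \<open>j = s - 1\<close> \<open>s \<le> t\<close> by simp
        then have "a t \<in> {- m..m}" using L by blast
        then show False using mid by simp
      qed
      ultimately have k: "j = s - 1" "int k = t - s" using j by auto
      then have "{j + 1..<j + 1 + int k} = {s..<t}" by auto
      then show ?R using L k void by auto
    next
      assume R: ?R
      then have "j + 1 = s" "j + 1 + int k = t" using \<open>s \<le> t\<close> by auto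
      then show ?L using R void mid s t by auto
    qed
    then show ?thesis unfolding along_window by simp
  qed
  have "(\<integral>\<^sup>+k. \<integral>\<^sup>+j. along (\<lambda>f i. f (a i)) (window m B k) j \<partial>count_space UNIV \<partial>count_space UNIV) =
    (\<integral>\<^sup>+k. \<integral>\<^sup>+j. (if range a \<inter> B = {} then 1 else 0) * indicator {nat (t - s)} k * indicator {s - 1} j \<partial>count_space UNIV \<partial>count_space UNIV)"
    unfolding val by (intro nn_integral_cong) (auto simp: indicator_def)
  also have "\<dots> = (if range a \<inter> B = {} then 1 else 0)"
    by (simp add: nn_integral_cmult_indicator)
  finally show ?thesis .
qed

lemma mono_pt: "T \<in> configs \<Longrightarrow> mono (pt T)"
  by (rule monoI) (rule pt_mono)

theorem (in poisson_beta_division) beta_division_preserves_law: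
  "distr (P \<Otimes>\<^sub>M marks) config_space (\<lambda>(T, \<beta>). neighbour_shift \<beta> T) = P"
proof (rule measure_eq_by_voids)
  let ?J = "P \<Otimes>\<^sub>M marks"
  note [measurable_cong] = sets_P
  note [measurable] = measurable_neighbour_shift
  show "sets P = sets config_space" by (rule sets_P)
  interpret J: prob_space ?J by (intro prob_space_pair prob_space_axioms marks.prob_space_axioms)
  interpret D: prob_space "distr ?J config_space (\<lambda>(T, \<beta>). neighbour_shift \<beta> T)"
    by (rule J.prob_space_distr) measurable
  show "emeasure (distr ?J config_space (\<lambda>(T, \<beta>). neighbour_shift \<beta> T)) configs \<noteq> \<infinity>"
    using D.emeasure_space_1 by simp
  fix B :: "real set" assume B: "B \<in> sets borel" "bounded B"
  have V: "{T \<in> configs. T \<inter> B = {}} \<in> sets config_space" by (rule void_sets[OF B])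
  note [measurable] = V
  obtain m where m: "0 \<le> m" "B \<subseteq> {- m..m}"
  proof -
    obtain K where K: "\<forall>x\<in>B. norm x \<le> K" using B(2) unfolding bounded_iff by blast
    show ?thesis using K by (intro that[of "\<bar>K\<bar>"]) (auto, (smt (verit) real_norm_def)+)
  qed
  note fs = window_measurable[OF B(1)]
  have shift_m: "(\<lambda>w. along (\<lambda>f i. f (shifted (fst w) (snd w) i)) (window m B k) j) \<in> borel_measurable ?J" for k j
    by (intro measurable_along measurable_compose[OF measurable_shifted[unfolded measurable_cong_sets[OF sets_pair_measure_cong[OF sets_P[symmetric] refl] refl]]])
       (use fs in auto)
  have pt_m: "(\<lambda>T. along (\<lambda>f i. f (pt T i)) (window m B k) j) \<in> borel_measurable P" for k j
    unfolding measurable_P by (intro measurable_along measurable_compose[OF measurable_pt]) (use fs in auto)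
  have "emeasure (distr ?J config_space (\<lambda>(T, \<beta>). neighbour_shift \<beta> T)) {T \<in> configs. T \<inter> B = {}} =
      (\<integral>\<^sup>+T. indicator {T \<in> configs. T \<inter> B = {}} T \<partial>distr ?J config_space (\<lambda>(T, \<beta>). neighbour_shift \<beta> T))"
    by (rule nn_integral_indicator[symmetric]) simp
  also have "\<dots> = (\<integral>\<^sup>+w. indicator {T \<in> configs. T \<inter> B = {}} ((\<lambda>(T, \<beta>). neighbour_shift \<beta> T) w) \<partial>?J)"
    by (rule nn_integral_distr) measurable
  also have "\<dots> = (\<integral>\<^sup>+w. \<integral>\<^sup>+k. \<integral>\<^sup>+j. along (\<lambda>f i. f (shifted (fst w) (snd w) i)) (window m B k) j \<partial>count_space UNIV \<partial>count_space UNIV \<partial>?J)"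
  proof (rule nn_integral_cong)
    fix w assume "w \<in> space ?J"
    then have w: "fst w \<in> configs" "\<And>j. snd w j \<in> {0..1}" by (auto simp: space_pair_measure space_marks)
    show "indicator {T \<in> configs. T \<inter> B = {}} ((\<lambda>(T, \<beta>). neighbour_shift \<beta> T) w) =
      (\<integral>\<^sup>+k. \<integral>\<^sup>+j. along (\<lambda>f i. f (shifted (fst w) (snd w) i)) (window m B k) j \<partial>count_space UNIV \<partial>count_space UNIV)"
      using void_indicator_eq_sum[OF mono_shifted[OF w] shifted_unbounded[OF w] m(2,1)]
        range_shifted_configs[OF w] neighbour_shift_eq_range[OF w(1), of "snd w"]
      by (simp add: case_prod_beta indicator_def)
  qed
  also have "\<dots> = (\<integral>\<^sup>+k. \<integral>\<^sup>+w. \<integral>\<^sup>+j. along (\<lambda>f i. f (shifted (fst w) (snd w) i)) (window m B k) j \<partial>count_space UNIV \<partial>?J \<partial>count_space UNIV)"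
    by (rule nn_integral_count_space_nn_integral) (auto intro!: borel_measurable_nn_integral_countable shift_m)
  also have "\<dots> = (\<integral>\<^sup>+k. \<integral>\<^sup>+T. \<integral>\<^sup>+j. along (\<lambda>f i. f (pt T i)) (window m B k) j \<partial>count_space UNIV \<partial>P \<partial>count_space UNIV)"
    by (intro nn_integral_cong sum_along_expectation_eq fs)
  also have "\<dots> = (\<integral>\<^sup>+T. \<integral>\<^sup>+k. \<integral>\<^sup>+j. along (\<lambda>f i. f (pt T i)) (window m B k) j \<partial>count_space UNIV \<partial>count_space UNIV \<partial>P)"
    by (rule nn_integral_count_space_nn_integral[symmetric])
       (auto intro!: borel_measurable_nn_integral_countable pt_m simp del: measurable_P)
  also have "\<dots> = (\<integral>\<^sup>+T. indicator {T \<in> configs. T \<inter> B = {}} T \<partial>P)"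
  proof (rule nn_integral_cong)
    fix T assume "T \<in> space P"
    then have T: "T \<in> configs" by simp
    show "(\<integral>\<^sup>+k. \<integral>\<^sup>+j. along (\<lambda>f i. f (pt T i)) (window m B k) j \<partial>count_space UNIV \<partial>count_space UNIV) =
      indicator {T \<in> configs. T \<inter> B = {}} T"
      using void_indicator_eq_sum[OF mono_pt[OF T] pt_unbounded[OF T] m(2,1)] range_pt[OF T] T
      by (simp add: indicator_def)
  qed
  also have "\<dots> = emeasure P {T \<in> configs. T \<inter> B = {}}"
    using V by (simp add: sets_P)
  finally show "emeasure (distr ?J config_space (\<lambda>(T, \<beta>). neighbour_shift \<beta> T)) {T \<in> configs. T \<inter> B = {}} =
    emeasure P {T \<in> configs. T \<inter> B = {}}" .
qed simp


section \<open>Laws on the unit interval\<close>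

locale unit_interval_law = prob_space G for G :: "real measure" +
  assumes sets_unit: "sets G = sets (restrict_space borel {0..1})"
begin

lemma space_unit: "space G = {0..1}"
  using sets_eq_imp_space_eq[OF sets_unit] by (simp add: space_restrict_space)

lemma measurable_unit: "f \<in> borel_measurable borel \<Longrightarrow> f \<in> borel_measurable G"
  unfolding measurable_cong_sets[OF sets_unit refl] by (rule measurable_restrict_space1)

lemma integrable_unit:
  fixes f :: "real \<Rightarrow> real"
  assumes "f \<in> borel_measurable borel" "\<And>b. b \<in> {0..1} \<Longrightarrow> \<bar>f b\<bar> \<le> K"
  shows "integrable G f"
  by (rule integrable_const_bound[where B = K]) (use assms in \<open>auto simp: space_unit intro: measurable_unit AE_I2\<close>)

lemma integrable_power_unit: "integrable G (\<lambda>b. b ^ k)"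
  by (rule integrable_unit[where K = 1]) (auto simp: power_le_one)

lemma real_distribution_unit: "real_distribution (distr G borel (\<lambda>b. b))"
  by (rule real_distribution_distr) (rule measurable_unit, simp)

lemma char_moment_bound:
  "cmod (char (distr G borel (\<lambda>b. b)) t - (\<Sum>k\<le>n. ((\<i> * t) ^ k / fact k) * (\<integral>b. b ^ k \<partial>G))) \<le> 2 * \<bar>t\<bar> ^ n / fact n"
proof -
  interpret D: real_distribution "distr G borel (\<lambda>b. b)" by (rule real_distribution_unit)
  have id: "(\<lambda>b. b) \<in> borel_measurable G" by (rule measurable_unit) simp
  have int: "integrable (distr G borel (\<lambda>b. b)) (\<lambda>b. b ^ k)" for k
    by (subst integrable_distr_eq[OF id]) (auto intro: integrable_power_unit)
  have eq: "D.expectation (\<lambda>b. b ^ k) = (\<integral>b. b ^ k \<partial>G)" for k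
    by (rule integral_distr[OF id]) simp
  have "D.expectation (\<lambda>b. \<bar>b\<bar> ^ n) = (\<integral>b. \<bar>b\<bar> ^ n \<partial>G)"
    by (rule integral_distr[OF id]) simp
  also have "\<dots> \<le> (\<integral>b. 1 \<partial>G)"
    by (rule integral_mono) (auto intro!: integrable_unit[where K = 1] simp: space_unit power_le_one)
  finally have le: "D.expectation (\<lambda>b. \<bar>b\<bar> ^ n) \<le> 1" by (simp add: prob_space)
  have "cmod (char (distr G borel (\<lambda>b. b)) t - (\<Sum>k\<le>n. ((\<i> * t) ^ k / fact k) * D.expectation (\<lambda>b. b ^ k))) \<le>
      (2 * \<bar>t\<bar> ^ n / fact n) * D.expectation (\<lambda>b. \<bar>b\<bar> ^ n)"
    by (rule D.char_approx1) (rule int)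
  also have "\<dots> \<le> (2 * \<bar>t\<bar> ^ n / fact n) * 1"
    by (rule mult_left_mono[OF le]) simp
  finally show ?thesis by (simp add: eq)
qed

end

text \<open>On a bounded interval the Taylor polynomials of the characteristic function, whose coefficients
  are the moments, converge, so moments determine the law by Levy's uniqueness theorem.\<close>

theorem unit_interval_law_eqI:
  assumes "unit_interval_law G" "unit_interval_law H"
    and moments: "\<And>k. (\<integral>b. b ^ k \<partial>G) = (\<integral>b. b ^ k \<partial>H)"
  shows "G = H"
proof -
  interpret G: unit_interval_law G by fact
  interpret H: unit_interval_law H by fact
  let ?G = "distr G borel (\<lambda>b. b)" and ?H = "distr H borel (\<lambda>b. b)"
  have "char ?G t = char ?H t" for t
  proof -
    have "cmod (char ?G t - char ?H t) \<le> 4 * (\<bar>t\<bar> ^ n / fact n)" for n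
      using norm_triangle_le_diff[OF add_mono[OF G.char_moment_bound[of t n] H.char_moment_bound[of t n]]]
      by (simp add: moments)
    moreover have "(\<lambda>n. 4 * (\<bar>t\<bar> ^ n / fact n)) \<longlonglongrightarrow> 4 * 0"
      using summable_LIMSEQ_zero[OF summable_exp, of "\<bar>t\<bar>"]
      by (intro tendsto_mult tendsto_const) (simp add: divide_inverse_commute)
    ultimately have "cmod (char ?G t - char ?H t) \<le> 4 * 0" by (intro LIMSEQ_le_const[where a = "cmod _"]) auto
    then show ?thesis by simp
  qed
  then have eq: "?G = ?H"
    by (intro Levy_uniqueness G.real_distribution_unit H.real_distribution_unit ext)
  show ?thesis
  proof (rule measure_eqI)
    show "sets G = sets H" using G.sets_unit H.sets_unit by simp
    fix A assume A: "A \<in> sets G"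
    then have AH: "A \<in> sets H" using \<open>sets G = sets H\<close> by simp
    have B: "A \<in> sets borel" using A by (simp add: G.sets_unit sets_restrict_space_iff)
    have "emeasure ?G A = emeasure G A"
      using B sets.sets_into_space[OF A] by (subst emeasure_distr) (auto intro: G.measurable_unit intro!: arg_cong[where f = "emeasure G"])
    moreover have "emeasure ?H A = emeasure H A"
      using B sets.sets_into_space[OF AH] by (subst emeasure_distr) (auto intro: H.measurable_unit intro!: arg_cong[where f = "emeasure H"])
    ultimately show "emeasure G A = emeasure H A" using eq by simp
  qed
qed

section \<open>Moments of the beta distribution\<close>

context
  fixes r :: real
  assumes r: "0 < r" "r < 1"
begin

lemma beta_moment_integral:
  fixes k :: nat
  defines "g \<equiv> \<lambda>x::real. Gamma (r + (1 - r)) / (Gamma r * Gamma (1 - r)) * x powr (r - 1) * (1 - x) powr ((1 - r) - 1) * indicator {0<..<1} x * x ^ k"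
  shows "integrable lborel g" "(\<integral>x. g x \<partial>lborel) = pochhammer r k / fact k"
proof -
  let ?C = "1 / (Gamma r * Gamma (1 - r))"
  let ?h = "\<lambda>t::real. t powr (r + real k - 1) * (1 - t) powr (1 - r - 1)"
  have AE: "AE x in lborel. x \<noteq> (0::real)" "AE x in lborel. x \<noteq> (1::real)" by (rule AE_lborel_singleton)+
  have pos: "0 < r + real k" "0 < 1 - r" using r by auto
  have set_int: "set_integrable lborel {0..1} ?h" by (rule integrable_Beta[OF pos])
  have "(LINT t:{0..1}|lborel. ?h t) = integral {0..1} ?h"
    by (rule set_borel_integral_eq_integral(2)[OF set_int])
  also have "\<dots> = Beta (r + real k) (1 - r)"
    using has_integral_Beta_real[OF pos] by (simp add: integral_unique)
  finally have beta: "(\<integral>t. indicator {0..1} t * ?h t \<partial>lborel) = Beta (r + real k) (1 - r)"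
    by (simp add: set_lebesgue_integral_def)
  have int: "integrable lborel (\<lambda>t. indicator {0..1} t * ?h t)"
    using set_int by (simp add: set_integrable_def)
  have g: "AE t in lborel. g t = ?C * (indicator {0..1} t * ?h t)"
    using AE
  proof eventually_elim
    case (elim t)
    show ?case
    proof (cases "0 < t \<and> t < 1")
      case True
      then have "t powr (r + real k - 1) = t powr (r - 1) * t ^ k"
        by (simp add: powr_add[symmetric] powr_realpow[symmetric] algebra_simps)
      then show ?thesis using True by (simp add: g_def)
    qed (use elim in \<open>auto simp: g_def indicator_def\<close>)
  qed
  have gm: "g \<in> borel_measurable lborel" unfolding g_def by measurable
  show "integrable lborel g"
    by (rule integrable_cong_AE_imp[OF integrable_mult_right[OF int, of ?C] gm]) (use g in auto)
  have "(\<integral>x. g x \<partial>lborel) = (\<integral>t. ?C * (indicator {0..1} t * ?h t) \<partial>lborel)"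
    by (rule integral_cong_AE[OF gm _ g]) measurable
  also have "\<dots> = ?C * Beta (r + real k) (1 - r)" using beta by simp
  also have "\<dots> = pochhammer r k / fact k"
  proof -
    have "Gamma (1 - r) > 0" "Gamma r > 0" using r by (auto intro: Gamma_real_pos)
    moreover have "pochhammer r k = Gamma (r + real k) / Gamma r"
      using r by (intro pochhammer_Gamma) (auto elim!: nonpos_Ints_cases)
    moreover have "Gamma (r + real k + (1 - r)) = fact k"
      using Gamma_fact[of k, where ?'a = real] by (simp add: algebra_simps)
    ultimately show ?thesis by (simp add: Beta_def field_simps)
  qed
  finally show "(\<integral>x. g x \<partial>lborel) = pochhammer r k / fact k" .
qed

abbreviation "beta_weight \<equiv> \<lambda>x::real. Gamma (r + (1 - r)) / (Gamma r * Gamma (1 - r)) *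
        x powr (r - 1) * (1 - x) powr ((1 - r) - 1) * indicator {0<..<1} x"

lemma beta_weight_nonneg: "0 \<le> beta_weight x"
  using r by (intro mult_nonneg_nonneg divide_nonneg_nonneg) (auto intro: less_imp_le Gamma_real_pos)

lemma beta_moment: "(\<integral>b. b ^ k \<partial>beta_distribution r (1 - r)) = pochhammer r k / fact k"
proof -
  have "(\<integral>b. b ^ k \<partial>beta_distribution r (1 - r)) = (\<integral>b. beta_weight b *\<^sub>R b ^ k \<partial>restrict_space lborel {0..1})"
    unfolding beta_distribution_def using beta_weight_nonneg
    by (intro integral_density) (auto intro!: measurable_restrict_space1 AE_I2)
  also have "\<dots> = (\<integral>b. indicator {0..1} b *\<^sub>R (beta_weight b *\<^sub>R b ^ k) \<partial>lborel)"
    by (rule integral_restrict_space) auto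
  also have "\<dots> = (\<integral>b. beta_weight b * b ^ k \<partial>lborel)"
    by (rule Bochner_Integration.integral_cong) (auto simp: indicator_def)
  also have "\<dots> = pochhammer r k / fact k" by (rule beta_moment_integral(2))
  finally show ?thesis .
qed

lemma unit_interval_law_beta: "unit_interval_law (beta_distribution r (1 - r))"
proof -
  have "emeasure (beta_distribution r (1 - r)) (space (beta_distribution r (1 - r))) =
      (\<integral>\<^sup>+b. ennreal (beta_weight b) \<partial>restrict_space lborel {0..1})"
    unfolding beta_distribution_def
  proof (subst emeasure_density)
    have "{0..1} \<in> sets (restrict_space lborel {0..1 :: real})" by (subst sets_restrict_space_iff) auto
    then show "space (density (restrict_space lborel {0..1}) beta_weight) \<in> sets (restrict_space lborel {0..1})"
      by (simp add: space_restrict_space)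
  qed (auto intro!: measurable_restrict_space1 nn_integral_cong simp: space_restrict_space indicator_def)
  also have "\<dots> = (\<integral>\<^sup>+b. ennreal (beta_weight b) * indicator {0..1} b \<partial>lborel)"
    by (rule nn_integral_restrict_space) auto
  also have "\<dots> = (\<integral>\<^sup>+b. ennreal (beta_weight b) \<partial>lborel)"
    by (intro nn_integral_cong) (auto simp: indicator_def)
  also have "\<dots> = ennreal (\<integral>b. beta_weight b \<partial>lborel)"
    using beta_moment_integral(1)[of 0] beta_weight_nonneg by (intro nn_integral_eq_integral) auto
  also have "(\<integral>b. beta_weight b \<partial>lborel) = 1"
    using beta_moment_integral(2)[of 0] by (simp only: power_0 mult_1_right pochhammer_0 fact_0 div_by_1)
  finally have "prob_space (beta_distribution r (1 - r))" by (intro prob_spaceI) (simp only: ennreal_1)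
  moreover have "sets (beta_distribution r (1 - r)) = sets (restrict_space borel {0..1})"
    by (simp add: beta_distribution_def sets_restrict_space)
  ultimately show ?thesis by (simp add: unit_interval_law_def unit_interval_law_axioms_def)
qed

end


section \<open>The transform of a division distribution\<close>

text \<open>The constant term is the limit at 0; dividing by \<open>x\<close> shifts the coefficients.\<close>

lemma powser_zero_imp_coeff_zero:
  fixes a :: "nat \<Rightarrow> real"
  assumes "\<And>x. x \<noteq> 0 \<Longrightarrow> \<bar>x\<bar> < 1 \<Longrightarrow> (\<lambda>n. a n * x ^ n) sums 0"
  shows "a k = 0"
  using assms
proof (induction k arbitrary: a)
  case 0
  have "((\<lambda>_. 0) \<longlongrightarrow> a 0) (at (0::real))"
    by (rule powser_limit_0_strong[of 1]) (use 0 in auto)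
  then show ?case using tendsto_unique[OF _ _ tendsto_const] trivial_limit_at by blast
next
  case (Suc k)
  have "((\<lambda>_. 0) \<longlongrightarrow> a 0) (at (0::real))"
    by (rule powser_limit_0_strong[of 1]) (use Suc.prems in auto)
  then have a0: "a 0 = 0" using tendsto_unique[OF _ _ tendsto_const] trivial_limit_at by blast
  have "(\<lambda>n. a (Suc n) * x ^ n) sums 0" if "x \<noteq> 0" "\<bar>x\<bar> < 1" for x
  proof -
    have "(\<lambda>n. a (Suc n) * x ^ Suc n) sums 0"
      using Suc.prems[OF that] a0 by (subst sums_Suc_iff) simp
    then have "(\<lambda>n. (1 / x) * (a (Suc n) * x ^ Suc n)) sums ((1 / x) * 0)" by (rule sums_mult)
    then show ?thesis using that by simp
  qed
  then show ?case using Suc.IH[of "\<lambda>n. a (Suc n)"] by simp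
qed

context unit_interval_law
begin

text \<open>If an exponential variable of rate one is divided in the proportion \<open>b\<close>, this is the
  joint Laplace transform of its two parts at \<open>a - 1\<close> and \<open>c - 1\<close>.\<close>

definition split_transform :: "real \<Rightarrow> real \<Rightarrow> real" where
  "split_transform a c = (\<integral>b. 1 / (a * b + c * (1 - b)) \<partial>G)"

lemma split_denominator:
  fixes a c b :: real
  assumes "0 < a" "0 < c" "b \<in> {0..1}"
  shows "min a c \<le> a * b + c * (1 - b)" "0 < a * b + c * (1 - b)"
proof -
  have "min a c * b + min a c * (1 - b) \<le> a * b + c * (1 - b)"
    using assms by (intro add_mono mult_right_mono) auto
  then show "min a c \<le> a * b + c * (1 - b)" by (simp add: algebra_simps)
  then show "0 < a * b + c * (1 - b)" using assms by (smt (verit) min_def)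
qed

lemma integrable_split:
  assumes "0 < a" "0 < c"
  shows "integrable G (\<lambda>b. 1 / (a * b + c * (1 - b)))"
proof (rule integrable_unit[where K = "1 / min a c"])
  fix b :: real assume "b \<in> {0..1}"
  then show "\<bar>1 / (a * b + c * (1 - b))\<bar> \<le> 1 / min a c"
    using split_denominator[OF assms, of b] assms by (auto intro!: divide_left_mono mult_pos_pos)
qed measurable

lemma nn_integral_split:
  assumes "0 < a" "0 < c"
  shows "(\<integral>\<^sup>+b. ennreal (1 / (a * b + c * (1 - b))) \<partial>G) = ennreal (split_transform a c)"
  unfolding split_transform_def
  by (rule nn_integral_eq_integral[OF integrable_split[OF assms]])
     (auto intro!: AE_I2 simp: space_unit dest!: split_denominator(2)[OF assms, unfolded atLeastAtMost_iff, OF conjI] intro: less_imp_le)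

lemma split_transform_nonneg: "0 < a \<Longrightarrow> 0 < c \<Longrightarrow> 0 \<le> split_transform a c"
  unfolding split_transform_def
  by (rule integral_nonneg_AE) (auto intro!: AE_I2 simp: space_unit intro: less_imp_le[OF split_denominator(2)])

lemma split_transform_scale: "l \<noteq> 0 \<Longrightarrow> split_transform (l * a) (l * c) = split_transform a c / l"
proof -
  assume "l \<noteq> 0"
  have "split_transform (l * a) (l * c) = (\<integral>b. (1 / (a * b + c * (1 - b))) / l \<partial>G)"
    unfolding split_transform_def
    by (rule Bochner_Integration.integral_cong) (auto simp: mult.assoc distrib_left[symmetric])
  also have "\<dots> = split_transform a c / l" unfolding split_transform_def by (rule integral_divide_zero)
  finally show ?thesis .
qed

definition mean :: real where "mean = (\<integral>b. b \<partial>G)"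

text \<open>The error of \<open>1 - h b\<close> as an approximation of \<open>1 / (1 + h b)\<close> is
  \<open>(h b)\<^sup>2 / (1 + h b)\<close>, which is at most \<open>2 h\<^sup>2\<close> for \<open>h\<close>
  between \<open>- 1/2\<close> and \<open>1/2\<close>, uniformly in \<open>b\<close>.\<close>

lemma split_transform_derivative_1: "((\<lambda>a. split_transform a 1) has_real_derivative - mean) (at 1)"
proof -
  have at_1: "split_transform 1 1 = 1" by (simp add: split_transform_def prob_space)
  have bound: "\<bar>(split_transform (1 + h) 1 - split_transform 1 1) / h - (- mean)\<bar> \<le> 2 * \<bar>h\<bar>"
    if h: "h \<noteq> 0" "\<bar>h\<bar> < 1/2" for h
  proof -
    have int1: "integrable G (\<lambda>b. 1 / ((1 + h) * b + 1 * (1 - b)))" using h by (intro integrable_split) auto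
    have int2: "integrable G (\<lambda>b. b)" using integrable_power_unit[of 1] by simp
    have "split_transform (1 + h) 1 - 1 + h * mean =
        (\<integral>b. 1 / ((1 + h) * b + 1 * (1 - b)) - 1 + h * b \<partial>G)"
      using int1 int2 by (simp add: split_transform_def mean_def prob_space)
    also have "\<bar>\<dots>\<bar> \<le> (\<integral>b. 2 * h\<^sup>2 \<partial>G)"
    proof (rule integral_abs_bound[THEN order_trans], rule integral_mono)
      show "integrable G (\<lambda>b. \<bar>1 / ((1 + h) * b + 1 * (1 - b)) - 1 + h * b\<bar>)" using int1 int2 by simp
      fix b assume "b \<in> space G"
      then have b: "0 \<le> b" "b \<le> 1" by (auto simp: space_unit)
      have "\<bar>h * b\<bar> \<le> 1/2 * 1" unfolding abs_mult using h b by (intro mult_mono) auto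
      then have den: "1/2 \<le> 1 + h * b" by linarith
      have "1 / ((1 + h) * b + 1 * (1 - b)) - 1 + h * b = (h * b)\<^sup>2 / (1 + h * b)"
        using den by (simp add: field_simps power2_eq_square)
      then have "\<bar>1 / ((1 + h) * b + 1 * (1 - b)) - 1 + h * b\<bar> = \<bar>(h * b)\<^sup>2 / (1 + h * b)\<bar>" by (rule arg_cong)
      also have "\<dots> = (h * b)\<^sup>2 / (1 + h * b)"
        using den by (intro abs_of_nonneg divide_nonneg_nonneg) auto
      also have "\<dots> \<le> h\<^sup>2 / (1/2)"
      proof (rule frac_le)
        show "(h * b)\<^sup>2 \<le> h\<^sup>2" using b by (simp add: power_mult_distrib mult_left_le power_le_one)
      qed (use den in auto)
      finally show "\<bar>1 / ((1 + h) * b + 1 * (1 - b)) - 1 + h * b\<bar> \<le> 2 * h\<^sup>2" by simp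
    qed simp
    also have "\<dots> = 2 * h\<^sup>2" by (simp add: prob_space)
    finally have *: "\<bar>split_transform (1 + h) 1 - 1 + h * mean\<bar> \<le> 2 * h\<^sup>2" .
    have "(split_transform (1 + h) 1 - split_transform 1 1) / h - (- mean) = (split_transform (1 + h) 1 - 1 + h * mean) / h"
      using h by (simp add: at_1 field_simps)
    also have "\<bar>\<dots>\<bar> \<le> 2 * h\<^sup>2 / \<bar>h\<bar>" using * by (simp add: divide_right_mono)
    also have "\<dots> = 2 * \<bar>h\<bar>" using h by (simp add: power2_eq_square field_simps abs_if)
    finally show ?thesis .
  qed
  have "((\<lambda>h. (split_transform (1 + h) 1 - split_transform 1 1) / h - (- mean)) \<longlongrightarrow> 0) (at 0)"
  proof (rule Lim_null_comparison)
    have "eventually (\<lambda>h. h \<in> ball (0::real) (1/2) - {0}) (at 0)" by (rule eventually_at_in_open) auto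
    then show "eventually (\<lambda>h. norm ((split_transform (1 + h) 1 - split_transform 1 1) / h - (- mean)) \<le> 2 * \<bar>h\<bar>) (at 0)"
      by eventually_elim (use bound in auto)
    have "((\<lambda>h. 2 * \<bar>h\<bar>) \<longlongrightarrow> 2 * \<bar>0::real\<bar>) (at 0)" by (intro tendsto_intros)
    then show "((\<lambda>h. 2 * \<bar>h\<bar>) \<longlongrightarrow> (0::real)) (at 0)" by simp
  qed
  then have "((\<lambda>h. (split_transform (1 + h) 1 - split_transform 1 1) / h) \<longlongrightarrow> - mean) (at 0)"
    by (simp only: Lim_null[symmetric])
  then show ?thesis by (simp add: DERIV_def)
qed

text \<open>The equation at \<open>(x y, y)\<close> and at \<open>(x y, 1)\<close>, combined with homogeneity,
  makes \<open>u(a) = \<phi>(a, 1)\<close> multiplicative. Differentiability at 1 then spreads to the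
  differential equation \<open>u\<^sup>\<prime>(x) = - mean * u(x) / x\<close>.\<close>

lemma split_transform_powr:
  assumes eq: "\<And>a c. 0 < a \<Longrightarrow> 0 < c \<Longrightarrow> split_transform 1 a * split_transform a c * split_transform c 1 = 1 / (a * c)"
    and "0 < a"
  shows "split_transform a 1 = a powr (- mean)"
proof -
  let ?u = "\<lambda>a. split_transform a 1"
  have u1: "?u 1 = 1" by (simp add: split_transform_def prob_space)
  have mult: "?u (x * y) = ?u x * ?u y" if "0 < x" "0 < y" for x y
  proof -
    have "split_transform (x * y) y = ?u x / y"
      using split_transform_scale[of y x 1] that by (simp add: mult.commute)
    then have "split_transform 1 (x * y) * (?u x / y) * ?u y = 1 / (x * y * y)"
      using eq[of "x * y" y] that by simp
    then have 1: "split_transform 1 (x * y) * (?u x * ?u y) = 1 / (x * y)"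
      using that by (simp add: field_simps)
    have 2: "split_transform 1 (x * y) * ?u (x * y) = 1 / (x * y)"
      using eq[of "x * y" 1] that u1 by simp
    then have "split_transform 1 (x * y) \<noteq> 0" using that by auto
    then show ?thesis using 1 2 by (metis mult_left_cancel)
  qed
  have deriv: "(?u has_real_derivative ?u x * (- mean) / x) (at x)" if "0 < x" for x
  proof -
    have "(?u has_real_derivative - mean) (at (x / x))" using that split_transform_derivative_1 by simp
    then have "((\<lambda>z. ?u (z / x)) has_real_derivative - mean * (1 / x)) (at x)"
      by (rule DERIV_chain2) (use that in \<open>auto intro!: derivative_eq_intros\<close>)
    then have "((\<lambda>z. ?u x * ?u (z / x)) has_real_derivative ?u x * (- mean * (1 / x))) (at x)"
      by (rule DERIV_cmult)
    moreover have "eventually (\<lambda>z. ?u x * ?u (z / x) = ?u z) (nhds x)"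
    proof -
      have "eventually (\<lambda>z. z \<in> {0<..}) (nhds x)" using that by (intro eventually_nhds_in_open) auto
      then show ?thesis
        by eventually_elim (use mult[of x] that in \<open>auto simp: mult[symmetric]\<close>)
    qed
    ultimately show ?thesis by (subst (asm) DERIV_cong_ev[OF refl _ refl]) auto
  qed
  \<comment> \<open>The differential equation makes \<open>u(x)\<close> times \<open>x\<close> to the power \<open>mean\<close> constant.\<close>
  have "\<exists>k. \<forall>x\<in>{0<..}. ?u x * x powr mean = k"
  proof (rule has_field_derivative_zero_constant)
    fix x :: real assume "x \<in> {0<..}"
    then have x: "0 < x" by simp
    have "((\<lambda>x. ?u x * x powr mean) has_real_derivative
        ?u x * (- mean) / x * x powr mean + mean * x powr (mean - 1) * ?u x) (at x within {0<..})"
      using has_real_derivative_powr[OF x, of mean] deriv[OF x]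
      by (intro DERIV_mult) (auto intro: has_field_derivative_at_within)
    moreover have "?u x * (- mean) / x * x powr mean + mean * x powr (mean - 1) * ?u x = 0"
      using x by (simp add: powr_diff)
    ultimately show "((\<lambda>x. ?u x * x powr mean) has_real_derivative 0) (at x within {0<..})" by simp
  qed auto
  then obtain k where k: "\<And>x. 0 < x \<Longrightarrow> ?u x * x powr mean = k" by auto
  have "k = 1" using k[of 1] u1 by simp
  then have "?u a * a powr mean = 1" using k \<open>0 < a\<close> by simp
  then show ?thesis using \<open>0 < a\<close> by (simp add: powr_minus field_simps)
qed

text \<open>Compare the geometric expansion of \<open>1 / (1 + s b)\<close>, integrated termwise, with the
  binomial series of \<open>(1 + s)\<close> to the power \<open>- mean\<close>.\<close>

lemma moments_of_split_transform:
  assumes powr: "\<And>a. 0 < a \<Longrightarrow> split_transform a 1 = a powr (- mean)"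
  shows "(\<integral>b. b ^ k \<partial>G) = pochhammer mean k / fact k"
proof -
  have expansion: "(\<lambda>n. (- s) ^ n * (\<integral>b. b ^ n \<partial>G)) sums (1 + s) powr (- mean)" if s: "\<bar>s\<bar> < 1" for s
  proof -
    let ?f = "\<lambda>n b. (- s * b) ^ n"
    have int: "integrable G (?f n)" for n
      using integrable_mult_right[OF integrable_power_unit[of n], of "(- s) ^ n"] by (simp add: power_mult_distrib[symmetric])
    have small: "\<bar>- s * b\<bar> \<le> \<bar>s\<bar>" if "b \<in> {0..1}" for b
      using that by (simp add: abs_mult mult_left_le)
    have "(\<lambda>n. \<integral>b. ?f n b \<partial>G) sums (\<integral>b. (\<Sum>n. ?f n b) \<partial>G)"
    proof (rule sums_integral[OF int])
      show "AE b in G. summable (\<lambda>n. norm (?f n b))"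
      proof (rule AE_I2)
        fix b assume "b \<in> space G"
        then have "norm \<bar>- s * b\<bar> < 1" using small[of b] s by (simp add: space_unit)
        then show "summable (\<lambda>n. norm (?f n b))"
          by (simp only: real_norm_def power_abs summable_geometric)
      qed
      show "summable (\<lambda>n. \<integral>b. norm (?f n b) \<partial>G)"
      proof (rule summable_comparison_test')
        show "summable (\<lambda>n. \<bar>s\<bar> ^ n)" using s by (intro summable_geometric) simp
        fix n
        have "(\<integral>b. norm (?f n b) \<partial>G) \<le> (\<integral>b. \<bar>s\<bar> ^ n \<partial>G)"
        proof (rule integral_mono)
          show "integrable G (\<lambda>b. norm (?f n b))" by (rule integrable_norm[OF int])
          fix b assume "b \<in> space G"
          then have "\<bar>- s * b\<bar> \<le> \<bar>s\<bar>" using small by (simp add: space_unit)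
          then show "norm (?f n b) \<le> \<bar>s\<bar> ^ n"
            unfolding real_norm_def power_abs by (intro power_mono) auto
        qed simp
        then show "norm (\<integral>b. norm (?f n b) \<partial>G) \<le> \<bar>s\<bar> ^ n" by (simp add: prob_space)
      qed
    qed
    also have "(\<integral>b. (\<Sum>n. ?f n b) \<partial>G) = split_transform (1 + s) 1"
      unfolding split_transform_def
    proof (rule Bochner_Integration.integral_cong[OF refl])
      fix b assume "b \<in> space G"
      then have "\<bar>- s * b\<bar> < 1" using small[of b] s by (simp add: space_unit)
      then have "(\<Sum>n. ?f n b) = 1 / (1 - (- s * b))" by (intro suminf_geometric) simp
      then show "(\<Sum>n. ?f n b) = 1 / ((1 + s) * b + 1 * (1 - b))" by (simp add: algebra_simps)
    qed
    also have "\<dots> = (1 + s) powr (- mean)" using s by (intro powr) auto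
    finally show ?thesis by (simp only: power_mult_distrib integral_mult_right_zero)
  qed
  \<comment> \<open>Both expansions converge for all \<open>s\<close> of modulus less than one, so their coefficients agree.\<close>
  have "(- 1) ^ k * (\<integral>b. b ^ k \<partial>G) - ((- mean) gchoose k) = 0"
  proof (rule powser_zero_imp_coeff_zero)
    fix s :: real assume s: "\<bar>s\<bar> < 1"
    have "(\<lambda>n. (- s) ^ n * (\<integral>b. b ^ n \<partial>G) - ((- mean) gchoose n) * s ^ n) sums ((1 + s) powr (- mean) - (1 + s) powr (- mean))"
      by (rule sums_diff[OF expansion[OF s] gen_binomial_real[OF s]])
    moreover have "(- s) ^ n * (\<integral>b. b ^ n \<partial>G) - ((- mean) gchoose n) * s ^ n =
        ((- 1) ^ n * (\<integral>b. b ^ n \<partial>G) - ((- mean) gchoose n)) * s ^ n" for n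
      by (subst power_minus) (simp add: algebra_simps)
    ultimately show "(\<lambda>n. ((- 1) ^ n * (\<integral>b. b ^ n \<partial>G) - ((- mean) gchoose n)) * s ^ n) sums 0" by simp
  qed
  then have "(- 1) ^ k * (\<integral>b. b ^ k \<partial>G) = (- 1) ^ k * (pochhammer mean k / fact k)"
    by (simp add: gbinomial_pochhammer)
  then show ?thesis by (subst (asm) mult_left_cancel) auto
qed

text \<open>A law on the unit interval with mean 0 or 1 is concentrated at that end point.\<close>

lemma mean_bounds_nondegenerate:
  assumes "nondegenerate G"
  shows "0 < mean" "mean < 1"
proof -
  have int: "integrable G (\<lambda>b. b)" using integrable_power_unit[of 1] by simp
  have not_AE: "\<not> (AE b in G. b = x)" if "x \<in> {0..1}" for x
  proof
    assume AE: "AE b in G. b = x"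
    have "{x} \<in> sets G" using that by (auto simp: sets_unit sets_restrict_space_iff)
    then have "measure G {x} = 1" using AE by (subst prob_eq_1) auto
    then show False using assms that by (auto simp: nondegenerate_def space_unit)
  qed
  have "0 \<le> mean" unfolding mean_def by (rule integral_nonneg_AE) (auto simp: space_unit)
  moreover have "mean \<noteq> 0"
  proof
    assume "mean = 0"
    moreover have "AE b in G. 0 \<le> b" by (rule AE_I2) (simp add: space_unit)
    ultimately have "AE b in G. b = 0"
      using integral_nonneg_eq_0_iff_AE[OF int] by (simp add: mean_def)
    then show False using not_AE[of 0] by simp
  qed
  ultimately show "0 < mean" by simp
  have 1: "(\<integral>b. 1 - b \<partial>G) = 1 - mean" using int by (simp add: mean_def prob_space)
  have int': "integrable G (\<lambda>b. 1 - b)" using int by simp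
  have "0 \<le> (\<integral>b. 1 - b \<partial>G)" by (rule integral_nonneg_AE) (auto simp: space_unit)
  moreover have "(\<integral>b. 1 - b \<partial>G) \<noteq> 0"
  proof
    assume "(\<integral>b. 1 - b \<partial>G) = 0"
    moreover have "AE b in G. 0 \<le> 1 - b" by (rule AE_I2) (simp add: space_unit)
    ultimately have "AE b in G. 1 - b = 0"
      using integral_nonneg_eq_0_iff_AE[OF int'] by simp
    then have "AE b in G. b = 1" by eventually_elim simp
    then show False using not_AE[of 1] by simp
  qed
  ultimately show "mean < 1" using 1 by linarith
qed

theorem beta_characterization:
  assumes "\<And>a c. 0 < a \<Longrightarrow> 0 < c \<Longrightarrow> split_transform 1 a * split_transform a c * split_transform c 1 = 1 / (a * c)"
    and "nondegenerate G"
  shows "\<exists>r. 0 < r \<and> r < 1 \<and> G = beta_distribution r (1 - r)"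
proof (intro exI conjI)
  note r = mean_bounds_nondegenerate[OF assms(2)]
  show "0 < mean" "mean < 1" by (fact r)+
  show "G = beta_distribution mean (1 - mean)"
    by (rule unit_interval_law_eqI[OF unit_interval_law_axioms unit_interval_law_beta[OF r]])
       (simp add: beta_moment[OF r] moments_of_split_transform[OF split_transform_powr[OF assms(1)]])
qed

end


section \<open>Three consecutive points of the divided process\<close>

lemma nn_integral_exp_half_line:
  assumes "0 < l"
  shows "(\<integral>\<^sup>+x. ennreal (exp (- (l * x))) * indicator {0<..} x \<partial>lborel) = ennreal (1 / l)"
proof -
  interpret prob_space "density lborel (exponential_density l)"
    by (rule prob_space_exponential_density[OF assms])
  have "1 = (\<integral>\<^sup>+x. ennreal (exponential_density l x) * indicator UNIV x \<partial>lborel)"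
    using emeasure_space_1 by (simp add: emeasure_density)
  also have "\<dots> = (\<integral>\<^sup>+x. ennreal l * (ennreal (exp (- (l * x))) * indicator {0<..} x) \<partial>lborel)"
  proof (rule nn_integral_cong_AE)
    show "AE x in lborel. ennreal (exponential_density l x) * indicator UNIV x =
        ennreal l * (ennreal (exp (- (l * x))) * indicator {0<..} x)"
      using AE_lborel_singleton[of "0::real"]
      by eventually_elim (use assms in \<open>auto simp: exponential_density_def indicator_def ennreal_mult'[symmetric] mult.commute\<close>)
  qed
  also have "\<dots> = ennreal l * (\<integral>\<^sup>+x. ennreal (exp (- (l * x))) * indicator {0<..} x \<partial>lborel)"
    by (rule nn_integral_cmult) measurable
  finally have "ennreal (1 / l) * 1 = ennreal (1 / l) * (ennreal l * (\<integral>\<^sup>+x. ennreal (exp (- (l * x))) * indicator {0<..} x \<partial>lborel))"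
    by (rule arg_cong)
  also have "\<dots> = (\<integral>\<^sup>+x. ennreal (exp (- (l * x))) * indicator {0<..} x \<partial>lborel)"
    using assms by (simp add: mult.assoc[symmetric] ennreal_mult'[symmetric])
  finally show ?thesis by simp
qed

text \<open>For three successive arguments the product is \<open>exp (- s (c\<^sub>1 - c\<^sub>0) - t
  (c\<^sub>2 - c\<^sub>1))\<close> restricted to \<open>c\<^sub>0\<close> in the unit interval. The last
  factor is the middle one with \<open>t\<close> and 0 for \<open>s\<close> and \<open>t\<close>.\<close>

definition laplace_triple :: "real \<Rightarrow> real \<Rightarrow> (real \<Rightarrow> ennreal) list" where
  "laplace_triple s t = [\<lambda>c. indicator {0..1} c * ennreal (exp (s * c)), \<lambda>c. ennreal (exp ((t - s) * c)), \<lambda>c. ennreal (exp ((0 - t) * c))]"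

lemma laplace_triple_measurable: "\<forall>f\<in>set (laplace_triple s t). f \<in> borel_measurable borel"
  by (auto simp: laplace_triple_def)

context poisson_division
begin

sublocale unit: unit_interval_law G
  by unfold_locales (rule sets_G)

text \<open>Integrating over the gap length first leaves \<open>\<gamma> / ((\<gamma> + s) b + (\<gamma> + t)
  (1 - b))\<close>.\<close>

lemma gap_transform:
  assumes "0 < \<gamma> + s" "0 < \<gamma> + t"
  shows "(\<integral>\<^sup>+l. ennreal (\<gamma> * exp (- (\<gamma> * l))) * indicator {0<..} l *
      (\<integral>\<^sup>+b. ennreal (exp (- (l * (s * b + t * (1 - b))))) \<partial>G) \<partial>lborel) =
    ennreal (\<gamma> * unit.split_transform (\<gamma> + s) (\<gamma> + t))"
proof -
  note [measurable] = id_measurable_G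
  interpret pair_sigma_finite G lborel by unfold_locales
  let ?w = "\<lambda>l. ennreal (\<gamma> * exp (- (\<gamma> * l))) * indicator {0<..} l"
  have "(\<integral>\<^sup>+l. ?w l * (\<integral>\<^sup>+b. ennreal (exp (- (l * (s * b + t * (1 - b))))) \<partial>G) \<partial>lborel) =
      (\<integral>\<^sup>+l. \<integral>\<^sup>+b. ?w l * ennreal (exp (- (l * (s * b + t * (1 - b))))) \<partial>G \<partial>lborel)"
    by (intro nn_integral_cong nn_integral_cmult[symmetric]) measurable
  also have "\<dots> = (\<integral>\<^sup>+b. \<integral>\<^sup>+l. ?w l * ennreal (exp (- (l * (s * b + t * (1 - b))))) \<partial>lborel \<partial>G)"
    by (rule Fubini') measurable
  also have "\<dots> = (\<integral>\<^sup>+b. ennreal \<gamma> * ennreal (1 / ((\<gamma> + s) * b + (\<gamma> + t) * (1 - b))) \<partial>G)"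
  proof (rule nn_integral_cong)
    fix b assume "b \<in> space G"
    then have "0 < (\<gamma> + s) * b + (\<gamma> + t) * (1 - b)"
      using unit.split_denominator(2)[OF assms, of b] by (simp add: space_G)
    have "(\<integral>\<^sup>+l. ?w l * ennreal (exp (- (l * (s * b + t * (1 - b))))) \<partial>lborel) =
        (\<integral>\<^sup>+l. ennreal \<gamma> * (ennreal (exp (- (((\<gamma> + s) * b + (\<gamma> + t) * (1 - b)) * l))) * indicator {0<..} l) \<partial>lborel)"
    proof (rule nn_integral_cong)
      fix l
      have "exp (- (\<gamma> * l)) * exp (- (l * (s * b + t * (1 - b)))) = exp (- (((\<gamma> + s) * b + (\<gamma> + t) * (1 - b)) * l))"
        by (simp add: exp_add[symmetric] algebra_simps)
      then show "?w l * ennreal (exp (- (l * (s * b + t * (1 - b))))) =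
          ennreal \<gamma> * (ennreal (exp (- (((\<gamma> + s) * b + (\<gamma> + t) * (1 - b)) * l))) * indicator {0<..} l)"
        using rate_pos by (simp add: indicator_def ennreal_mult'[symmetric] mult.assoc)
    qed
    also have "\<dots> = ennreal \<gamma> * ennreal (1 / ((\<gamma> + s) * b + (\<gamma> + t) * (1 - b)))"
      by (subst nn_integral_cmult) (auto simp: nn_integral_exp_half_line \<open>0 < (\<gamma> + s) * b + (\<gamma> + t) * (1 - b)\<close>)
    finally show "(\<integral>\<^sup>+l. ?w l * ennreal (exp (- (l * (s * b + t * (1 - b))))) \<partial>lborel) =
        ennreal \<gamma> * ennreal (1 / ((\<gamma> + s) * b + (\<gamma> + t) * (1 - b)))" .
  qed
  also have "\<dots> = ennreal \<gamma> * ennreal (unit.split_transform (\<gamma> + s) (\<gamma> + t))"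
    unfolding unit.nn_integral_split[OF assms, symmetric]
    by (rule nn_integral_cmult) measurable
  finally show ?thesis using rate_pos by (simp add: ennreal_mult')
qed

lemma exp_step_division_shift:
  assumes [measurable]: "f \<in> borel_measurable borel" "u \<in> borel_measurable borel"
  shows "exp_step \<gamma> (division_kernel G f) u x =
    (\<integral>\<^sup>+l. ennreal (\<gamma> * exp (- (\<gamma> * l))) * indicator {0<..} l * (\<integral>\<^sup>+b. f (x + b * l) * u (x + l) \<partial>G) \<partial>lborel)"
proof -
  note [measurable] = id_measurable_G
  have [measurable]: "(\<lambda>y. division_kernel G f x y) \<in> borel_measurable borel"
    by (rule borel_kernelD[OF borel_kernel_division_kernel]) auto
  have "exp_step \<gamma> (division_kernel G f) u x = (\<integral>\<^sup>+l. ennreal (\<gamma> * exp (- (\<gamma> * (x + 1 * l - x)))) * indicator {x<..} (x + 1 * l) *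
      (division_kernel G f x (x + 1 * l) * u (x + 1 * l)) \<partial>lborel)"
    unfolding exp_step_def by (subst nn_integral_real_affine[where c = 1 and t = x]) auto
  also have "\<dots> = (\<integral>\<^sup>+l. ennreal (\<gamma> * exp (- (\<gamma> * l))) * indicator {0<..} l * (\<integral>\<^sup>+b. f (x + b * l) * u (x + l) \<partial>G) \<partial>lborel)"
    by (intro nn_integral_cong) (simp add: division_kernel_def nn_integral_multc indicator_def)
  finally show ?thesis .
qed

lemma measurable_gap_mean:
  "(\<lambda>l. \<integral>\<^sup>+b. ennreal (exp (- (l * (s * b + t * (1 - b))))) \<partial>G) \<in> borel_measurable borel"
proof -
  note [measurable] = id_measurable_G
  show ?thesis by measurable
qed

text \<open>Exponential functions are eigenfunctions up to a change of rate: an incoming weight \<open>exp (-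
  t y)\<close> leaves the gap as \<open>exp (- s x)\<close>, and the gap contributes the transform of its two
  parts.\<close>

lemma exp_step_exponential:
  assumes "0 < \<gamma> + s" "0 < \<gamma> + t"
  shows "exp_step \<gamma> (division_kernel G (\<lambda>c. ennreal (exp ((t - s) * c)))) (\<lambda>y. k * ennreal (exp (- (t * y)))) x =
    k * ennreal (\<gamma> * unit.split_transform (\<gamma> + s) (\<gamma> + t)) * ennreal (exp (- (s * x)))"
proof -
  note [measurable] = measurable_gap_mean
  let ?w = "\<lambda>l. ennreal (\<gamma> * exp (- (\<gamma> * l))) * indicator {0<..} l"
  let ?e = "\<lambda>l. \<integral>\<^sup>+b. ennreal (exp (- (l * (s * b + t * (1 - b))))) \<partial>G"
  have "(\<integral>\<^sup>+b. ennreal (exp ((t - s) * (x + b * l))) * (k * ennreal (exp (- (t * (x + l))))) \<partial>G) =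
      k * ennreal (exp (- (s * x))) * ?e l" for l
  proof -
    have "exp ((t - s) * (x + b * l)) * exp (- (t * (x + l))) = exp (- (s * x)) * exp (- (l * (s * b + t * (1 - b))))" for b
      by (simp add: exp_add[symmetric] algebra_simps)
    then have "ennreal (exp ((t - s) * (x + b * l))) * ennreal (exp (- (t * (x + l)))) =
        ennreal (exp (- (s * x))) * ennreal (exp (- (l * (s * b + t * (1 - b)))))" for b
      by (simp add: ennreal_mult'[symmetric])
    then have "ennreal (exp ((t - s) * (x + b * l))) * (k * ennreal (exp (- (t * (x + l))))) =
        k * ennreal (exp (- (s * x))) * ennreal (exp (- (l * (s * b + t * (1 - b)))))" for b
      by (simp only: mult.assoc mult.left_commute)
    moreover have "(\<lambda>b. ennreal (exp (- (l * (s * b + t * (1 - b)))))) \<in> borel_measurable G"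
      by (rule measurable_from_G) measurable
    ultimately show ?thesis by (simp add: nn_integral_cmult)
  qed
  then have "exp_step \<gamma> (division_kernel G (\<lambda>c. ennreal (exp ((t - s) * c)))) (\<lambda>y. k * ennreal (exp (- (t * y)))) x =
      (\<integral>\<^sup>+l. (k * ennreal (exp (- (s * x)))) * (?w l * ?e l) \<partial>lborel)"
    by (subst exp_step_division_shift) (auto intro!: nn_integral_cong simp: mult_ac)
  also have "\<dots> = k * ennreal (exp (- (s * x))) * ennreal (\<gamma> * unit.split_transform (\<gamma> + s) (\<gamma> + t))"
    unfolding gap_transform[OF assms, symmetric] by (rule nn_integral_cmult) measurable
  finally show ?thesis by (simp only: mult_ac)
qed

text \<open>At the first gap the left part carries no exponential weight, and translation invariance of
  Lebesgue measure absorbs the position of the first divided point.\<close>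

lemma nn_integral_exp_step:
  assumes [measurable]: "h \<in> borel_measurable borel" and "0 < \<gamma> + s"
  shows "(\<integral>\<^sup>+x. exp_step \<gamma> (division_kernel G (\<lambda>c. h c * ennreal (exp (s * c)))) (\<lambda>y. k * ennreal (exp (- (s * y)))) x \<partial>lborel) =
    k * integral\<^sup>N lborel h * ennreal (\<gamma> * unit.split_transform \<gamma> (\<gamma> + s))"
proof -
  note [measurable] = id_measurable_G
  interpret GL: pair_sigma_finite G lborel by unfold_locales
  let ?w = "\<lambda>l. ennreal (\<gamma> * exp (- (\<gamma> * l))) * indicator {0<..} l"
  let ?e = "\<lambda>l b. ennreal (exp (- (l * (s * (1 - b)))))"
  have "(h (x + b * l) * ennreal (exp (s * (x + b * l)))) * (k * ennreal (exp (- (s * (x + l))))) =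
      k * (h (x + b * l) * ?e l b)" for x l b
  proof -
    have "exp (s * (x + b * l)) * exp (- (s * (x + l))) = exp (- (l * (s * (1 - b))))"
      by (simp add: exp_add[symmetric] algebra_simps)
    then have "ennreal (exp (s * (x + b * l))) * ennreal (exp (- (s * (x + l)))) = ?e l b"
      by (simp add: ennreal_mult'[symmetric])
    moreover have "(h (x + b * l) * ennreal (exp (s * (x + b * l)))) * (k * ennreal (exp (- (s * (x + l))))) =
        k * (h (x + b * l) * (ennreal (exp (s * (x + b * l))) * ennreal (exp (- (s * (x + l))))))"
      by (simp only: mult_ac)
    ultimately show ?thesis by simp
  qed
  then have "(\<integral>\<^sup>+x. exp_step \<gamma> (division_kernel G (\<lambda>c. h c * ennreal (exp (s * c)))) (\<lambda>y. k * ennreal (exp (- (s * y)))) x \<partial>lborel) =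
      (\<integral>\<^sup>+x. \<integral>\<^sup>+l. ?w l * (\<integral>\<^sup>+b. k * (h (x + b * l) * ?e l b) \<partial>G) \<partial>lborel \<partial>lborel)"
    by (subst exp_step_division_shift) auto
  also have "\<dots> = (\<integral>\<^sup>+l. \<integral>\<^sup>+x. ?w l * (\<integral>\<^sup>+b. k * (h (x + b * l) * ?e l b) \<partial>G) \<partial>lborel \<partial>lborel)"
    by (rule lborel_pair.Fubini') measurable
  also have "\<dots> = (\<integral>\<^sup>+l. (k * integral\<^sup>N lborel h) * (?w l * (\<integral>\<^sup>+b. ?e l b \<partial>G)) \<partial>lborel)"
  proof (rule nn_integral_cong)
    fix l :: real
    have shift: "(\<integral>\<^sup>+x. h (x + b * l) \<partial>lborel) = integral\<^sup>N lborel h" for b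
      using nn_integral_shift[of h "- (b * l)"] by simp
    have "(\<integral>\<^sup>+x. ?w l * (\<integral>\<^sup>+b. k * (h (x + b * l) * ?e l b) \<partial>G) \<partial>lborel) =
        ?w l * (\<integral>\<^sup>+x. \<integral>\<^sup>+b. k * (h (x + b * l) * ?e l b) \<partial>G \<partial>lborel)"
      by (rule nn_integral_cmult) measurable
    also have "(\<integral>\<^sup>+x. \<integral>\<^sup>+b. k * (h (x + b * l) * ?e l b) \<partial>G \<partial>lborel) =
        (\<integral>\<^sup>+b. \<integral>\<^sup>+x. k * (h (x + b * l) * ?e l b) \<partial>lborel \<partial>G)"
      by (rule GL.Fubini') measurable
    also have "\<dots> = (\<integral>\<^sup>+b. (k * integral\<^sup>N lborel h) * ?e l b \<partial>G)"
      by (intro nn_integral_cong) (simp add: nn_integral_cmult nn_integral_multc shift mult.assoc)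
    also have "\<dots> = (k * integral\<^sup>N lborel h) * (\<integral>\<^sup>+b. ?e l b \<partial>G)"
      by (rule nn_integral_cmult) measurable
    finally show "(\<integral>\<^sup>+x. ?w l * (\<integral>\<^sup>+b. k * (h (x + b * l) * ?e l b) \<partial>G) \<partial>lborel) =
        (k * integral\<^sup>N lborel h) * (?w l * (\<integral>\<^sup>+b. ?e l b \<partial>G))" by (simp only: mult.left_commute)
  qed
  also have "\<dots> = (k * integral\<^sup>N lborel h) * (\<integral>\<^sup>+l. ?w l * (\<integral>\<^sup>+b. ?e l b \<partial>G) \<partial>lborel)"
    using measurable_exp_step_weight[of \<gamma> 0] measurable_gap_mean[of 0 s]
    by (intro nn_integral_cmult borel_measurable_times) auto
  also have "(\<integral>\<^sup>+l. ?w l * (\<integral>\<^sup>+b. ?e l b \<partial>G) \<partial>lborel) = ennreal (\<gamma> * unit.split_transform \<gamma> (\<gamma> + s))"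
    using gap_transform[of 0 s] rate_pos assms(2) by simp
  finally show ?thesis .
qed

text \<open>Three divided points involve three gaps of \<open>T\<close>; the middle one is weighted on both of
  its parts, the outer ones on one part only.\<close>

lemma chain_mean_laplace_triple:
  assumes "0 < \<gamma> + s" "0 < \<gamma> + t"
  shows "(\<integral>\<^sup>+x. chain_mean \<gamma> (map (division_kernel G) (laplace_triple s t)) x \<partial>lborel) =
    ennreal (\<gamma> ^ 3 * (unit.split_transform \<gamma> (\<gamma> + s) * unit.split_transform (\<gamma> + s) (\<gamma> + t) * unit.split_transform (\<gamma> + t) \<gamma>))"
proof -
  let ?k2 = "ennreal (\<gamma> * unit.split_transform (\<gamma> + t) \<gamma>)"
  let ?k1 = "ennreal (\<gamma> * unit.split_transform (\<gamma> + s) (\<gamma> + t))"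
  have nil: "chain_mean \<gamma> [] = (\<lambda>y. 1 * ennreal (exp (- (0 * y))))" by auto
  have last: "chain_mean \<gamma> [division_kernel G (\<lambda>c. ennreal (exp ((0 - t) * c)))] = (\<lambda>x. ?k2 * ennreal (exp (- (t * x))))"
    unfolding chain_mean.simps(2) nil fun_eq_iff
    using exp_step_exponential[of t 0 1] rate_pos assms by simp
  have mid: "chain_mean \<gamma> [division_kernel G (\<lambda>c. ennreal (exp ((t - s) * c))), division_kernel G (\<lambda>c. ennreal (exp ((0 - t) * c)))] =
      (\<lambda>x. (?k2 * ?k1) * ennreal (exp (- (s * x))))"
    unfolding chain_mean.simps(2)[of \<gamma> "division_kernel G (\<lambda>c. ennreal (exp ((t - s) * c)))"] last fun_eq_iff
    using exp_step_exponential[of s t ?k2] assms by simp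
  have "(\<integral>\<^sup>+x. chain_mean \<gamma> (map (division_kernel G) (laplace_triple s t)) x \<partial>lborel) =
      ?k2 * ?k1 * integral\<^sup>N lborel (indicator {0..1::real}) * ennreal (\<gamma> * unit.split_transform \<gamma> (\<gamma> + s))"
    unfolding laplace_triple_def list.map chain_mean.simps(2)[of \<gamma> "division_kernel G (\<lambda>c. indicator {0..1} c * ennreal (exp (s * c)))"] mid
    by (rule nn_integral_exp_step) (use assms in auto)
  also have "\<dots> = ennreal (\<gamma> ^ 3 * (unit.split_transform \<gamma> (\<gamma> + s) * unit.split_transform (\<gamma> + s) (\<gamma> + t) * unit.split_transform (\<gamma> + t) \<gamma>))"
    using rate_pos assms unit.split_transform_nonneg
    by (simp add: ennreal_mult'[symmetric] power3_eq_cube mult_ac)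
  finally show ?thesis .
qed

end


section \<open>Invariance forces a beta distribution\<close>

lemma next_point_strict_mono:
  assumes c: "strict_mono c"
  shows "next_point (range c) (c j) = c (j + (1::int))"
proof (rule next_point_eqI)
  show "c j < c (j + 1)" using strict_monoD[OF c] by simp
  show "range c \<inter> {c j<..<c (j + 1)} = {}" using strict_mono_less[OF c] by auto
qed simp

text \<open>A sum over all indices does not depend on the choice of the index origin, and following next
  points recovers any strictly increasing enumeration.\<close>

lemma sum_along_strict_mono:
  assumes c: "strict_mono c" and S: "range c \<in> configs"
  shows "(\<integral>\<^sup>+j. along (\<lambda>f i. f (pt (range c) i)) fs j \<partial>count_space UNIV) =
    (\<integral>\<^sup>+j. along (\<lambda>f i. f (c i)) fs j \<partial>count_space UNIV)"
proof -
  let ?S = "range c" and ?Fs = "map (\<lambda>f x y. f x) fs"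
  have chain_c: "chain ?Fs ?S (c j) = along (\<lambda>f i. f (c i)) fs j" for j
    by (induction fs arbitrary: j) (auto simp: next_point_strict_mono[OF c])
  have "(\<integral>\<^sup>+j. along (\<lambda>f i. f (pt ?S i)) fs j \<partial>count_space UNIV) = (\<integral>\<^sup>+j. chain ?Fs ?S (pt ?S j) \<partial>count_space UNIV)"
    by (simp add: chain_map_eq_along[OF S])
  also have "\<dots> = (\<integral>\<^sup>+x. chain ?Fs ?S x \<partial>count_space ?S)"
    by (rule nn_integral_bij_count_space[OF bij_betw_pt[OF S]])
  also have "\<dots> = (\<integral>\<^sup>+j. chain ?Fs ?S (c j) \<partial>count_space UNIV)"
    by (rule nn_integral_bij_count_space[symmetric]) (use strict_mono_imp_inj_on[OF c] in \<open>simp add: bij_betw_def\<close>)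
  finally show ?thesis by (simp only: chain_c)
qed

context poisson_division
begin

lemma measurable_joint: "measurable (P \<Otimes>\<^sub>M marks) N = measurable (config_space \<Otimes>\<^sub>M marks) N"
  by (intro measurable_cong_sets sets_pair_measure_cong sets_P refl)

lemma joint_space: "w \<in> space (P \<Otimes>\<^sub>M marks) \<Longrightarrow> fst w \<in> configs \<and> (\<forall>j. snd w j \<in> {0..1})"
  by (auto simp: space_pair_measure space_marks)

lemma nn_integral_shifted_law:
  assumes law: "distr (P \<Otimes>\<^sub>M marks) config_space (\<lambda>(T, \<beta>). neighbour_shift \<beta> T) = P"
    and g: "g \<in> borel_measurable config_space"
  shows "(\<integral>\<^sup>+w. g (range (shifted (fst w) (snd w))) \<partial>(P \<Otimes>\<^sub>M marks)) = (\<integral>\<^sup>+S. g S \<partial>P)"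
proof -
  have "(\<integral>\<^sup>+S. g S \<partial>P) = (\<integral>\<^sup>+S. g S \<partial>distr (P \<Otimes>\<^sub>M marks) config_space (\<lambda>(T, \<beta>). neighbour_shift \<beta> T))"
    by (simp only: law)
  also have "\<dots> = (\<integral>\<^sup>+w. g ((\<lambda>(T, \<beta>). neighbour_shift \<beta> T) w) \<partial>(P \<Otimes>\<^sub>M marks))"
    by (rule nn_integral_distr) (simp_all only: measurable_joint measurable_neighbour_shift measurable_distr_eq1 g)
  also have "\<dots> = (\<integral>\<^sup>+w. g (range (shifted (fst w) (snd w))) \<partial>(P \<Otimes>\<^sub>M marks))"
    by (intro nn_integral_cong) (auto dest!: joint_space simp: neighbour_shift_eq_range case_prod_beta)
  finally show ?thesis by simp
qed

text \<open>Each gap contributes one divided point, so the intensity counted with multiplicity is unchanged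
  whatever \<open>G\<close> is.\<close>

lemma shifted_count_mean:
  assumes [measurable]: "A \<in> sets borel"
  shows "(\<integral>\<^sup>+w. \<integral>\<^sup>+j. indicator A (shifted (fst w) (snd w) j) \<partial>count_space UNIV \<partial>(P \<Otimes>\<^sub>M marks)) = ennreal \<gamma> * emeasure lborel A"
proof -
  have nil: "chain_mean \<gamma> [] = (\<lambda>y. 1 * ennreal (exp (- (0 * y))))" by auto
  have "(\<integral>\<^sup>+x. chain_mean \<gamma> [division_kernel G (indicator A)] x \<partial>lborel) =
      (\<integral>\<^sup>+x. exp_step \<gamma> (division_kernel G (\<lambda>c. indicator A c * ennreal (exp (0 * c)))) (\<lambda>y. 1 * ennreal (exp (- (0 * y)))) x \<partial>lborel)"
    unfolding chain_mean.simps(2) nil by simp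
  also have "\<dots> = 1 * integral\<^sup>N lborel (indicator A) * ennreal (\<gamma> * unit.split_transform \<gamma> (\<gamma> + 0))"
    by (rule nn_integral_exp_step) (use rate_pos in auto)
  also have "unit.split_transform \<gamma> (\<gamma> + 0) = 1 / \<gamma>"
    using unit.split_transform_scale[of \<gamma> 1 1] rate_pos by (simp add: unit.split_transform_def G.prob_space)
  finally have "(\<integral>\<^sup>+x. chain_mean \<gamma> [division_kernel G (indicator A)] x \<partial>lborel) = emeasure lborel A"
    using rate_pos by simp
  then show ?thesis
    using shifted_sum_along_expectation[of "[indicator A]"] by simp
qed

text \<open>The number of indices with a divided point in a window is at least the number of distinct divided
  points there. Under invariance both have the same finite mean, so they agree almost surely.\<close>

lemma AE_inj_shifted:
  assumes law: "distr (P \<Otimes>\<^sub>M marks) config_space (\<lambda>(T, \<beta>). neighbour_shift \<beta> T) = P"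
  shows "AE w in P \<Otimes>\<^sub>M marks. inj (shifted (fst w) (snd w))"
proof -
  let ?J = "P \<Otimes>\<^sub>M marks"
  have inj: "AE w in ?J. inj_on (shifted (fst w) (snd w)) {j. shifted (fst w) (snd w) j \<in> {- real n..real n}}" for n :: nat
  proof -
    let ?A = "{- real n..real n}"
    define X where "X w = (\<integral>\<^sup>+j. indicator ?A (shifted (fst w) (snd w) j) \<partial>count_space UNIV)" for w
    define Y where "Y w = (of_nat (card (range (shifted (fst w) (snd w)) \<inter> ?A)) :: ennreal)" for w
    have X_meas: "X \<in> borel_measurable ?J"
      unfolding X_def measurable_joint
      by (intro borel_measurable_nn_integral_countable measurable_compose[OF measurable_shifted]) auto
    have count [measurable]: "(\<lambda>S. of_nat (card (S \<inter> ?A)) :: ennreal) \<in> borel_measurable config_space"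
      by (rule measurable_compose[OF measurable_card]) auto
    have Y_meas: "Y \<in> borel_measurable ?J"
    proof -
      have "(\<lambda>w. of_nat (card ((\<lambda>(T, \<beta>). neighbour_shift \<beta> T) w \<inter> ?A)) :: ennreal) \<in> borel_measurable ?J"
        unfolding measurable_joint by (rule measurable_compose[OF measurable_neighbour_shift count])
      then show ?thesis
        by (rule measurable_cong[THEN iffD1, rotated])
           (auto dest!: joint_space simp: Y_def neighbour_shift_eq_range case_prod_beta)
    qed
    have EX: "(\<integral>\<^sup>+w. X w \<partial>?J) = ennreal (\<gamma> * measure lborel ?A)"
      unfolding X_def by (subst shifted_count_mean) (use rate_pos in \<open>auto simp: ennreal_mult'\<close>)
    have EY: "(\<integral>\<^sup>+w. Y w \<partial>?J) = ennreal (\<gamma> * measure lborel ?A)"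
    proof -
      have "(\<integral>\<^sup>+w. Y w \<partial>?J) = (\<integral>\<^sup>+S. of_nat (card (S \<inter> ?A)) \<partial>P)"
        unfolding Y_def by (rule nn_integral_shifted_law[OF law count])
      also have "\<dots> = (\<integral>\<^sup>+S. of_nat (card (S \<inter> ?A)) * indicator {S \<in> configs. S \<inter> {} = {}} S \<partial>P)"
        by (intro nn_integral_cong) simp
      also have "\<dots> = ennreal (\<gamma> * measure lborel ?A)"
        using mean_count[of ?A "{}"] by simp
      finally show ?thesis .
    qed
    have X_card: "X w = of_nat (card {j. shifted (fst w) (snd w) j \<in> ?A})"
      and finite: "finite {j. shifted (fst w) (snd w) j \<in> ?A}" if "w \<in> space ?J" for w
    proof -
      have w: "fst w \<in> configs" "\<And>j. snd w j \<in> {0..1}" using joint_space[OF that] by auto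
      show fin: "finite {j. shifted (fst w) (snd w) j \<in> ?A}" by (rule finite_shifted_index[OF w])
      have "X w = (\<integral>\<^sup>+j. indicator {j. shifted (fst w) (snd w) j \<in> ?A} j \<partial>count_space UNIV)"
        unfolding X_def by (intro nn_integral_cong) (simp add: indicator_def)
      then show "X w = of_nat (card {j. shifted (fst w) (snd w) j \<in> ?A})" using fin by simp
    qed
    have image: "range c \<inter> ?A = c ` {j. c j \<in> ?A}" for c :: "int \<Rightarrow> real" by auto
    \<comment> \<open>\<open>X\<close> counts indices, \<open>Y\<close> counts distinct points; a coincidence makes \<open>Y\<close> smaller.\<close>
    have le: "AE w in ?J. Y w \<le> X w"
      by (rule AE_I2) (simp add: Y_def X_card image finite card_image_le del: atLeastAtMost_iff)
    have "AE w in ?J. X w \<le> Y w"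
    proof (rule ccontr)
      assume "\<not> (AE w in ?J. X w \<le> Y w)"
      then have "(\<integral>\<^sup>+w. Y w \<partial>?J) < (\<integral>\<^sup>+w. X w \<partial>?J)"
        by (intro nn_integral_less Y_meas X_meas le) (simp_all add: EY)
      then show False using EX EY by simp
    qed
    then show ?thesis
    proof (rule AE_mp, intro AE_I2 impI)
      fix w assume w: "w \<in> space ?J" and "X w \<le> Y w"
      then have "card {j. shifted (fst w) (snd w) j \<in> ?A} \<le> card (shifted (fst w) (snd w) ` {j. shifted (fst w) (snd w) j \<in> ?A})"
        by (simp add: X_card[OF w] Y_def image del: atLeastAtMost_iff)
      then show "inj_on (shifted (fst w) (snd w)) {j. shifted (fst w) (snd w) j \<in> ?A}"
        using finite[OF w] card_image_le[OF finite[OF w]] by (intro eq_card_imp_inj_on antisym) auto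
    qed
  qed
  then have "AE w in ?J. \<forall>n::nat. inj_on (shifted (fst w) (snd w)) {j. shifted (fst w) (snd w) j \<in> {- real n..real n}}"
    by (simp add: AE_all_countable)
  then show ?thesis
  proof eventually_elim
    case (elim w)
    let ?c = "shifted (fst w) (snd w)"
    show ?case
    proof (rule injI)
      fix i j assume eq: "?c i = ?c j"
      obtain n :: nat where "\<bar>?c i\<bar> \<le> real n" using real_arch_simple by blast
      then have "i \<in> {j. ?c j \<in> {- real n..real n}}" "j \<in> {j. ?c j \<in> {- real n..real n}}" using eq by auto
      then show "i = j" using elim eq by (meson inj_onD)
    qed
  qed
qed

text \<open>Once the divided points are distinct, the sum over indices is a functional of the divided point
  set, to which equality in law applies.\<close>

lemma invariance_imp_chain_mean_eq:
  assumes law: "distr (P \<Otimes>\<^sub>M marks) config_space (\<lambda>(T, \<beta>). neighbour_shift \<beta> T) = P"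
    and fs: "\<forall>f\<in>set fs. f \<in> borel_measurable borel"
  shows "(\<integral>\<^sup>+x. chain_mean \<gamma> (map (division_kernel G) fs) x \<partial>lborel) = (\<integral>\<^sup>+x. chain_mean \<gamma> (map (\<lambda>f x y. f x) fs) x \<partial>lborel)"
proof -
  let ?J = "P \<Otimes>\<^sub>M marks"
  let ?H = "\<lambda>S. \<integral>\<^sup>+j. along (\<lambda>f i. f (pt S i)) fs j \<partial>count_space UNIV"
  have H: "?H \<in> borel_measurable config_space"
    by (intro borel_measurable_nn_integral_countable measurable_along measurable_compose[OF measurable_pt]) (use fs in auto)
  have "ennreal \<gamma> * (\<integral>\<^sup>+x. chain_mean \<gamma> (map (division_kernel G) fs) x \<partial>lborel) =
      (\<integral>\<^sup>+w. \<integral>\<^sup>+j. along (\<lambda>f i. f (shifted (fst w) (snd w) i)) fs j \<partial>count_space UNIV \<partial>?J)"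
    by (rule shifted_sum_along_expectation[OF fs, symmetric])
  also have "\<dots> = (\<integral>\<^sup>+w. ?H (range (shifted (fst w) (snd w))) \<partial>?J)"
  proof (rule nn_integral_cong_AE, use AE_inj_shifted[OF law] AE_space in eventually_elim)
    fix w assume inj: "inj (shifted (fst w) (snd w))" and "w \<in> space ?J"
    then have w: "fst w \<in> configs" "\<And>j. snd w j \<in> {0..1}" using joint_space by auto
    have "strict_mono (shifted (fst w) (snd w))"
      using mono_shifted[OF w] inj by (simp add: strict_mono_iff_mono)
    then show "(\<integral>\<^sup>+j. along (\<lambda>f i. f (shifted (fst w) (snd w) i)) fs j \<partial>count_space UNIV) = ?H (range (shifted (fst w) (snd w)))"
      by (rule sum_along_strict_mono[symmetric]) (rule range_shifted_configs[OF w])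
  qed
  also have "\<dots> = (\<integral>\<^sup>+S. ?H S \<partial>P)" by (rule nn_integral_shifted_law[OF law H])
  also have "\<dots> = ennreal \<gamma> * (\<integral>\<^sup>+x. chain_mean \<gamma> (map (\<lambda>f x y. f x) fs) x \<partial>lborel)"
    by (rule points_sum_along_expectation[OF fs])
  finally show ?thesis using rate_pos by (simp add: ennreal_mult_cancel_left)
qed

end

text \<open>The points of \<open>T\<close> are its own divided points for the division concentrated at 0, so
  the computation for general divisions applies.\<close>

lemma (in poisson_law) points_laplace_triple:
  assumes "0 < \<gamma> + s" "0 < \<gamma> + t"
  shows "(\<integral>\<^sup>+x. chain_mean \<gamma> (map (\<lambda>f x y. f x) (laplace_triple s t)) x \<partial>lborel) =
    ennreal (\<gamma>\<^sup>2 / ((\<gamma> + s) * (\<gamma> + t)))"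
proof -
  let ?U = "restrict_space borel {0..1::real}"
  let ?D = "return ?U 0"
  have D: "division_distribution ?D"
    by (auto simp: division_distribution_def space_restrict_space intro!: prob_space_return)
  interpret D: poisson_division P \<gamma> ?D
    by unfold_locales (rule D)
  have kernel: "division_kernel ?D f = (\<lambda>x y. f x)" if [measurable]: "f \<in> borel_measurable borel" for f
  proof (intro ext)
    fix x y
    have "(\<lambda>b. f (x + b * (y - x))) \<in> borel_measurable ?U" by (rule measurable_restrict_space1) measurable
    then show "division_kernel ?D f x y = f x"
      unfolding division_kernel_def by (subst nn_integral_return) (auto simp: space_restrict_space)
  qed
  have transform: "D.unit.split_transform a c = 1 / c" for a c
  proof -
    have "(\<lambda>b. 1 / (a * b + c * (1 - b))) \<in> borel_measurable ?U" by (rule measurable_restrict_space1) measurable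
    then show ?thesis
      unfolding D.unit.split_transform_def by (subst integral_return) (auto simp: space_restrict_space)
  qed
  \<comment> \<open>At every gap the division concentrated at 0 picks the left end point.\<close>
  have map_eq: "map (\<lambda>f x y. f x) (laplace_triple s t) = map (division_kernel ?D) (laplace_triple s t)"
    using laplace_triple_measurable kernel by (intro map_cong) auto
  show ?thesis
    unfolding map_eq
    using D.chain_mean_laplace_triple[OF assms] rate_pos by (simp add: transform power2_eq_square power3_eq_cube)
qed

text \<open>Choosing \<open>s\<close> and \<open>t\<close> so that the rates become \<open>\<gamma> a\<close>
  and \<open>\<gamma> c\<close> removes \<open>\<gamma>\<close> by homogeneity.\<close>

theorem (in poisson_division) invariance_imp_beta:
  assumes law: "distr (P \<Otimes>\<^sub>M marks) config_space (\<lambda>(T, \<beta>). neighbour_shift \<beta> T) = P"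
    and "nondegenerate G"
  shows "\<exists>r. 0 < r \<and> r < 1 \<and> G = beta_distribution r (1 - r)"
proof (rule unit.beta_characterization[OF _ assms(2)])
  fix a c :: real assume ac: "0 < a" "0 < c"
  let ?\<phi> = unit.split_transform
  \<comment> \<open>The rates \<open>\<gamma> + s\<close> and \<open>\<gamma> + t\<close> are prescribed to be \<open>\<gamma> a\<close> and \<open>\<gamma> c\<close>.\<close>
  define s t where "s = \<gamma> * a - \<gamma>" and "t = \<gamma> * c - \<gamma>"
  have st: "\<gamma> + s = \<gamma> * a" "\<gamma> + t = \<gamma> * c" by (auto simp: s_def t_def)
  then have pos: "0 < \<gamma> + s" "0 < \<gamma> + t" using rate_pos ac by auto
  have "ennreal (\<gamma> ^ 3 * (?\<phi> \<gamma> (\<gamma> + s) * ?\<phi> (\<gamma> + s) (\<gamma> + t) * ?\<phi> (\<gamma> + t) \<gamma>)) = ennreal (\<gamma>\<^sup>2 / ((\<gamma> + s) * (\<gamma> + t)))"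
    using invariance_imp_chain_mean_eq[OF law laplace_triple_measurable] chain_mean_laplace_triple[OF pos]
      points_laplace_triple[OF pos] by simp
  then have eq: "\<gamma> ^ 3 * (?\<phi> \<gamma> (\<gamma> * a) * ?\<phi> (\<gamma> * a) (\<gamma> * c) * ?\<phi> (\<gamma> * c) \<gamma>) = \<gamma>\<^sup>2 / ((\<gamma> * a) * (\<gamma> * c))"
    using rate_pos ac unit.split_transform_nonneg unfolding st by (subst (asm) ennreal_inj) auto
  have "?\<phi> \<gamma> (\<gamma> * a) = ?\<phi> 1 a / \<gamma>" "?\<phi> (\<gamma> * c) \<gamma> = ?\<phi> c 1 / \<gamma>" "?\<phi> (\<gamma> * a) (\<gamma> * c) = ?\<phi> a c / \<gamma>"
    using unit.split_transform_scale[of \<gamma> 1 a] unit.split_transform_scale[of \<gamma> c 1] unit.split_transform_scale[of \<gamma> a c] rate_pos by auto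
  with eq show "?\<phi> 1 a * ?\<phi> a c * ?\<phi> c 1 = 1 / (a * c)"
    using rate_pos ac by (simp add: field_simps power2_eq_square power3_eq_cube)
qed

section \<open>The characterization\<close>

lemma (in prob_space) distr_pair_indep_vimage:
  assumes X: "X \<in> M \<rightarrow>\<^sub>M S" and Y: "Y \<in> M \<rightarrow>\<^sub>M N"
    and indep: "indep_set (sets (vimage_algebra (space M) X S)) (sets (vimage_algebra (space M) Y N))"
  shows "distr M (S \<Otimes>\<^sub>M N) (\<lambda>w. (X w, Y w)) = distr M S X \<Otimes>\<^sub>M distr M N Y"
proof (rule pair_measure_eqI[symmetric])
  interpret X: prob_space "distr M S X" by (rule prob_space_distr[OF X])
  interpret Y: prob_space "distr M N Y" by (rule prob_space_distr[OF Y])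
  show "sigma_finite_measure (distr M S X)" "sigma_finite_measure (distr M N Y)" by unfold_locales
  show "sets (distr M S X \<Otimes>\<^sub>M distr M N Y) = sets (distr M (S \<Otimes>\<^sub>M N) (\<lambda>w. (X w, Y w)))"
    by (simp cong: sets_pair_measure_cong)
  fix A B assume "A \<in> sets (distr M S X)" "B \<in> sets (distr M N Y)"
  then have AB: "A \<in> sets S" "B \<in> sets N" by auto
  have "prob ((X -` A \<inter> space M) \<inter> (Y -` B \<inter> space M)) = prob (X -` A \<inter> space M) * prob (Y -` B \<inter> space M)"
    using AB by (intro indep_setD[OF indep] in_vimage_algebra)
  moreover have "(\<lambda>w. (X w, Y w)) -` (A \<times> B) \<inter> space M = (X -` A \<inter> space M) \<inter> (Y -` B \<inter> space M)" by auto
  ultimately show "emeasure (distr M S X) A * emeasure (distr M N Y) B =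
      emeasure (distr M (S \<Otimes>\<^sub>M N) (\<lambda>w. (X w, Y w))) (A \<times> B)"
    using AB X Y by (simp add: emeasure_distr measurable_Pair emeasure_eq_measure ennreal_mult)
qed

theorem corollary1:
  fixes M :: "'w measure" and T :: "'w \<Rightarrow> real set" and \<gamma> :: real
    and G :: "real measure" and b :: "int \<Rightarrow> 'w \<Rightarrow> real"
  assumes "prob_space M"
    and "\<gamma> > 0"
    and "homogeneous_poisson_process M \<gamma> T"
    and "division_distribution G"
    and "nondegenerate G"
    and "prob_space.indep_vars M (\<lambda>_. G) b UNIV"
    and "\<And>n. distr M G (b n) = G"
    and "prob_space.indep_set M
           (sets (vimage_algebra (space M) T config_space))
           (sets (vimage_algebra (space M) (\<lambda>\<omega> n. b n \<omega>) (\<Pi>\<^sub>M n\<in>UNIV. G)))"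
  shows "distr M config_space (\<lambda>\<omega>. neighbour_shift (\<lambda>n. b n \<omega>) (T \<omega>)) = distr M config_space T
     \<longleftrightarrow> (\<exists>r. 0 < r \<and> r < 1 \<and> G = beta_distribution r (1 - r))"
proof -
  interpret M: prob_space M by fact
  let ?P = "distr M config_space T"
  interpret P: poisson_law ?P \<gamma> by (rule poisson_law_distr) fact+
  interpret poisson_division ?P \<gamma> G by unfold_locales fact
  let ?b = "\<lambda>\<omega> n. b n \<omega>"
  have T: "T \<in> M \<rightarrow>\<^sub>M config_space"
    using assms(3) by (simp add: homogeneous_poisson_process_def)
  have b: "b n \<in> M \<rightarrow>\<^sub>M G" for n
    using assms(6) by (simp add: M.indep_vars_def)
  have b_PiM: "?b \<in> M \<rightarrow>\<^sub>M marks" by (rule measurable_PiM_single') (auto simp: b measurable_space[OF b])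
  have "distr M marks (\<lambda>\<omega>. \<lambda>n\<in>UNIV. b n \<omega>) = (\<Pi>\<^sub>M n\<in>UNIV. distr M G (b n))"
    using M.indep_vars_iff_distr_eq_PiM[of UNIV b "\<lambda>_. G"] assms(6) b by simp
  then have marks_law: "distr M marks ?b = marks"
    by (simp add: assms(7) restrict_UNIV)
  have joint_law: "distr M (config_space \<Otimes>\<^sub>M marks) (\<lambda>\<omega>. (T \<omega>, ?b \<omega>)) = ?P \<Otimes>\<^sub>M marks"
    using M.distr_pair_indep_vimage[OF T b_PiM assms(8)] marks_law by simp
  have "distr (?P \<Otimes>\<^sub>M marks) config_space (\<lambda>(T, \<beta>). neighbour_shift \<beta> T) =
      distr M config_space (\<lambda>\<omega>. neighbour_shift (\<lambda>n. b n \<omega>) (T \<omega>))"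
    unfolding joint_law[symmetric]
    by (subst distr_distr) (use measurable_neighbour_shift T b_PiM in \<open>auto simp: comp_def\<close>)
  moreover have "distr (?P \<Otimes>\<^sub>M marks) config_space (\<lambda>(T, \<beta>). neighbour_shift \<beta> T) = ?P
     \<longleftrightarrow> (\<exists>r. 0 < r \<and> r < 1 \<and> G = beta_distribution r (1 - r))"
  proof
    assume "\<exists>r. 0 < r \<and> r < 1 \<and> G = beta_distribution r (1 - r)"
    then obtain r where "0 < r" "r < 1" "G = beta_distribution r (1 - r)" by blast
    then interpret poisson_beta_division ?P \<gamma> G r by unfold_locales
    show "distr (?P \<Otimes>\<^sub>M marks) config_space (\<lambda>(T, \<beta>). neighbour_shift \<beta> T) = ?P"
      by (rule beta_division_preserves_law)
  qed (rule invariance_imp_beta[OF _ assms(5)])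
  ultimately show ?thesis by simp
qed

end
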